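(* Let $n\ge3$ be an odd integer. Then for all integers $k\ge0$ and $m\ge1$, $$\begin{aligned}\lim_{s\to-2n+1-k}(s+2n-1+k)^2\,I_m(s)&=(-1)^{\frac{n-1}{2}}\,\frac{2\pi}{k!}\,\frac{(2n+k-2)!}{(n-1)!^2}\,\frac{\Gamma(k+\frac n2)}{\Gamma(1-\frac n2)^2}\,\frac{\Gamma(n-1+m)^2}{\Gamma(n-1)^2\,\Gamma(m)^2\,\Gamma(\frac{3n}{2}+k-1)}\\&\quad\times{}_4F_3\!\left(\begin{matrix}m+n-1,\ -\frac k2,\ \frac{1-k}{2},\ 1-m\\ n,\ 1-\frac n2-k,\ \frac{n+1}{2}\end{matrix};1\right).\end{aligned}$$ In particular, $\mathcal{W}_2^d=\{-2n+1-k:\ k=0,1,2,\dots\}$.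
   Context: $(a)_\ell=a(a+1)\cdots(a+\ell-1)$ is the Pochhammer symbol, $(a)_0=1$. The generalized hypergeometric series is $${}_pF_q\!\left(\begin{matrix}a_1,\dots,a_p\\ b_1,\dots,b_q\end{matrix};z\right)=\sum_{\ell\ge0}\frac{(a_1)_\ell\cdots(a_p)_\ell}{(b_1)_\ell\cdots(b_q)_\ell}\frac{z^\ell}{\ell!}.$$ For integers $n>2$ and $m\ge0$ put $$S_m(t)=\frac{(n-1)_m}{(\frac n2)_m}\,{}_2F_1\!\left(\begin{matrix}m,\ 1-\frac n2\\ m+\frac n2\end{matrix};t\right),$$ and for $s>-1$ (or $\operatorname{Re}s>-1$) $$I_m(s)=\frac{\Gamma(\frac n2+s+1)}{\Gamma(\frac n2)\,\Gamma(s+1)}\int_0^1t^{m+\frac n2-1}(1-t)^sS_m(t)^2\,dt.$$ The function $I_m$ extends to a meromorphic function on $\mathbb{C}$, still denoted $I_m(s)$ (and $I_0\equiv1$). For $s_0\in\mathbb{C}$ and an integer $r\ge1$, let $c_{-r,m}(s_0)$ be the coefficient of $(s-s_0)^{-r}$ in the Laurent expansion of $I_m$ at $s_0$. The discrete Wallach set $\mathcal{W}_r^d$ (depending on $n$) is the set of $s_0\in\mathbb{C}$ such that $I_m$ has a pole at $s_0$ for some $m$, the numbers $c_{-r,m}(s_0)$, $m\ge0$, are either all nonnegative or all nonpositive, and they are not all zero. *)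

theory Defs
  imports "HOL-Complex_Analysis.Complex_Analysis"
begin

text \<open>
  The value at \<open>z\<close> of the generalized hypergeometric series. The third argument of
  \<^const>\<open>fps_hypergeo\<close> rescales the variable, so it is \<open>1\<close> here.
\<close>
definition hypergeo :: "'a :: {banach, real_normed_field} list \<Rightarrow> 'a list \<Rightarrow> 'a \<Rightarrow> 'a" where
  "hypergeo as bs z = eval_fps (fps_hypergeo as bs 1) z"

lemma hypergeo_altdef:
  "hypergeo as bs z =
     (\<Sum>l. (\<Prod>a\<leftarrow>as. pochhammer a l) / (\<Prod>b\<leftarrow>bs. pochhammer b l) * (z ^ l / fact l))"
proof -
  have "foldl (\<lambda>r a. r * pochhammer a l) c xs = c * (\<Prod>a\<leftarrow>xs. pochhammer a l)"
    for xs :: "'a list" and c l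
    by (induction xs arbitrary: c) (simp_all add: mult.assoc)
  then show ?thesis
    by (simp add: hypergeo_def eval_fps_def)
qed

definition S_fun :: "nat \<Rightarrow> nat \<Rightarrow> real \<Rightarrow> real" where
  "S_fun n m t =
     pochhammer (real n - 1) m / pochhammer (real n / 2) m *
     hypergeo [real m, 1 - real n / 2] [real m + real n / 2] t"

definition I_integral :: "nat \<Rightarrow> nat \<Rightarrow> complex \<Rightarrow> complex" where
  "I_integral n m s =
     Gamma (of_nat n / 2 + s + 1) / (Gamma (of_nat n / 2) * Gamma (s + 1)) *
     integral {0..1} (\<lambda>t.
       of_real (t powr (real m + real n / 2 - 1)) * of_real (1 - t) powr s *
       of_real (S_fun n m t ^ 2))"

text \<open>
  The meromorphic continuation of \<^const>\<open>I_integral\<close>. It is unique, since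
  \<open>nicely_meromorphic_on\<close> fixes the values at poles (to \<open>0\<close>) and excludes removable
  singularities.
\<close>
definition I_fun :: "nat \<Rightarrow> nat \<Rightarrow> complex \<Rightarrow> complex" where
  "I_fun n m = (SOME f. f nicely_meromorphic_on UNIV \<and>
                        (\<forall>s. Re s > -1 \<longrightarrow> f s = I_integral n m s))"

text \<open>\<open>laurent_coeff n r m s0\<close> is \<open>c\<^bsub>-r,m\<^esub>(s0)\<close>.\<close>
definition laurent_coeff :: "nat \<Rightarrow> nat \<Rightarrow> nat \<Rightarrow> complex \<Rightarrow> complex" where
  "laurent_coeff n r m s0 = fls_nth (laurent_expansion (I_fun n m) s0) (- int r)"

definition discrete_Wallach :: "nat \<Rightarrow> nat \<Rightarrow> complex set" where
  "discrete_Wallach n r =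
     {s0. (\<exists>m. is_pole (I_fun n m) s0) \<and>
          ((\<forall>m. laurent_coeff n r m s0 \<in> \<real>\<^sub>\<ge>\<^sub>0) \<or> (\<forall>m. laurent_coeff n r m s0 \<in> \<real>\<^sub>\<le>\<^sub>0)) \<and>
          (\<exists>m. laurent_coeff n r m s0 \<noteq> 0)}"

end

theory Submission
  imports Defs "HOL-Real_Asymp.Real_Asymp"
begin

text \<open>
  Put \<open>x = 1 - t\<close>. Near \<open>x = 0\<close> one has \<open>S\<^sub>m = P(x) + \<kappa> x\<^bsup>n-1\<^esup> ln x \<cdot> F(m+n-1, n/2; n; x)\<close> with \<open>P\<close>
  holomorphic, because \<open>c - a - b = n - 1\<close> is a natural number. The coefficient \<open>\<gamma>\<^sub>j\<close> of \<open>x\<^sup>j (ln x)\<^sup>2\<close> in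
  \<open>t\<^bsup>m+n/2-1\<^esup> S\<^sub>m\<^sup>2\<close> makes the Mellin integral behave like \<open>2 \<gamma>\<^sub>j / (s + j + 1)\<^sup>3\<close>, the logarithm-free and
  simply logarithmic terms give poles of order at most two, and \<open>1 / \<Gamma>(s + 1)\<close> has a simple zero
  there. Hence double poles occur only for \<open>j = 2n - 2 + k\<close>, and their coefficient is the
  \<open>k\<close>-th Taylor coefficient, up to an explicit factor, of \<open>(1 - x)\<^bsup>m+n/2-1\<^esup> F(m+n-1, n/2; n; x)\<^sup>2\<close>. A quadratic transformation combined with
  Clausen's formula turns this into the terminating \<open>\<^sub>4F\<^sub>3\<close>, all of whose terms are nonnegative.
\<close>

subsection \<open>The square of a hypergeometric series as a quadratic series\<close>

text \<open>The weight fits the square. For \<open>a = m + n - 1\<close>, \<open>b = n/2\<close> the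
  lower parameter is \<open>2 b\<close> and the weight exponent \<open>m + n/2 - 1\<close> is
  \<open>a - b\<close>. Because the lower parameter is \<open>2 b\<close>, Pfaff's transformation
  makes \<open>(1 - x)^a F^2\<close> invariant under \<open>x -> x / (x - 1)\<close>, hence a series
  in \<open>w = x^2 / (4 (x - 1))\<close>. The quadratic transformation and Clausen's formula are
  not proved one after the other: a third-order operator annihilates the weighted square,
  annihilates partial sums of the series in \<open>w\<close> up to a defect of high order, and has
  no further power series solution with the same constant term. This comparison is purely formal.

  Oddness of \<open>n\<close> acts twice. It keeps \<open>1 - n/2\<close> off the integers, so the
  logarithm has a nonzero coefficient for \<open>m >= 1\<close>. It also puts the simple poles of
  \<open>Gamma(n/2 + s + 1)\<close> at half-integers, where the Mellin integral is regular, so they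
  cannot contribute to a double pole.

  The sign \<open>(-1)^((n-1)/2)\<close> comes from the reflection formula and is the same for all
  \<open>m >= 1\<close>, which is what the Wallach condition asks. The holomorphic part
  \<open>P\<close> is never computed.\<close>

text \<open>Read \<open>A0\<close>, \<open>B0\<close>, \<open>C0\<close> as \<open>W u^2\<close>,
  \<open>W u u'\<close>, \<open>W u'^2\<close> with \<open>W = (1 - x)^(a-b)\<close>, and the
  indices as orders of differentiation. Over the rational functions these three span a space closed
  under differentiation, so \<open>A0\<close> must satisfy a third-order equation. In an abstract
  integral domain the elimination becomes a polynomial identity.\<close>

lemma symsq_elim:
  fixes X y a b A0 A1 A2 A3 B0 B1 B2 C0 C1 :: "'a::idom"
  assumes y: "y = 1 - X" "y \<noteq> 0"
    and e1: "y * A1 = - (a - b) * A0 + 2 * y * B0"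
    and e2: "y * A2 = A1 - (a - b) * A1 + 2 * y * B1 - 2 * B0"
    and e3: "y * A3 = 2 * A2 - (a - b) * A2 + 2 * y * B2 - 4 * B1"
    and f1: "X * y * B1 = - (a - b) * X * B0 + X * y * C0 - (2 * b - (a + b + 1) * X) * B0 + a * b * A0"
    and f2: "X * y * B2 + (y - X) * B1 = - (a - b) * (B0 + X * B1) + X * y * C1 + (y - X) * C0
               - (2 * b - (a + b + 1) * X) * B1 + (a + b + 1) * B0 + a * b * A1"
    and h1: "X * y * C1 = - (a - b) * X * C0 - 2 * (2 * b - (a + b + 1) * X) * C0 + 2 * a * b * B0"
  shows "X^2 * y^2 * A3 + 3 * (2 * b * X * y^2 - X^2 * y) * A2
     + (X^2 - (a - b)^2 * X^2 + (8 * b^2 - 2 * b) * y^2 - (4 * b^2 + 8 * b) * X * y) * A1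
     + (2 * b^2 - 2 * b * (a - b)^2 * X - 8 * b^3 * y) * A0 = 0" (is "?T = 0")
proof -
  let ?P = "2 * b - (a + b + 1) * X"
  let ?Q = "6 * b * y - (1 + (a - b)) * X"
  let ?R = "- 2 * X + ?Q - y + X - (a - b) * X - ?P"
  let ?S = "X * ?Q * (1 - (a - b)) + 2 * X * y * (a * b)
     + (X^2 - (a - b)^2 * X^2 + (8 * b^2 - 2 * b) * y^2 - (4 * b^2 + 8 * b) * X * y)"
  \<comment> \<open>Elimination certificate: every bracket is the difference of the two sides of a
    hypothesis. The relation \<open>e1\<close> enters only after multiplication by \<open>y\<close>,
    whence the extra factor, which is cancelled at the end.\<close>
  have "y * ?T = y * (X^2 * y * (y * A3 - (2 * A2 - (a - b) * A2 + 2 * y * B2 - 4 * B1))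
     + X * ?Q * (y * A2 - (A1 - (a - b) * A1 + 2 * y * B1 - 2 * B0))
     + 2 * X * y * (X * y * B2 + (y - X) * B1 - (- (a - b) * (B0 + X * B1) + X * y * C1 + (y - X) * C0
               - ?P * B1 + (a + b + 1) * B0 + a * b * A1))
     + 2 * X * y * (X * y * C1 - (- (a - b) * X * C0 - 2 * ?P * C0 + 2 * a * b * B0))
     + 2 * ?R * (X * y * B1 - (- (a - b) * X * B0 + X * y * C0 - ?P * B0 + a * b * A0)))
     + ?S * (y * A1 - (- (a - b) * A0 + 2 * y * B0))"
    unfolding y(1) by algebra
  also have "\<dots> = 0"
    unfolding e1 e2 e3 f1 f2 h1 by simp
  finally show ?thesis
    using y(2) by simp
qed

text \<open>Here \<open>g0\<close> stands for \<open>x^(2l) (1 - x)^(-b-l)\<close> and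
  \<open>h\<close> for its successor. In the variable \<open>w\<close> the operator is of
  hypergeometric type, so it maps a power to a combination of two neighbouring powers. The common
  factor \<open>2 - X\<close> vanishes where \<open>dw/dx = x (x - 2) / (4 (x - 1)^2)\<close>
  does.\<close>

lemma symsq_basis:
  fixes X y a b l g0 g1 g2 g3 h :: "'a::idom"
  assumes y: "y = 1 - X" "y \<noteq> 0"
    and e1: "X * y * g1 = (2 * l + (b - l) * X) * g0"
    and e2: "X * y * g2 + (1 - 2 * X) * g1 = (2 * l + (b - l) * X) * g1 + (b - l) * g0"
    and e3: "X * y * g3 + 2 * (1 - 2 * X) * g2 - 2 * g1 = (2 * l + (b - l) * X) * g2 + 2 * (b - l) * g1"
    and h: "y * h = X^2 * g0"
  shows "X * (X^2 * y^2 * g3 + 3 * (2 * b * X * y^2 - X^2 * y) * g2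
     + (X^2 - (a - b)^2 * X^2 + (8 * b^2 - 2 * b) * y^2 - (4 * b^2 + 8 * b) * X * y) * g1
     + (2 * b^2 - 2 * b * (a - b)^2 * X - 8 * b^3 * y) * g0)
     = (2 - X) * (2 * l * (l + 2 * b - 1) * (2 * l + 2 * b - 1) * g0 + (l + a) * (l + 2 * b - a) * (l + b) * h)"
   (is "X * ?T = ?rhs")
proof -
  let ?q = "2 * l + (b - l) * X"
  let ?Q = "?q - 2 + X + 6 * b * y"
  let ?S = "2 * (b - l + 1) * (X * y) + ?Q * (?q - 1 + 2 * X)
     + (X^2 - (a - b)^2 * X^2 + (8 * b^2 - 2 * b) * y^2 - (4 * b^2 + 8 * b) * X * y)"
  have "y * (X * ?T) - y * ?rhs = 
     X^2 * y^2 * (X * y * g3 + 2 * (1 - 2 * X) * g2 - 2 * g1 - (?q * g2 + 2 * (b - l) * g1))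
     + X * y * ?Q * (X * y * g2 + (1 - 2 * X) * g1 - (?q * g1 + (b - l) * g0))
     + ?S * (X * y * g1 - ?q * g0) - (2 - X) * (l + a) * (l + 2 * b - a) * (l + b) * (y * h - X^2 * g0)"
    unfolding y(1) by algebra
  also have "\<dots> = 0"
    unfolding e1 e2 e3 h by simp
  finally show ?thesis
    using y(2) by simp
qed

section \<open>Hypergeometric and binomial series as formal power series\<close>

abbreviation F21 :: "'a::field_char_0 \<Rightarrow> 'a \<Rightarrow> 'a \<Rightarrow> 'a fps" where
  "F21 a b c \<equiv> fps_hypergeo [a, b] [c] 1"

text \<open>The binomial series of \<open>(1 - x)^(-p)\<close>; note the sign of the
  exponent.\<close>

abbreviation geo_pow :: "'a::field_char_0 \<Rightarrow> 'a fps" where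
  "geo_pow p \<equiv> fps_hypergeo [p] [] 1"

lemma F21_nth: "fps_nth (F21 a b c) n = pochhammer a n * pochhammer b n / (pochhammer c n * fact n)"
  by simp

lemma geo_pow_nth: "fps_nth (geo_pow p) n = pochhammer p n / fact n"
  by simp

lemma pochhammer_neq_0:
  fixes c :: "'a::field_char_0"
  assumes "\<And>j. c \<noteq> - of_nat j"
  shows "pochhammer c n \<noteq> 0"
  using assms by (auto simp: pochhammer_eq_0_iff)

lemma F21_Suc:
  fixes c :: "'a::field_char_0"
  assumes "\<And>j. c \<noteq> - of_nat j"
  shows "(c + of_nat n) * (of_nat n + 1) * fps_nth (F21 a b c) (Suc n)
     = (a + of_nat n) * (b + of_nat n) * fps_nth (F21 a b c) n"
proof -
  have "c + of_nat n \<noteq> 0"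
    using assms[of n] by (metis add_eq_0_iff2)
  moreover have "(1 + of_nat n :: 'a) \<noteq> 0"
    by (metis of_nat_Suc of_nat_eq_0_iff nat.distinct(1))
  moreover have "pochhammer c n \<noteq> 0"
    using assms by (rule pochhammer_neq_0)
  ultimately show ?thesis
    unfolding F21_nth pochhammer_Suc fact_Suc of_nat_Suc by (simp add: divide_simps add.commute)
qed

lemma F21_ode:
  fixes a b c :: "'a::field_char_0"
  assumes "\<And>j. c \<noteq> - of_nat j"
  defines "u \<equiv> F21 a b c"
  shows "fps_X * (1 - fps_X) * fps_deriv (fps_deriv u)
     = - (fps_const c - fps_const (a + b + 1) * fps_X) * fps_deriv u + fps_const (a * b) * u"
proof (rule fps_ext)
  fix n
  have r: "(c + of_nat k) * (of_nat k + 1) * fps_nth u (Suc k) = (a + of_nat k) * (b + of_nat k) * fps_nth u k" for k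
    unfolding u_def using F21_Suc[OF assms(1), of k a b] .
  have "fps_X * (1 - fps_X) * fps_deriv (fps_deriv u) = fps_X * fps_deriv (fps_deriv u) - fps_X * (fps_X * fps_deriv (fps_deriv u))"
    by (simp add: algebra_simps)
  moreover have "- (fps_const c - fps_const (a + b + 1) * fps_X) * fps_deriv u + fps_const (a * b) * u
    = fps_const (a + b + 1) * (fps_X * fps_deriv u) - fps_const c * fps_deriv u + fps_const (a * b) * u"
    by (simp add: algebra_simps)
  ultimately show "fps_nth (fps_X * (1 - fps_X) * fps_deriv (fps_deriv u)) n =
         fps_nth (- (fps_const c - fps_const (a + b + 1) * fps_X) * fps_deriv u + fps_const (a * b) * u) n"
    using r[of n] by (cases n rule: nat.exhaust; cases "n - 1")
      (simp_all add: algebra_simps)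
qed

lemma geo_pow_deriv:
  fixes p :: "'a::field_char_0"
  shows "(1 - fps_X) * fps_deriv (geo_pow p) = fps_const p * geo_pow p"
proof (rule fps_ext)
  fix n
  have r: "of_nat (Suc k) * fps_nth (geo_pow p) (Suc k) = (p + of_nat k) * fps_nth (geo_pow p) k" for k
    unfolding geo_pow_nth pochhammer_Suc by (simp add: field_simps del: of_nat_Suc)
  have "(1 - fps_X) * fps_deriv (geo_pow p) = fps_deriv (geo_pow p) - fps_X * fps_deriv (geo_pow p)"
    by (simp add: algebra_simps)
  then show "fps_nth ((1 - fps_X) * fps_deriv (geo_pow p)) n = fps_nth (fps_const p * geo_pow p) n"
    using r[of n] r[of "n - 1"]  by (cases n) (simp_all add: algebra_simps del: fps_hypergeo_nth)
qed

text \<open>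
  The symmetric square of the hypergeometric equation of \<open>F(a, b; 2b)\<close>, gauged by \<open>(1 - x)\<^bsup>a-b\<^esup>\<close>
  and cleared of denominators.
\<close>

definition symsq_op :: "'a::field_char_0 \<Rightarrow> 'a \<Rightarrow> 'a fps \<Rightarrow> 'a fps" where
  "symsq_op a b f = (let X = fps_X; y = 1 - X; a = fps_const a; b = fps_const b in
     X^2 * y^2 * fps_deriv (fps_deriv (fps_deriv f)) + 3 * (2 * b * X * y^2 - X^2 * y) * fps_deriv (fps_deriv f)
     + (X^2 - (a - b)^2 * X^2 + (8 * b^2 - 2 * b) * y^2 - (4 * b^2 + 8 * b) * X * y) * fps_deriv f
     + (2 * b^2 - 2 * b * (a - b)^2 * X - 8 * b^3 * y) * f)"

lemma symsq_op_add: "symsq_op a b (f + g) = symsq_op a b f + symsq_op a b g"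
  by (simp add: symsq_op_def Let_def algebra_simps)

lemma symsq_op_diff: "symsq_op a b (f - g) = symsq_op a b f - symsq_op a b g"
  by (simp add: symsq_op_def Let_def algebra_simps)

lemma symsq_op_cmult: "symsq_op a b (fps_const k * f) = fps_const k * symsq_op a b f"
  by (simp add: symsq_op_def Let_def algebra_simps)

lemma one_minus_fps_X_neq_0: "(1 - fps_X :: 'a::field_char_0 fps) \<noteq> 0"
proof
  assume "(1 - fps_X :: 'a fps) = 0"
  then have "fps_nth (1 - fps_X :: 'a fps) 0 = 0" by (simp only: fps_zero_nth)
  then show False by simp
qed

text \<open>The second-order equation of \<open>u\<close> and the first-order equation of the gauge
  factor \<open>W = (1 - x)^(a-b)\<close> provide exactly the closed system required by
  \<open>symsq_elim\<close>.\<close>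

lemma symsq_op_F21:
  fixes a b :: "'a::field_char_0"
  assumes "\<And>j. 2 * b \<noteq> - of_nat j"
  shows "symsq_op a b (geo_pow (b - a) * F21 a b (2 * b) ^ 2) = 0"
proof -
  define W where "W = geo_pow (b - a)"
  define u where "u = F21 a b (2 * b)"
  define y :: "'a fps" where "y = 1 - fps_X"
  define A0 where "A0 = W * u^2"
  define B0 where "B0 = W * u * fps_deriv u"
  define C0 where "C0 = W * fps_deriv u ^ 2"
  define a' b' where ab: "a' = fps_const a" "b' = fps_const b"
  have cc: "fps_const (2 * b) = 2 * b'" "fps_const (a + b + 1) = a' + b' + 1" "fps_const (a * b) = a' * b'"
    "fps_const (b - a) = b' - a'"
    by (simp_all add: ab fps_const_add[symmetric] fps_const_mult[symmetric] fps_const_sub[symmetric] numeral_fps_const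
       del: fps_const_add fps_const_mult fps_const_sub)
  have W: "y * fps_deriv W = (b' - a') * W"
    unfolding W_def y_def geo_pow_deriv cc ..
  have u: "fps_X * y * fps_deriv (fps_deriv u) = - (2 * b' - (a' + b' + 1) * fps_X) * fps_deriv u + a' * b' * u"
    unfolding u_def y_def F21_ode[OF assms] cc ..
  have e1: "y * fps_deriv A0 = - (a' - b') * A0 + 2 * y * B0"
  proof -
    have "y * fps_deriv A0 = (y * fps_deriv W) * u^2 + 2 * y * B0"
      by (simp add: A0_def B0_def power2_eq_square algebra_simps)
    then show ?thesis unfolding W A0_def by (simp add: algebra_simps)
  qed
  have f1: "fps_X * y * fps_deriv B0 = - (a' - b') * fps_X * B0 + fps_X * y * C0 - (2 * b' - (a' + b' + 1) * fps_X) * B0 + a' * b' * A0"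
  proof -
    have "fps_X * y * fps_deriv B0 = fps_X * (y * fps_deriv W) * u * fps_deriv u + fps_X * y * C0
           + W * u * (fps_X * y * fps_deriv (fps_deriv u))"
      by (simp add: C0_def B0_def power2_eq_square algebra_simps)
    then show ?thesis unfolding W u A0_def B0_def C0_def by (simp add: algebra_simps power2_eq_square)
  qed
  have h1: "fps_X * y * fps_deriv C0 = - (a' - b') * fps_X * C0 - 2 * (2 * b' - (a' + b' + 1) * fps_X) * C0 + 2 * a' * b' * B0"
  proof -
    have "fps_X * y * fps_deriv C0 = fps_X * (y * fps_deriv W) * fps_deriv u ^ 2
           + 2 * W * fps_deriv u * (fps_X * y * fps_deriv (fps_deriv u))"
      by (simp add: C0_def power2_eq_square algebra_simps)
    then show ?thesis unfolding W u A0_def B0_def C0_def by (simp add: algebra_simps power2_eq_square)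
  qed
  have d0 [simp]: "fps_deriv a' = 0" "fps_deriv b' = 0" "fps_deriv y = -1"
    by (simp_all add: ab y_def)
  \<comment> \<open>The relations \<open>e2\<close>, \<open>e3\<close> and \<open>f2\<close> are
    derivatives of \<open>e1\<close>, \<open>e2\<close> and \<open>f1\<close>.\<close>
  have e2: "y * fps_deriv (fps_deriv A0) = fps_deriv A0 - (a' - b') * fps_deriv A0 + 2 * y * fps_deriv B0 - 2 * B0"
    using arg_cong[OF e1, of fps_deriv] by (simp add: algebra_simps)
  have e3: "y * fps_deriv (fps_deriv (fps_deriv A0)) = 2 * fps_deriv (fps_deriv A0) - (a' - b') * fps_deriv (fps_deriv A0)
      + 2 * y * fps_deriv (fps_deriv B0) - 4 * fps_deriv B0"
    using arg_cong[OF e2, of fps_deriv] by (simp add: algebra_simps)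
  have f2: "fps_X * y * fps_deriv (fps_deriv B0) + (y - fps_X) * fps_deriv B0 = - (a' - b') * (B0 + fps_X * fps_deriv B0)
       + fps_X * y * fps_deriv C0 + (y - fps_X) * C0
       - (2 * b' - (a' + b' + 1) * fps_X) * fps_deriv B0 + (a' + b' + 1) * B0 + a' * b' * fps_deriv A0"
    using arg_cong[OF f1, of fps_deriv] by (simp add: algebra_simps)
  show ?thesis
    using symsq_elim[OF y_def _ e1 e2 e3 f1 f2 h1] one_minus_fps_X_neq_0[where 'a = 'a]
    by (simp add: symsq_op_def Let_def A0_def W_def u_def y_def ab)
qed

text \<open>
  With \<open>w = x\<^sup>2 / (4 (x - 1))\<close> the basis element is \<open>(1 - x)\<^bsup>-b\<^esup> (-4 w)\<^sup>l\<close>, so that \<open>quad_coeff\<close> below consists of the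
  coefficients of \<open>(1 - x)\<^bsup>-b\<^esup> \<cdot> \<^sub>3F\<^sub>2(a, 2b - a, b; 2b, b + 1/2; w)\<close>.
\<close>

definition quad_basis :: "'a::field_char_0 \<Rightarrow> nat \<Rightarrow> 'a fps" where
  "quad_basis b l = fps_X ^ (2 * l) * geo_pow (b + of_nat l)"

lemma geo_pow_Suc: "(1 - fps_X) * geo_pow (p + 1) = geo_pow (p :: 'a::field_char_0)"
proof (rule fps_ext)
  fix n
  have "fps_nth (geo_pow (p + 1)) (Suc k) - fps_nth (geo_pow (p + 1)) k = fps_nth (geo_pow p) (Suc k)" for k
  proof -
    have "pochhammer p (Suc k) = p * pochhammer (p + 1) k" 
      by (simp add: pochhammer_rec)
    then show ?thesis
      unfolding geo_pow_nth by (simp add: pochhammer_Suc field_simps del: of_nat_Suc) (simp add: algebra_simps)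
  qed
  then show "fps_nth ((1 - fps_X) * geo_pow (p + 1)) n = fps_nth (geo_pow p) n"
    by (cases n) (simp_all add: algebra_simps del: fps_hypergeo_nth) 
qed

lemma symsq_op_quad_basis:
  fixes a b :: "'a::field_char_0"
  shows "fps_X * symsq_op a b (quad_basis b l) =
     (2 - fps_X) * (fps_const (2 * of_nat l * (of_nat l + 2 * b - 1) * (2 * of_nat l + 2 * b - 1)) * quad_basis b l
       + fps_const ((of_nat l + a) * (of_nat l + 2 * b - a) * (of_nat l + b)) * quad_basis b (Suc l))"
proof -
  define y :: "'a fps" where "y = 1 - fps_X"
  define a' b' l' :: "'a fps" where ab: "a' = fps_const a" "b' = fps_const b" "l' = fps_const (of_nat l)"
  define g0 where "g0 = quad_basis b l"
  have d0 [simp]: "fps_deriv a' = 0" "fps_deriv b' = 0" "fps_deriv y = -1" "fps_deriv l' = 0"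
    by (simp_all add: ab y_def)
  have XD: "fps_X * fps_deriv (fps_X ^ k :: 'a fps) = of_nat k * fps_X ^ k" for k
    by (induction k) (simp_all add: algebra_simps)
  have e1: "fps_X * y * fps_deriv g0 = (2 * l' + (b' - l') * fps_X) * g0"
  proof -
    have "fps_X * y * fps_deriv g0 = y * (fps_X * fps_deriv (fps_X ^ (2 * l))) * geo_pow (b + of_nat l)
        + fps_X * fps_X ^ (2 * l) * (y * fps_deriv (geo_pow (b + of_nat l)))"
      unfolding g0_def quad_basis_def fps_deriv_mult by (simp add: algebra_simps)
    also have "\<dots> = y * of_nat (2 * l) * g0 + fps_X * (b' + l') * g0"
      unfolding XD y_def geo_pow_deriv by (simp add: g0_def quad_basis_def ab algebra_simps flip: fps_const_add)
    also have "\<dots> = (2 * l' + (b' - l') * fps_X) * g0"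
      by (simp add: ab y_def fps_of_nat algebra_simps)
    finally show ?thesis .
  qed
  have e2: "fps_X * y * fps_deriv (fps_deriv g0) + (1 - 2 * fps_X) * fps_deriv g0
      = (2 * l' + (b' - l') * fps_X) * fps_deriv g0 + (b' - l') * g0"
    using arg_cong[OF e1, of fps_deriv] by (simp add: algebra_simps) (simp add: y_def algebra_simps)
  have e3: "fps_X * y * fps_deriv (fps_deriv (fps_deriv g0)) + 2 * (1 - 2 * fps_X) * fps_deriv (fps_deriv g0) - 2 * fps_deriv g0
      = (2 * l' + (b' - l') * fps_X) * fps_deriv (fps_deriv g0) + 2 * (b' - l') * fps_deriv g0"
    using arg_cong[OF e2, of fps_deriv] by (simp add: algebra_simps) (simp add: y_def algebra_simps)
  have h: "y * quad_basis b (Suc l) = fps_X ^ 2 * g0"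
  proof -
    have "y * quad_basis b (Suc l) = fps_X ^ 2 * (fps_X ^ (2 * l) * (y * geo_pow (b + of_nat l + 1)))"
      by (simp add: quad_basis_def power2_eq_square add_ac mult_ac)
    then show ?thesis
      unfolding y_def geo_pow_Suc by (simp add: g0_def quad_basis_def)
  qed
  have "2 = fps_const (2::'a)" by (simp add: numeral_fps_const)
  then have cc: "fps_const (2 * of_nat l * (of_nat l + 2 * b - 1) * (2 * of_nat l + 2 * b - 1))
     = 2 * l' * (l' + 2 * b' - 1) * (2 * l' + 2 * b' - 1)"
    "fps_const ((of_nat l + a) * (of_nat l + 2 * b - a) * (of_nat l + b))
     = (l' + a') * (l' + 2 * b' - a') * (l' + b')"
    by (simp_all add: ab fps_const_add[symmetric] fps_const_mult[symmetric] fps_const_sub[symmetric]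
       del: fps_const_add fps_const_mult fps_const_sub)
  show ?thesis
    using symsq_basis[OF y_def _ e1 e2 e3 h, of a'] one_minus_fps_X_neq_0[where 'a = 'a]
    unfolding cc by (simp add: symsq_op_def Let_def y_def ab g0_def)
qed


text \<open>Each summand is a scalar times a power of \<open>fps_X\<close> times a derivative, so
  that a single coefficient of the image can be read off.\<close>

lemma symsq_op_expand:
  fixes f :: "'a::field_char_0 fps"
  shows "symsq_op a b f =
    fps_X^2 * fps_deriv (fps_deriv (fps_deriv f)) - fps_const 2 * (fps_X^3 * fps_deriv (fps_deriv (fps_deriv f)))
    + fps_X^4 * fps_deriv (fps_deriv (fps_deriv f))
    + fps_const (6 * b) * (fps_X * fps_deriv (fps_deriv f)) - fps_const (12 * b + 3) * (fps_X^2 * fps_deriv (fps_deriv f))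
    + fps_const (6 * b + 3) * (fps_X^3 * fps_deriv (fps_deriv f))
    + fps_const (8 * b^2 - 2 * b) * fps_deriv f - fps_const (20 * b^2 + 4 * b) * (fps_X * fps_deriv f)
    + fps_const (1 - (a - b)^2 + 12 * b^2 + 6 * b) * (fps_X^2 * fps_deriv f)
    + fps_const (2 * b^2 - 8 * b^3) * f + fps_const (8 * b^3 - 2 * b * (a - b)^2) * (fps_X * f)"
proof -
  define a' b' where ab: "a' = fps_const a" "b' = fps_const b"
  have "2 = fps_const (2::'a)" "3 = fps_const (3::'a)" "4 = fps_const (4::'a)" "6 = fps_const (6::'a)" "8 = fps_const (8::'a)"
     "12 = fps_const (12::'a)" "20 = fps_const (20::'a)"
    by (simp_all add: numeral_fps_const)
  then have cc: "fps_const 2 = (2 :: 'a fps)" "fps_const (6 * b) = 6 * b'" "fps_const (12 * b + 3) = 12 * b' + 3" "fps_const (6 * b + 3) = 6 * b' + 3"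
    "fps_const (8 * b^2 - 2 * b) = 8 * b'^2 - 2 * b'" "fps_const (20 * b^2 + 4 * b) = 20 * b'^2 + 4 * b'"
    "fps_const (1 - (a - b)^2 + 12 * b^2 + 6 * b) = 1 - (a' - b')^2 + 12 * b'^2 + 6 * b'"
    "fps_const (2 * b^2 - 8 * b^3) = 2 * b'^2 - 8 * b'^3" "fps_const (8 * b^3 - 2 * b * (a - b)^2) = 8 * b'^3 - 2 * b' * (a' - b')^2"
    by (simp_all add: ab fps_const_add[symmetric] fps_const_mult[symmetric] fps_const_sub[symmetric] fps_const_power[symmetric]
       del: fps_const_add fps_const_mult fps_const_sub fps_const_power)
  show ?thesis
    unfolding cc symsq_op_def Let_def ab(1,2)[symmetric] by algebra
qed

text \<open>
  The indicial polynomial has no positive root, so a power series solution is determined by its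
  constant term.
\<close>

lemma symsq_op_lowest:
  fixes f :: "'a::field_char_0 fps"
  assumes "\<And>j. j \<le> k \<Longrightarrow> fps_nth f j = 0"
  shows "fps_nth (symsq_op a b f) k = (of_nat k + 1) * (of_nat k + 2 * b) * (of_nat k + 4 * b - 1) * fps_nth f (Suc k)"
proof -
  \<comment> \<open>Multiplication by powers of \<open>fps_X\<close> shifts indices by truncated
    subtraction, so the two lowest coefficients are treated separately.\<close>
  consider "k = 0" | "k = 1" | i where "k = Suc (Suc i)"
    by (metis One_nat_def not0_implies_Suc)
  then show ?thesis
  proof cases
    case 1
    then show ?thesis using assms[of 0]
      by (simp add: symsq_op_expand algebra_simps power2_eq_square)
  next
    case 2
    then show ?thesis using assms[of 0] assms[of 1]
      by (simp add: symsq_op_expand fps_X_power_mult_nth algebra_simps power2_eq_square)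
  next
    case 3
    have [simp]: "fps_nth f i = 0" "fps_nth f (Suc i) = 0" "fps_nth f (Suc (Suc i)) = 0"
      using assms 3 by auto
    have [simp]: "i \<noteq> 0 \<Longrightarrow> fps_nth f (Suc (i - Suc 0)) = 0" "\<not> i < Suc (Suc 0) \<Longrightarrow> fps_nth f (Suc (Suc (Suc (i - Suc (Suc 0))))) = 0"
       "fps_nth f (Suc (Suc (i - Suc 0))) = 0"  "fps_nth f (Suc (Suc (i - 2))) = 0" "i > 0 \<Longrightarrow> fps_nth f (Suc (Suc (Suc (i - Suc 0)))) = 0"
      using assms 3 by auto
    show ?thesis unfolding 3
      by (auto simp: symsq_op_expand fps_X_power_mult_nth fps_X_power_mult_right_nth algebra_simps power2_eq_square numeral_3_eq_3)
  qed
qed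

definition quad_coeff :: "'a::field_char_0 \<Rightarrow> 'a \<Rightarrow> nat \<Rightarrow> 'a" where
  "quad_coeff a b l = pochhammer a l * pochhammer (2 * b - a) l * pochhammer b l * (-1/4) ^ l
     / (pochhammer (2 * b) l * pochhammer (b + 1/2) l * fact l)"

text \<open>This two-term recurrence makes the contributions of neighbouring basis elements in
  \<open>symsq_op_quad_basis\<close> cancel; the polynomial factors are the ones occurring
  there.\<close>

lemma quad_coeff_Suc:
  fixes a b :: "'a::field_char_0"
  assumes "\<And>j. 2 * b \<noteq> - of_nat j"
  shows "2 * of_nat (Suc l) * (of_nat (Suc l) + 2 * b - 1) * (2 * of_nat (Suc l) + 2 * b - 1) * quad_coeff a b (Suc l)
     = - ((of_nat l + a) * (of_nat l + 2 * b - a) * (of_nat l + b) * quad_coeff a b l)"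
proof -
  have *: "b + 1/2 \<noteq> - of_nat j" for j
  proof
    assume "b + 1/2 = - of_nat j"
    moreover have "2 * b = 2 * (b + 1/2) - 1" by simp
    ultimately have "2 * b = - of_nat (2 * j + 1)" by (simp only: of_nat_add of_nat_mult) simp
    with assms show False by blast
  qed
  have "pochhammer (2 * b) l \<noteq> 0" "pochhammer (b + 1/2) l \<noteq> 0"
    using assms * by (auto intro!: pochhammer_neq_0)
  moreover have "2 * b + of_nat l \<noteq> 0" "b + 1/2 + of_nat l \<noteq> 0"
    using assms[of l] *[of l] by (metis add_eq_0_iff2)+
  moreover have "(1 + of_nat l :: 'a) \<noteq> 0"
    by (metis of_nat_Suc of_nat_eq_0_iff nat.distinct(1))
  moreover define P where "P = (of_nat l + a) * (of_nat l + 2 * b - a) * (of_nat l + b)"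
  moreover have "pochhammer a (Suc l) * pochhammer (2 * b - a) (Suc l) * pochhammer b (Suc l)
     = P * (pochhammer a l * pochhammer (2 * b - a) l * pochhammer b l)"
    unfolding P_def pochhammer_Suc by (simp add: algebra_simps)
  moreover have "2 * of_nat (Suc l) * (of_nat (Suc l) + 2 * b - 1) * (2 * of_nat (Suc l) + 2 * b - 1) 
     = 4 * (1 + of_nat l) * (2 * b + of_nat l) * (b + 1/2 + of_nat l)"
    by (simp add: algebra_simps)
  moreover have "4 * x1 * x2 * x3 * (P * d * (- 1/4 * e) / ((u * x2) * (v * x3) * (x1 * w))) = - (P * (d * e / (u * v * w)))"
    if "x1 \<noteq> 0" "x2 \<noteq> 0" "x3 \<noteq> 0" "u \<noteq> 0" "v \<noteq> 0" "w \<noteq> 0" for x1 x2 x3 d e u v w :: 'a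
    using that by (simp add: divide_simps)
  ultimately show ?thesis
    unfolding quad_coeff_def P_def[symmetric] pochhammer_Suc[of "2 * b"] pochhammer_Suc[of "b + 1/2"] fact_Suc of_nat_Suc[of l] power_Suc
    by (simp only: fact_nonzero simp_thms)
qed

text \<open>Both sides have constant term 1, and the operator separates their difference from zero
  at its lowest coefficient: the two conditions on \<open>b\<close> say that the indicial polynomial
  does not vanish at positive integers. A partial sum suffices because \<open>quad_basis b l\<close>
  starts at \<open>x^(2 l)\<close>.\<close>

theorem F21_square_quadratic:
  fixes a b :: "'a::field_char_0"
  assumes b: "\<And>j. 2 * b \<noteq> - of_nat j" "\<And>j. 4 * b \<noteq> 1 - of_nat j" and k: "k < 2 * N"
  shows "fps_nth (geo_pow (b - a) * F21 a b (2 * b) ^ 2) k = (\<Sum>l<N. quad_coeff a b l * fps_nth (quad_basis b l) k)"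
proof -
  define A where "A = geo_pow (b - a) * F21 a b (2 * b) ^ 2"
  define G where "G N = (\<Sum>l<N. fps_const (quad_coeff a b l) * quad_basis b l)" for N
  define s where "s l = 2 * of_nat l * (of_nat l + 2 * b - 1) * (2 * of_nat l + 2 * b - 1)" for l
  define r where "r l = (of_nat l + a) * (of_nat l + 2 * b - a) * (of_nat l + b)" for l
  have s: "s (Suc l) * quad_coeff a b (Suc l) = - (r l * quad_coeff a b l)" for l
    unfolding s_def r_def by (rule quad_coeff_Suc[OF b(1)])
  \<comment> \<open>Telescoping: the defect of a partial sum comes from its last term alone and has
    no coefficient below \<open>x^(2 N)\<close>.\<close>
  have M: "fps_X * symsq_op a b (G N) = - (2 - fps_X) * (fps_const (s N * quad_coeff a b N) * quad_basis b N)" for N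
  proof (induction N)
    case 0
    show ?case by (simp add: G_def s_def symsq_op_def Let_def)
  next
    case (Suc N)
    have "fps_X * symsq_op a b (G (Suc N)) = fps_X * symsq_op a b (G N)
        + fps_const (quad_coeff a b N) * (fps_X * symsq_op a b (quad_basis b N))"
      by (simp only: G_def sum.lessThan_Suc symsq_op_add symsq_op_cmult distrib_left mult.left_commute)
    also have "\<dots> = - (2 - fps_X) * (fps_const (s N * quad_coeff a b N) * quad_basis b N)
       + fps_const (quad_coeff a b N) * ((2 - fps_X) * (fps_const (s N) * quad_basis b N + fps_const (r N) * quad_basis b (Suc N)))"
      unfolding Suc.IH symsq_op_quad_basis s_def r_def ..
    also have "\<dots> = (2 - fps_X) * (fps_const (r N * quad_coeff a b N) * quad_basis b (Suc N))"
      unfolding fps_const_mult[symmetric] by (simp add: algebra_simps del: fps_const_mult)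
    also have "r N * quad_coeff a b N = - (s (Suc N) * quad_coeff a b (Suc N))"
      using s[of N] by simp
    finally show ?case 
      by (simp add: algebra_simps flip: fps_const_neg)
  qed
  \<comment> \<open>Strong induction on the index. If all lower coefficients of the difference
    vanish, the next one times a nonzero indicial value is a coefficient of the image, which is zero
    below the defect.\<close>
  have *: "fps_nth (A - G N) k = 0" if "k < 2 * N" for k N
    using that
  proof (induction k rule: less_induct)
    case (less k)
    show ?case
    proof (cases k)
      case 0
      have "G N $ 0 = (\<Sum>l<N. if l = 0 then 1 else 0)"
        unfolding G_def fps_sum_nth
        by (intro sum.cong) (auto simp: quad_basis_def quad_coeff_def)
      also have "\<dots> = 1" using less.prems by simp
      finally show ?thesis using 0 by (simp add: A_def fps_square_nth)
    next
      case (Suc j)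
      have low: "fps_nth (A - G N) i = 0" if "i \<le> j" for i
        using less.IH[of i] less.prems that Suc by simp
      have "symsq_op a b A = 0"
        unfolding A_def by (rule symsq_op_F21[OF b(1)])
      then have "fps_X * symsq_op a b (A - G N) = (2 - fps_X) * (fps_const (s N * quad_coeff a b N) * quad_basis b N)"
        using M[of N] by (simp add: symsq_op_diff algebra_simps)
      also have "\<dots> = fps_X ^ (2 * N) * ((2 - fps_X) * fps_const (s N * quad_coeff a b N) * geo_pow (b + of_nat N))"
        by (simp add: quad_basis_def algebra_simps)
      finally have "fps_nth (fps_X * symsq_op a b (A - G N)) (Suc j) = 0"
        using less.prems Suc by (simp add: fps_X_power_mult_nth del: fps_hypergeo_nth)
      then have "fps_nth (symsq_op a b (A - G N)) j = 0" by simp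
      then have "(of_nat j + 1) * (of_nat j + 2 * b) * (of_nat j + 4 * b - 1) * fps_nth (A - G N) k = 0"
        using symsq_op_lowest[OF low, where a = a and b = b] Suc by simp
      moreover have "of_nat j + 1 \<noteq> (0 :: 'a)"
        by (metis of_nat_Suc of_nat_eq_0_iff nat.distinct(1) add.commute)
      moreover have "of_nat j + 2 * b \<noteq> 0"
        using b(1)[of j] by (metis add_eq_0_iff add.commute)
      moreover have "of_nat j + 4 * b - 1 \<noteq> 0"
        using b(2)[of j] by (auto simp: algebra_simps)
      ultimately show ?thesis by simp
    qed
  qed
  have "fps_nth A k = fps_nth (G N) k"
    using *[OF k] by simp
  then show ?thesis
    by (simp add: A_def G_def fps_sum_nth del: fps_hypergeo_nth)
qed


section \<open>Taylor coefficients of the weighted square as a terminating 4F3\<close>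

lemma pochhammer_neg_nat:
  "pochhammer (- of_nat k :: 'a::field_char_0) j = (if j \<le> k then (-1) ^ j * fact k / fact (k - j) else 0)"
proof (induction j)
  case (Suc j)
  show ?case
  proof (cases "Suc j \<le> k")
    case True
    then obtain i where i: "k = Suc (i + j)"
      by (metis add.commute add_Suc le_Suc_ex)
    have "(of_nat (Suc i) :: 'a) \<noteq> 0"
      using of_nat_neq_0 by blast
    then show ?thesis using Suc i by (simp add: pochhammer_Suc divide_simps del: of_nat_Suc) (simp add: algebra_simps)
  next
    case False
    then show ?thesis using Suc by (cases "j = k") (auto simp: pochhammer_Suc)
  qed
qed simp

text \<open>The duplication \<open>(-k)_(2l) = 4^l (-k/2)_l ((1-k)/2)_l\<close> turns the quotient
  \<open>k! / (k - 2 l)!\<close> into the two half-parameters, and reversing the product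
  \<open>(b + k - l)_l\<close> yields the parameter \<open>1 - b - k\<close>. The prefactor is the
  value for \<open>l = 0\<close>.\<close>

lemma quad_coeff_basis_nth:
  fixes a b :: "'a::field_char_0"
  assumes b: "\<And>j. b \<noteq> - of_nat j"
  shows "quad_coeff a b l * fps_nth (quad_basis b l) k = pochhammer b k / fact k *
     (pochhammer a l * pochhammer (- of_nat k / 2) l * pochhammer ((1 - of_nat k) / 2) l * pochhammer (2 * b - a) l
      / (pochhammer (2 * b) l * pochhammer (1 - b - of_nat k) l * pochhammer (b + 1/2) l * fact l))"
proof -
  have "pochhammer (2 * (- of_nat k / 2)) (2 * l) = (4 :: 'a) ^ l * (pochhammer (- of_nat k / 2) l * pochhammer (- of_nat k / 2 + 1 / 2) l)"
    by (subst pochhammer_double) (simp add: power_mult)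
  moreover have "- of_nat k / 2 + 1 / 2 = (1 - of_nat k :: 'a) / 2" "2 * (- of_nat k / 2) = (- of_nat k :: 'a)"
    by (simp_all add: field_simps)
  ultimately have p: "pochhammer (- of_nat k) (2 * l) = (4 :: 'a) ^ l * (pochhammer (- of_nat k / 2) l * pochhammer ((1 - of_nat k) / 2) l)"
    by (simp only:)
  show ?thesis
  proof (cases "2 * l \<le> k")
    case True
    then obtain i where i: "k = 2 * l + i" by (metis le_Suc_ex)
    have e1: "pochhammer b k = pochhammer b l * pochhammer (b + of_nat l) i * pochhammer (b + of_nat (l + i)) l"
      unfolding i using pochhammer_product'[of b "l + i" l] pochhammer_product'[of b l i]
      by (simp add: mult_2 mult_2_right ac_simps)
    have e2: "pochhammer (1 - b - of_nat k) l = (-1) ^ l * pochhammer (b + of_nat (l + i)) l"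
      using pochhammer_minus[of "b + of_nat k - 1" l] by (simp add: i algebra_simps)
    have "pochhammer b k \<noteq> 0" using b by (rule pochhammer_neq_0)
    then have nz: "pochhammer (b + of_nat (l + i)) l \<noteq> 0" unfolding e1 by (simp del: pochhammer_eq_0_iff)
    have "4 ^ l * (pochhammer (- of_nat k / 2) l * pochhammer ((1 - of_nat k) / 2) l) = (fact k / fact i :: 'a)"
      unfolding p[symmetric] pochhammer_neg_nat using True by (simp add: i)
    then have e3: "pochhammer (- of_nat k / 2) l * pochhammer ((1 - of_nat k) / 2) l = (fact k / (4 ^ l * fact i) :: 'a)"
      by (simp add: field_simps)
    have e4: "fps_nth (quad_basis b l) k = pochhammer (b + of_nat l) i / fact i"
      using True i by (simp add: quad_basis_def fps_X_power_mult_nth)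
    have e5: "(-1/4 :: 'a) ^ l = (-1) ^ l / 4 ^ l"
      by (simp only: power_divide)
    have "(-1 :: 'a) ^ l = 1 \<or> (-1 :: 'a) ^ l = -1"
      using neg_one_even_power neg_one_odd_power by blast
    moreover have "pa * pc * \<beta> * (e / q) / (u * v * w) * (\<gamma> / f) = \<beta> * \<gamma> * \<delta> / g * (pa * (g / (q * f)) * pc / (u * (e * \<delta>) * v * w))"
      if "e = 1 \<or> e = -1" "q \<noteq> 0" "f \<noteq> 0" "g \<noteq> 0" "\<delta> \<noteq> 0" for pa pc \<beta> e q u v w \<gamma> f \<delta> g :: 'a
      using that by (auto simp: divide_simps)
    ultimately show ?thesis
      unfolding quad_coeff_def mult.assoc[of "pochhammer a l" "pochhammer (- of_nat k / 2) l"] e1 e2 e3 e4 e5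
      using nz by simp
  next
    case False
    \<comment> \<open>For \<open>2 l > k\<close> the symbol \<open>(-k)_(2l)\<close> is zero, hence
      so is one of its two halves, and both sides vanish.\<close>
    then have "pochhammer (- of_nat k / 2) l = (0 :: 'a) \<or> pochhammer ((1 - of_nat k) / 2) l = (0 :: 'a)"
      using p by (auto simp: pochhammer_neg_nat split: if_splits)
    moreover have "fps_nth (quad_basis b l) k = 0"
      using False by (simp add: quad_basis_def fps_X_power_mult_nth)
    ultimately show ?thesis by (auto simp del: pochhammer_eq_0_iff)
  qed
qed

theorem F21_square_nth:
  fixes a b :: "'a::{banach,real_normed_field}"
  assumes b: "\<And>j. 2 * b \<noteq> - of_nat j" "\<And>j. 4 * b \<noteq> 1 - of_nat j"
  shows "fps_nth (geo_pow (b - a) * F21 a b (2 * b) ^ 2) k = pochhammer b k / fact k *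
     hypergeo [a, - of_nat k / 2, (1 - of_nat k) / 2, 2 * b - a] [2 * b, 1 - b - of_nat k, b + 1/2] 1"
proof -
  define T where "T l = pochhammer a l * pochhammer (- of_nat k / 2) l * pochhammer ((1 - of_nat k) / 2) l * pochhammer (2 * b - a) l
      / (pochhammer (2 * b) l * pochhammer (1 - b - of_nat k) l * pochhammer (b + 1/2) l * fact l)" for l
  have b': "b \<noteq> - of_nat j" for j
    using b(1)[of "2 * j"] by auto
  \<comment> \<open>Termination follows from \<open>quad_coeff_basis_nth\<close> without
    distinguishing the parity of \<open>k\<close>: \<open>quad_basis b l\<close> has no
    \<open>x^k\<close> term and the prefactor is nonzero.\<close>
  have z: "T l = 0" if "l > k" for l
  proof -
    have "quad_coeff a b l * fps_nth (quad_basis b l) k = 0"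
      using that by (simp add: quad_basis_def fps_X_power_mult_nth)
    then show ?thesis
      unfolding quad_coeff_basis_nth[OF b'] T_def[symmetric] 
      using pochhammer_neq_0[OF b', of k] by (simp del: pochhammer_eq_0_iff)
  qed
  have "hypergeo [a, - of_nat k / 2, (1 - of_nat k) / 2, 2 * b - a] [2 * b, 1 - b - of_nat k, b + 1/2] 1 = (\<Sum>l. T l)"
    unfolding hypergeo_altdef T_def by (simp add: mult_ac)
  also have "\<dots> = (\<Sum>l<Suc k. T l)"
    using z by (intro suminf_finite) auto
  finally have H: "hypergeo [a, - of_nat k / 2, (1 - of_nat k) / 2, 2 * b - a] [2 * b, 1 - b - of_nat k, b + 1/2] 1
     = (\<Sum>l<Suc k. T l)" .
  have "k < 2 * Suc k" by simp
  show ?thesis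
    unfolding F21_square_quadratic[OF b \<open>k < 2 * Suc k\<close>] quad_coeff_basis_nth[OF b'] T_def[symmetric] H
    by (simp only: sum_distrib_left)
qed

subsection \<open>The logarithmic connection formula\<close>

lemma nonpos_Ints_plus_1:
  fixes z :: complex
  assumes "z \<notin> \<int>\<^sub>\<le>\<^sub>0"
  shows "z + 1 \<notin> \<int>\<^sub>\<le>\<^sub>0"
  using assms plus_one_in_nonpos_Ints_imp by blast

lemma nonpos_Ints_iff_neq: "z \<notin> \<int>\<^sub>\<le>\<^sub>0 \<longleftrightarrow> (\<forall>j. z \<noteq> - of_nat j)" for z :: complex
  by (auto elim!: nonpos_Ints_cases')

lemma F21_nth_neq_0:
  fixes a b c :: complex
  assumes "a \<notin> \<int>\<^sub>\<le>\<^sub>0" "b \<notin> \<int>\<^sub>\<le>\<^sub>0" "c \<notin> \<int>\<^sub>\<le>\<^sub>0"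
  shows "fps_nth (F21 a b c) n \<noteq> 0"
  unfolding F21_nth using assms by (auto simp: nonpos_Ints_iff_neq pochhammer_eq_0_iff)

lemma tendsto_shift_quotient: "(\<lambda>n. (z + of_nat n) / (w + of_nat n)) \<longlonglongrightarrow> (1 :: complex)"
proof -
  have "(\<lambda>n. (z / of_nat n + 1) / (w / of_nat n + 1)) \<longlonglongrightarrow> (0 + 1) / (0 + 1)"
    by (intro tendsto_intros lim_const_over_n) simp
  moreover have "\<forall>\<^sub>F n in sequentially. (z / of_nat n + 1) / (w / of_nat n + 1) = (z + of_nat n) / (w + of_nat n)"
    using eventually_gt_at_top[of 0]
  proof eventually_elim
    case (elim n)
    then have "z / of_nat n + 1 = (z + of_nat n) / of_nat n" for z :: complex
      by (simp add: add_divide_distrib)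
    then show ?case using elim by simp
  qed
  ultimately show ?thesis by (simp add: Lim_transform_eventually)
qed

text \<open>Parameters off the nonpositive integers keep all coefficients nonzero, so the ratio of
  neighbouring coefficients is defined and tends to 1.\<close>

lemma F21_conv_radius:
  fixes a b c :: complex
  assumes "a \<notin> \<int>\<^sub>\<le>\<^sub>0" "b \<notin> \<int>\<^sub>\<le>\<^sub>0" "c \<notin> \<int>\<^sub>\<le>\<^sub>0"
  shows "fps_conv_radius (F21 a b c) = 1"
proof -
  have "conv_radius (fps_nth (F21 a b c)) = ereal 1"
  proof (rule conv_radius_ratio_limit_nonzero)
    have "(\<lambda>n. norm ((c + of_nat n) / (a + of_nat n) * ((1 + of_nat n) / (b + of_nat n)))) \<longlonglongrightarrow> norm (1 * 1 :: complex)"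
      by (intro tendsto_intros tendsto_shift_quotient)
    moreover have "norm ((c + of_nat n) / (a + of_nat n) * ((1 + of_nat n) / (b + of_nat n)))
        = norm (fps_nth (F21 a b c) n) / norm (fps_nth (F21 a b c) (Suc n))" for n
    proof -
      have nz: "fps_nth (F21 a b c) n \<noteq> 0" "fps_nth (F21 a b c) (Suc n) \<noteq> 0" "a + of_nat n \<noteq> 0" "b + of_nat n \<noteq> 0"
        using F21_nth_neq_0[OF assms] assms by (auto simp: nonpos_Ints_iff_neq add_eq_0_iff2 simp del: fps_hypergeo_nth)
      have "(c + of_nat n) / (a + of_nat n) * ((1 + of_nat n) / (b + of_nat n)) = fps_nth (F21 a b c) n / fps_nth (F21 a b c) (Suc n)"
        using F21_Suc[of c n a b] assms(3) nz by (simp add: nonpos_Ints_iff_neq divide_simps mult_ac add.commute[of 1] del: fps_hypergeo_nth)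
      then show ?thesis by (simp only: norm_divide)
    qed
    ultimately show "(\<lambda>n. norm (fps_nth (F21 a b c) n) / norm (fps_nth (F21 a b c) (Suc n))) \<longlonglongrightarrow> 1"
      by simp
  qed simp_all
  then show ?thesis by (simp add: fps_conv_radius_def one_ereal_def)
qed

lemma F21_deriv:
  fixes a b c :: complex
  assumes "c \<notin> \<int>\<^sub>\<le>\<^sub>0"
  shows "fps_deriv (F21 a b c) = fps_const (a * b / c) * F21 (a + 1) (b + 1) (c + 1)"
proof (rule fps_ext)
  fix n
  have "c \<noteq> 0" "pochhammer (c + 1) n \<noteq> 0"
    using assms nonpos_Ints_plus_1[OF assms] by (auto simp: nonpos_Ints_iff_neq pochhammer_eq_0_iff)
  then show "fps_nth (fps_deriv (F21 a b c)) n = fps_nth (fps_const (a * b / c) * F21 (a + 1) (b + 1) (c + 1)) n"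
    unfolding fps_deriv_nth fps_mult_left_const_nth F21_nth Suc_eq_plus1[symmetric] pochhammer_rec fact_Suc
    by (simp add: divide_simps del: of_nat_Suc)
qed

lemma F21_eval_ode:
  fixes a b c :: complex
  assumes "a \<notin> \<int>\<^sub>\<le>\<^sub>0" "b \<notin> \<int>\<^sub>\<le>\<^sub>0" "c \<notin> \<int>\<^sub>\<le>\<^sub>0" "norm z < 1"
  defines "u \<equiv> F21 a b c"
  shows "z * (1 - z) * eval_fps (fps_deriv (fps_deriv u)) z
     = - (c - (a + b + 1) * z) * eval_fps (fps_deriv u) z + a * b * eval_fps u z"
proof -
  have r: "fps_conv_radius u \<ge> 1" "fps_conv_radius (fps_deriv u) \<ge> 1" "fps_conv_radius (fps_deriv (fps_deriv u)) \<ge> 1"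
    using F21_conv_radius[OF assms(1-3)] fps_conv_radius_deriv[of u] fps_conv_radius_deriv[of "fps_deriv u"]
    by (auto simp: u_def)
  have lt: "ereal (norm z) < fps_conv_radius u" "ereal (norm z) < fps_conv_radius (fps_deriv u)"
    "ereal (norm z) < fps_conv_radius (fps_deriv (fps_deriv u))"
    using r assms(4) by (meson ereal_less(3) less_le_trans)+
  \<comment> \<open>The coefficients are written with \<open>fps_of_poly\<close>, whose convergence
    radius is infinite, so that evaluation can be distributed over the products.\<close>
  have "fps_of_poly [:0, 1, -1:] * fps_deriv (fps_deriv u) = fps_of_poly [:- c, a + b + 1:] * fps_deriv u + fps_const (a * b) * u"
    using F21_ode[of c a b] assms(3) unfolding u_def[symmetric]
    by (simp add: nonpos_Ints_iff_neq fps_of_poly_pCons algebra_simps flip: fps_const_neg)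
  then have "eval_fps (fps_of_poly [:0, 1, -1:] * fps_deriv (fps_deriv u)) z
     = eval_fps (fps_of_poly [:- c, a + b + 1:] * fps_deriv u + fps_const (a * b) * u) z"
    by simp
  also have "eval_fps (fps_of_poly [:- c, a + b + 1:] * fps_deriv u + fps_const (a * b) * u) z
     = eval_fps (fps_of_poly [:- c, a + b + 1:] * fps_deriv u) z + eval_fps (fps_const (a * b) * u) z"
  proof (rule eval_fps_add)
    have "min (fps_conv_radius (fps_of_poly [:- c, a + b + 1:])) (fps_conv_radius (fps_deriv u)) \<le> fps_conv_radius (fps_of_poly [:- c, a + b + 1:] * fps_deriv u)"
      by (rule fps_conv_radius_mult)
    then show "ereal (norm z) < fps_conv_radius (fps_of_poly [:- c, a + b + 1:] * fps_deriv u)"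
      using lt by (simp add: min_def split: if_splits)
    have "min (fps_conv_radius (fps_const (a * b))) (fps_conv_radius u) \<le> fps_conv_radius (fps_const (a * b) * u)"
      by (rule fps_conv_radius_mult)
    then show "ereal (norm z) < fps_conv_radius (fps_const (a * b) * u)"
      using lt by (simp add: min_def split: if_splits)
  qed
  finally show ?thesis
    using lt by (subst (asm) (1 2 3) eval_fps_mult) (auto simp: algebra_simps)
qed

section \<open>Abel's theorem and the zero-balanced case\<close>

text \<open>For \<open>0 < x < 1\<close> the numbers \<open>x (1 - x)^n\<close> are weights of total
  mass 1, and the mass of any fixed initial segment tends to 0 with \<open>x\<close>. The lemma
  gives the behaviour of a hypergeometric series, and of its derivative, at the singular
  point.\<close>

lemma Abel_limit:
  fixes a :: "nat \<Rightarrow> complex"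
  assumes lim: "a \<longlonglongrightarrow> L"
  shows "((\<lambda>x. of_real x * (\<Sum>n. a n * (1 - of_real x) ^ n)) \<longlongrightarrow> L) (at_right 0)"
proof -
  have main: "norm (of_real x * (\<Sum>n. a n * (1 - of_real x) ^ n) - L) \<le> x * (\<Sum>n<N. norm (a n - L)) + e"
    if x: "0 < x" "x < 1" and e: "\<And>n. n \<ge> N \<Longrightarrow> norm (a n - L) \<le> e" for x e :: real and N
  proof -
    define t where "t = 1 - x"
    have t: "0 < t" "t < 1" using x by (auto simp: t_def)
    have t': "(1 - of_real x :: complex) = of_real t" by (simp add: t_def)
    have "(\<lambda>n. of_real t ^ n :: complex) sums (1 / (1 - of_real t))"
      by (rule geometric_sums) (use t in simp)
    then have g: "(\<lambda>n. of_real t ^ n :: complex) sums (1 / of_real x)"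
      by (simp add: t_def)
    have gr: "(\<lambda>n. t ^ n) sums (1 / x)"
      using geometric_sums[of t] t by (simp add: t_def)
    have "Bseq (\<lambda>n. a n - L)"
      using lim by (intro convergent_imp_Bseq) (auto simp: convergent_def intro!: tendsto_intros)
    then obtain B where B: "B > 0" "\<And>n. norm (a n - L) \<le> B"
      by (auto simp: Bseq_def)
    have s: "summable (\<lambda>n. norm ((a n - L) * of_real t ^ n))"
    proof (rule summable_comparison_test'[of "\<lambda>n. B * t ^ n" 0])
      show "summable (\<lambda>n. B * t ^ n)" using gr by (intro summable_mult) (simp add: sums_iff)
      show "norm (norm ((a n - L) * of_real t ^ n)) \<le> B * t ^ n" for n
        using B(2)[of n] t by (simp add: norm_mult norm_power mult_right_mono)
    qed
    have e0: "e \<ge> 0" using e[of N] by (meson norm_ge_zero order_trans order_refl)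
    have le: "norm ((a n - L) * of_real t ^ n) \<le> (if n < N then norm (a n - L) else 0) + e * t ^ n" for n
    proof (cases "n < N")
      case True
      have "norm (a n - L) * t ^ n \<le> norm (a n - L) * 1"
        using t by (intro mult_left_mono power_le_one) auto
      moreover have "0 \<le> e * t ^ n" using e0 t by simp
      ultimately show ?thesis using True t by (simp add: norm_mult norm_power)
    next
      case False
      then show ?thesis using e[of n] t by (simp add: norm_mult norm_power mult_right_mono)
    qed
    have fin: "(\<lambda>n. if n < N then norm (a n - L) else 0) sums (\<Sum>n<N. norm (a n - L))"
      using sums_If_finite_set[of "{..<N}" "\<lambda>n. norm (a n - L)"] by simp
    have "(\<lambda>n. (a n - L) * of_real t ^ n + L * of_real t ^ n) sums ((\<Sum>n. (a n - L) * of_real t ^ n) + L * (1 / of_real x))"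
      using summable_norm_cancel[OF s] g by (intro sums_add sums_mult) auto
    then have "(\<Sum>n. a n * of_real t ^ n) = (\<Sum>n. (a n - L) * of_real t ^ n) + L * (1 / of_real x)"
      by (simp add: sums_iff algebra_simps)
    then have "of_real x * (\<Sum>n. a n * of_real t ^ n) - L = of_real x * (\<Sum>n. (a n - L) * of_real t ^ n)"
      using x by (simp add: field_simps)
    then have "norm (of_real x * (\<Sum>n. a n * of_real t ^ n) - L) = x * norm (\<Sum>n. (a n - L) * of_real t ^ n)"
      using x by (simp add: norm_mult)
    also have "\<dots> \<le> x * (\<Sum>n. norm ((a n - L) * of_real t ^ n))"
      using x s by (intro mult_left_mono summable_norm) auto
    also have "\<dots> \<le> x * ((\<Sum>n<N. norm (a n - L)) + e * (1 / x))"
    proof (rule mult_left_mono)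
      show "(\<Sum>n. norm ((a n - L) * of_real t ^ n)) \<le> (\<Sum>n<N. norm (a n - L)) + e * (1 / x)"
        by (rule sums_le[OF le summable_sums[OF s] sums_add[OF fin sums_mult[OF gr]]])
    qed (use x in auto)
    also have "\<dots> = x * (\<Sum>n<N. norm (a n - L)) + e"
      using x by (simp add: field_simps)
    finally show ?thesis unfolding t' .
  qed
  show ?thesis
  proof (rule tendstoI)
    fix r :: real assume r: "r > 0"
    obtain N where N: "\<And>n. n \<ge> N \<Longrightarrow> norm (a n - L) < r / 2"
      using lim r by (metis LIMSEQ_D half_gt_zero)
    have "((\<lambda>x. x * (\<Sum>n<N. norm (a n - L)) + r / 2) \<longlongrightarrow> 0 * (\<Sum>n<N. norm (a n - L)) + r / 2) (at_right 0)"
      by (intro tendsto_intros)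
    then have "\<forall>\<^sub>F x in at_right 0. x * (\<Sum>n<N. norm (a n - L)) + r / 2 < r"
      by (rule order_tendstoD) (use r in simp)
    moreover have "\<forall>\<^sub>F x in at_right 0. x \<in> {0<..<1::real}"
      by (rule eventually_at_right_real) simp
    ultimately show "\<forall>\<^sub>F x in at_right 0. dist (of_real x * (\<Sum>n. a n * (1 - of_real x) ^ n)) L < r"
    proof eventually_elim
      case (elim x)
      then show ?case using main[of x N "r / 2"] N by (fastforce simp: dist_norm intro: less_imp_le)
    qed
  qed
qed

text \<open>The terms are quotients of \<open>Gamma_series\<close>, in which the powers of
  \<open>n\<close> cancel because the lower parameter is \<open>a + b\<close>. They are the Taylor
  coefficients of the derivative, so \<open>Abel_limit\<close> applies to it.\<close>

lemma F21_zero_balanced_coeff_limit: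
  fixes a b :: complex
  assumes "a \<notin> \<int>\<^sub>\<le>\<^sub>0" "b \<notin> \<int>\<^sub>\<le>\<^sub>0" "a + b \<notin> \<int>\<^sub>\<le>\<^sub>0"
  shows "(\<lambda>n. of_nat (Suc n) * fps_nth (F21 a b (a + b)) (Suc n)) \<longlonglongrightarrow> Gamma (a + b) / (Gamma a * Gamma b)"
proof -
  have "(\<lambda>n. Gamma_series (a + b) n / (Gamma_series a n * Gamma_series b n)) \<longlonglongrightarrow> Gamma (a + b) / (Gamma a * Gamma b)"
    using assms by (intro tendsto_intros Gamma_series_LIMSEQ) (simp add: Gamma_eq_zero_iff)
  moreover have "Gamma_series (a + b) n / (Gamma_series a n * Gamma_series b n) = of_nat (Suc n) * fps_nth (F21 a b (a + b)) (Suc n)" for n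
  proof -
    have nz: "pochhammer a (Suc n) \<noteq> 0" "pochhammer b (Suc n) \<noteq> 0" "pochhammer (a + b) (Suc n) \<noteq> 0"
      using assms by (auto simp: nonpos_Ints_iff_neq pochhammer_eq_0_iff)
    have "of_nat (Suc n) \<noteq> (0::complex)" by (rule of_nat_neq_0)
    moreover have "exp ((a + b) * of_real (ln (of_nat n))) = exp (a * of_real (ln (of_nat n))) * exp (b * of_real (ln (of_nat n)))"
      by (simp add: distrib_right exp_add)
    ultimately show ?thesis
      unfolding Gamma_series_def F21_nth fact_Suc Suc_eq_plus1[symmetric] using nz by (simp add: divide_simps del: of_nat_Suc)
  qed
  ultimately show ?thesis by (simp del: fps_hypergeo_nth of_nat_Suc)
qed

lemma eval_F21_has_field_derivative:
  fixes a b c :: complex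
  assumes "a \<notin> \<int>\<^sub>\<le>\<^sub>0" "b \<notin> \<int>\<^sub>\<le>\<^sub>0" "c \<notin> \<int>\<^sub>\<le>\<^sub>0" "norm z < 1"
  shows "(eval_fps (F21 a b c) has_field_derivative eval_fps (fps_deriv (F21 a b c)) z) (at z)"
    and "(eval_fps (fps_deriv (F21 a b c)) has_field_derivative eval_fps (fps_deriv (fps_deriv (F21 a b c))) z) (at z)"
proof -
  have r: "fps_conv_radius (F21 a b c) \<ge> 1" "fps_conv_radius (fps_deriv (F21 a b c)) \<ge> 1"
    using F21_conv_radius[OF assms(1-3)] fps_conv_radius_deriv[of "F21 a b c"] by auto
  then have lt: "ereal (norm z) < fps_conv_radius (F21 a b c)" "ereal (norm z) < fps_conv_radius (fps_deriv (F21 a b c))"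
    using assms(4) by (meson ereal_less(3) less_le_trans)+
  show "(eval_fps (F21 a b c) has_field_derivative eval_fps (fps_deriv (F21 a b c)) z) (at z)"
    "(eval_fps (fps_deriv (F21 a b c)) has_field_derivative eval_fps (fps_deriv (fps_deriv (F21 a b c))) z) (at z)"
    using lt by (auto intro: has_field_derivative_eval_fps)
qed

lemma eval_F21_holomorphic:
  fixes a b c :: complex
  assumes "a \<notin> \<int>\<^sub>\<le>\<^sub>0" "b \<notin> \<int>\<^sub>\<le>\<^sub>0" "c \<notin> \<int>\<^sub>\<le>\<^sub>0"
  shows "eval_fps (F21 a b c) holomorphic_on ball 0 1"
  unfolding holomorphic_on_open[OF open_ball]
  using eval_F21_has_field_derivative(1)[OF assms] by fastforce

text \<open>In the lens with radius at most 1 the series in \<open>x\<close> and the series in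
  \<open>1 - x\<close> both converge, and the branch cut of \<open>Ln\<close> is avoided.\<close>

lemma eventually_in_lens:
  assumes "\<epsilon> > 0"
  shows "\<forall>\<^sub>F x in at_right 0. complex_of_real x \<in> ball 0 \<epsilon> \<inter> ball 1 1"
proof -
  have "\<forall>\<^sub>F x in at_right 0. x \<in> {0<..<min \<epsilon> 1}"
    using assms by (intro eventually_at_right_real) simp
  then show ?thesis
  proof eventually_elim
    case (elim x)
    have "dist 1 (complex_of_real x) = 1 - x"
      using elim norm_of_real[of "1 - x", where 'a = complex] by (simp add: dist_norm)
    then show ?case using elim by simp
  qed
qed

lemma ball_1_1_nonpos_Reals: "x \<in> ball 1 1 \<Longrightarrow> x \<notin> \<real>\<^sub>\<le>\<^sub>0" for x :: complex
proof
  assume x: "x \<in> ball 1 1" "x \<in> \<real>\<^sub>\<le>\<^sub>0"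
  then have "Re x \<le> 0" by (auto simp: complex_nonpos_Reals_iff)
  moreover have "\<bar>Re (1 - x)\<bar> \<le> norm (1 - x)" by (rule abs_Re_le_cmod)
  ultimately show False using x by (auto simp: dist_norm)
qed

text \<open>
  The Wronskian is a constant multiple of \<open>1 / (x (1 - x)\<^bsup>a+b\<^esup>)\<close>; Abel's theorem for \<open>x \<rightarrow> 0\<close> finds the constant.
\<close>

lemma F21_zero_balanced_wronskian:
  fixes a b :: complex
  assumes a: "a \<notin> \<int>\<^sub>\<le>\<^sub>0" and b: "b \<notin> \<int>\<^sub>\<le>\<^sub>0" and ab: "a + b \<notin> \<int>\<^sub>\<le>\<^sub>0"
    and x: "x \<in> ball 0 1 \<inter> ball 1 1"
  defines "Z \<equiv> F21 a b (a + b)" and "F \<equiv> F21 a b 1"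
  shows "x * (1 - x) powr (a + b) *
     (- eval_fps (fps_deriv Z) (1 - x) * eval_fps F x - eval_fps Z (1 - x) * eval_fps (fps_deriv F) x)
     = - Gamma (a + b) / (Gamma a * Gamma b)"
proof -
  define D where "D = ball 0 1 \<inter> ball (1::complex) 1"
  have one: "(1::complex) \<notin> \<int>\<^sub>\<le>\<^sub>0" by simp
  \<comment> \<open>These are the derivatives of the function \<open>Z(1 - x)\<close>, hence the
    sign in \<open>z'\<close>.\<close>
  define z z' z'' where "z x = eval_fps Z (1 - x)" and "z' x = - eval_fps (fps_deriv Z) (1 - x)"
    and "z'' x = eval_fps (fps_deriv (fps_deriv Z)) (1 - x)" for x
  define f f' f'' where "f = eval_fps F" "f' = eval_fps (fps_deriv F)" "f'' = eval_fps (fps_deriv (fps_deriv F))"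
  define W where "W x = z' x * f x - z x * f' x" for x
  define V where "V x = x * (1 - x) powr (a + b) * W x" for x
  have D: "norm x < 1" "norm (1 - x) < 1" "1 - x \<notin> \<real>\<^sub>\<le>\<^sub>0" if "x \<in> D" for x
    using that ball_1_1_nonpos_Reals[of "1 - x"] by (auto simp: D_def dist_norm norm_minus_commute)
  have dz: "(z has_field_derivative z' x) (at x)" "(z' has_field_derivative z'' x) (at x)"
    and df: "(f has_field_derivative f' x) (at x)" "(f' has_field_derivative f'' x) (at x)" if "x \<in> D" for x
  proof -
    have m: "((\<lambda>x. 1 - x) has_field_derivative - 1) (at x)"
      by (auto intro!: derivative_eq_intros)
    show "(z has_field_derivative z' x) (at x)"
      using DERIV_chain2[OF eval_F21_has_field_derivative(1)[OF a b ab D(2)[OF that]] m]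
      by (simp add: z_def[abs_def] z'_def Z_def)
    show "(z' has_field_derivative z'' x) (at x)"
      using DERIV_minus[OF DERIV_chain2[OF eval_F21_has_field_derivative(2)[OF a b ab D(2)[OF that]] m]]
      by (simp add: z'_def[abs_def] z''_def Z_def)
    show "(f has_field_derivative f' x) (at x)" "(f' has_field_derivative f'' x) (at x)"
      using eval_F21_has_field_derivative[OF a b one D(1)[OF that]]
      by (simp_all add: f_f'_f''_def F_def)
  qed
  \<comment> \<open>The substitution \<open>x -> 1 - x\<close> carries the lower parameter
    \<open>c\<close> to \<open>a + b + 1 - c\<close>, hence \<open>a + b\<close> to 1. Both
    functions therefore solve the same equation.\<close>
  have ode: "x * (1 - x) * z'' x = - (1 - (a + b + 1) * x) * z' x + a * b * z x"
    "x * (1 - x) * f'' x = - (1 - (a + b + 1) * x) * f' x + a * b * f x" if "x \<in> D" for x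
    using F21_eval_ode[OF a b ab D(2)[OF that]] F21_eval_ode[OF a b one D(1)[OF that]]
    by (simp_all add: z_def z'_def z''_def f_f'_f''_def Z_def F_def algebra_simps)
  have dV: "(V has_field_derivative 0) (at x)" if xD: "x \<in> D" for x
  proof -
    have nz: "1 - x \<noteq> 0" using D(3)[OF xD] by auto
    have p: "(1 - x) powr (a + b) = (1 - x) powr (a + b - 1) * (1 - x)"
      using nz powr_add[of "1 - x" "a + b - 1" 1] by simp
    have dW: "(W has_field_derivative z'' x * f x - z x * f'' x) (at x)"
      unfolding W_def[abs_def] by (auto intro!: derivative_eq_intros dz df xD simp: algebra_simps)
    have dp: "((\<lambda>x. (1 - x) powr (a + b)) has_field_derivative - ((a + b) * (1 - x) powr (a + b - 1))) (at x)"
    proof -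
      have "((\<lambda>x. 1 - x) has_field_derivative - 1) (at x)"
        by (auto intro!: derivative_eq_intros)
      from DERIV_chain2[OF has_field_derivative_powr[OF D(3)[OF xD]] this] show ?thesis by simp
    qed
    have "(V has_field_derivative (1 - x) powr (a + b) * W x + x * (- ((a + b) * (1 - x) powr (a + b - 1))) * W x
        + x * (1 - x) powr (a + b) * (z'' x * f x - z x * f'' x)) (at x)"
      unfolding V_def[abs_def]
      by (rule DERIV_cong[OF DERIV_mult[OF DERIV_mult[OF DERIV_ident dp] dW]]) (simp add: algebra_simps)
    also have "(1 - x) powr (a + b) * W x + x * (- ((a + b) * (1 - x) powr (a + b - 1))) * W x
        + x * (1 - x) powr (a + b) * (z'' x * f x - z x * f'' x)
       = (1 - x) powr (a + b - 1) * ((1 - x - (a + b) * x) * W x + ((x * (1 - x) * z'' x) * f x - z x * (x * (1 - x) * f'' x)))"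
      unfolding p by (simp add: algebra_simps)
    also have "\<dots> = 0"
      unfolding ode[OF xD] W_def by (simp add: algebra_simps)
    finally show ?thesis .
  qed
  have cD: "convex D" unfolding D_def by (intro convex_Int convex_ball)
  obtain k where k: "\<And>x. x \<in> D \<Longrightarrow> V x = k"
  proof -
    have "\<exists>c. \<forall>x\<in>D. V x = c"
      by (rule has_field_derivative_zero_constant[OF cD]) (use dV in \<open>auto intro: has_field_derivative_at_within\<close>)
    then show ?thesis using that by blast
  qed
  have lim: "((\<lambda>x. V (of_real x)) \<longlongrightarrow> 1 * (- (Gamma (a + b) / (Gamma a * Gamma b)) * 1 - 0 * f' 0)) (at_right 0)"
  proof -
    have c0: "((\<lambda>x. complex_of_real x) \<longlongrightarrow> 0) (at_right 0)"
      using tendsto_of_real[OF tendsto_ident_at, of 0 "{0<..}"] by simp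
    have fl: "((\<lambda>x. f (of_real x)) \<longlongrightarrow> f 0) (at_right 0)" "((\<lambda>x. f' (of_real x)) \<longlongrightarrow> f' 0) (at_right 0)"
      using eval_F21_has_field_derivative[OF a b one, of 0]
      by (auto simp: f_f'_f''_def F_def intro!: isCont_tendsto_compose[OF _ c0] DERIV_isCont)
    have f0: "f 0 = 1" by (simp add: f_f'_f''_def F_def eval_fps_at_0)
    have lz: "((\<lambda>x. of_real x * z' (of_real x)) \<longlongrightarrow> - (Gamma (a + b) / (Gamma a * Gamma b))) (at_right 0)"
      using tendsto_minus[OF Abel_limit[OF F21_zero_balanced_coeff_limit[OF a b ab]]]
      by (simp add: z'_def eval_fps_def Z_def algebra_simps del: fps_hypergeo_nth)
    \<comment> \<open>Dividing the convergent sequence by its index shows that the coefficients of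
      \<open>Z\<close> tend to 0; this removes the second product of the Wronskian in the
      limit.\<close>
    have lz0: "((\<lambda>x. of_real x * z (of_real x)) \<longlongrightarrow> 0) (at_right 0)"
    proof -
      have "(\<lambda>n. of_nat (Suc n) * fps_nth Z (Suc n) * (1 / of_nat (Suc n))) \<longlonglongrightarrow> Gamma (a + b) / (Gamma a * Gamma b) * 0"
        unfolding Z_def by (intro tendsto_mult F21_zero_balanced_coeff_limit[OF a b ab] lim_const_over_n[THEN LIMSEQ_Suc])
      then have "(\<lambda>n. fps_nth Z (Suc n)) \<longlonglongrightarrow> 0"
        by (simp del: of_nat_Suc)
      then have "fps_nth Z \<longlonglongrightarrow> 0" by (simp add: filterlim_sequentially_Suc)
      from Abel_limit[OF this] show ?thesis by (simp add: z_def eval_fps_def)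
    qed
    have "((\<lambda>x. (1 - complex_of_real x) powr (a + b)) \<longlongrightarrow> (1 - 0) powr (a + b)) (at_right 0)"
      by (intro tendsto_intros c0) auto
    then have lp: "((\<lambda>x. (1 - complex_of_real x) powr (a + b)) \<longlongrightarrow> 1) (at_right 0)" by simp
    have "((\<lambda>x. (1 - complex_of_real x) powr (a + b) * (of_real x * z' (of_real x) * f (of_real x) - of_real x * z (of_real x) * f' (of_real x))) \<longlongrightarrow>
        1 * (- (Gamma (a + b) / (Gamma a * Gamma b)) * f 0 - 0 * f' 0)) (at_right 0)"
      by (intro tendsto_mult tendsto_diff lp lz lz0 fl)
    then show ?thesis unfolding f0 V_def W_def by (simp add: algebra_simps)
  qed
  have "\<forall>\<^sub>F x in at_right 0. V (of_real x) = k"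
    using eventually_in_lens[of 1] by (auto elim!: eventually_mono intro!: k simp: D_def)
  then have "((\<lambda>x. V (of_real x)) \<longlongrightarrow> k) (at_right 0)"
    by (rule tendsto_eventually)
  then have "k = - (Gamma (a + b) / (Gamma a * Gamma b))"
    using lim tendsto_unique[OF trivial_limit_at_right_real] by fastforce
  with k[of x] x show ?thesis
    by (simp add: V_def W_def z_def z'_def f_f'_f''_def D_def mult_ac)
qed

lemma convex_lens: "convex (ball (0::complex) \<epsilon> \<inter> ball 1 1)"
  by (intro convex_Int convex_ball)

text \<open>
  Reduction of order: the derivative of the quotient of the two solutions is the Wronskian divided
  by \<open>F\<^sup>2\<close>, which has a simple pole at \<open>0\<close>.
\<close>

theorem F21_zero_balanced_log:
  fixes a b :: complex
  assumes a: "a \<notin> \<int>\<^sub>\<le>\<^sub>0" and b: "b \<notin> \<int>\<^sub>\<le>\<^sub>0" and ab: "a + b \<notin> \<int>\<^sub>\<le>\<^sub>0"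
  obtains \<epsilon> P where "0 < \<epsilon>" "\<epsilon> \<le> 1" "P holomorphic_on ball 0 \<epsilon>"
    "\<And>x. x \<in> ball 0 \<epsilon> \<inter> ball 1 1 \<Longrightarrow> eval_fps (F21 a b (a + b)) (1 - x) =
       P x - Gamma (a + b) / (Gamma a * Gamma b) * Ln x * eval_fps (F21 a b 1) x"
proof -
  define k where "k = Gamma (a + b) / (Gamma a * Gamma b)"
  define f z where "f = eval_fps (F21 a b 1)" and "z x = eval_fps (F21 a b (a + b)) (1 - x)" for x
  define f' z' where "f' = eval_fps (fps_deriv (F21 a b 1))" and "z' x = - eval_fps (fps_deriv (F21 a b (a + b))) (1 - x)" for x
  have one: "(1::complex) \<notin> \<int>\<^sub>\<le>\<^sub>0" by simp
  have fhol: "f holomorphic_on ball 0 1"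
    unfolding f_def by (rule eval_F21_holomorphic[OF a b one])
  have f0: "f 0 = 1" by (simp add: f_def eval_fps_at_0)
  have "isCont f 0"
    using fhol by (meson centre_in_ball continuous_on_eq_continuous_at holomorphic_on_imp_continuous_on open_ball zero_less_one)
  then have "\<forall>\<^sub>F x in nhds 0. f x \<noteq> 0"
    using f0 by (intro tendsto_imp_eventually_ne[of f 1]) (auto simp: isCont_def tendsto_nhds_iff)
  then obtain e where e: "e > 0" "\<And>x. dist x 0 < e \<Longrightarrow> f x \<noteq> 0"
    by (auto simp: eventually_nhds_metric)
  \<comment> \<open>The quotient by \<open>f\<close> needs a disc without zeros of
    \<open>f\<close>.\<close>
  define \<epsilon> where "\<epsilon> = min e 1"
  have \<epsilon>: "0 < \<epsilon>" "\<epsilon> \<le> 1" using e by (auto simp: \<epsilon>_def)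
  have fne: "f x \<noteq> 0" if "x \<in> ball 0 \<epsilon>" for x
    using that e(2)[of x] by (simp add: \<epsilon>_def dist_commute)
  have fhol\<epsilon>: "f holomorphic_on ball 0 \<epsilon>"
    by (rule holomorphic_on_subset[OF fhol]) (use \<epsilon> in auto)
  define u where "u x = (1 - x) powr (- (a + b)) / f x ^ 2" for x
  have slit: "1 - x \<notin> \<real>\<^sub>\<le>\<^sub>0" if "x \<in> ball 0 \<epsilon>" for x :: complex
    by (rule ball_1_1_nonpos_Reals) (use that \<epsilon> in \<open>auto simp: dist_norm\<close>)
  have uhol: "u holomorphic_on ball 0 \<epsilon>"
    unfolding u_def[abs_def] by (intro holomorphic_intros fhol\<epsilon>) (use slit fne in auto)
  \<comment> \<open>Since \<open>u 0 = 1\<close>, the quotient \<open>u x / x\<close> equals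
    \<open>1 / x + g x\<close> with \<open>g\<close> holomorphic, and a primitive is
    \<open>Ln x + p x\<close>.\<close>
  define g where "g x = (if x = 0 then deriv u 0 else (u x - u 0) / (x - 0))" for x
  have ghol: "g holomorphic_on ball 0 \<epsilon>"
    unfolding g_def[abs_def] by (rule pole_lemma[OF uhol]) (use \<epsilon> in simp)
  obtain p where "\<And>x. x \<in> ball 0 \<epsilon> \<Longrightarrow> (p has_field_derivative g x) (at x within ball 0 \<epsilon>)"
    using holomorphic_convex_primitive'[OF convex_ball open_ball ghol] by blast
  then have p: "\<And>x. x \<in> ball 0 \<epsilon> \<Longrightarrow> (p has_field_derivative g x) (at x)"
    by (metis at_within_open open_ball)
  have phol: "p holomorphic_on ball 0 \<epsilon>"
    unfolding holomorphic_on_open[OF open_ball] using p by blast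
  have u0: "u 0 = 1" by (simp add: u_def f0)
  let ?D = "ball 0 \<epsilon> \<inter> ball (1::complex) 1"
  have d: "((\<lambda>x. z x / f x + k * (Ln x + p x)) has_field_derivative 0) (at x within ?D)" if x: "x \<in> ?D" for x
  proof -
    have n: "norm (1 - x) < 1" "norm x < 1" using x \<epsilon> by (auto simp: dist_norm)
    have m: "((\<lambda>x. 1 - x) has_field_derivative - 1) (at x)"
      by (auto intro!: derivative_eq_intros)
    have dz: "(z has_field_derivative z' x) (at x)"
      using DERIV_chain2[OF eval_F21_has_field_derivative(1)[OF a b ab n(1)] m]
      by (simp add: z_def[abs_def] z'_def)
    have df: "(f has_field_derivative f' x) (at x)"
      unfolding f_def f'_def by (rule eval_F21_has_field_derivative(1)[OF a b one n(2)])
    have xs: "x \<notin> \<real>\<^sub>\<le>\<^sub>0" using x ball_1_1_nonpos_Reals[of x] by simp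
    then have x0: "x \<noteq> 0" by auto
    have fx: "f x \<noteq> 0" using x fne by simp
    have wr: "x * (1 - x) powr (a + b) * (z' x * f x - z x * f' x) = - k"
      using F21_zero_balanced_wronskian[OF a b ab, of x] x \<epsilon>
      by (simp add: k_def z_def z'_def f_def f'_def mult_ac)
    have pw: "(1 - x) powr (a + b) * (1 - x) powr (- (a + b)) = 1"
      using slit[of x] x by (subst powr_add[symmetric]) auto
    have w: "z' x * f x - z x * f' x = - k * (1 - x) powr (- (a + b)) / x"
    proof -
      have "x * (z' x * f x - z x * f' x) = (1 - x) powr (- (a + b)) * (x * (1 - x) powr (a + b) * (z' x * f x - z x * f' x))"
        using pw by (simp add: mult_ac)
      then show ?thesis unfolding wr using x0 by (simp add: field_simps)
    qed
    have "((\<lambda>x. z x / f x + k * (Ln x + p x)) has_field_derivative (z' x * f x - z x * f' x) / (f x * f x) + k * (inverse x + g x)) (at x)"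
      using xs fx p[of x] x by (auto intro!: derivative_eq_intros dz df)
    also have "(z' x * f x - z x * f' x) / (f x * f x) + k * (inverse x + g x) = 0"
    proof -
      have "(z' x * f x - z x * f' x) / (f x * f x) = - k * u x / x"
        unfolding w by (simp add: u_def power2_eq_square)
      moreover have "inverse x + g x = u x / x"
        using x0 by (simp add: g_def u0 field_simps)
      ultimately show ?thesis by simp
    qed
    finally show ?thesis by (rule has_field_derivative_at_within)
  qed
  obtain c where c: "\<And>x. x \<in> ?D \<Longrightarrow> z x / f x + k * (Ln x + p x) = c"
    using has_field_derivative_zero_constant[OF convex_lens d] by blast
  show ?thesis
  proof (rule that[OF \<epsilon>, of "\<lambda>x. f x * (c - k * p x)"])
    show "(\<lambda>x. f x * (c - k * p x)) holomorphic_on ball 0 \<epsilon>"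
      by (intro holomorphic_intros fhol\<epsilon> phol)
    fix x assume x: "x \<in> ?D"
    have "z x = f x * (c - k * (Ln x + p x))"
      using c[OF x] fne[of x] x by (simp add: field_simps)
    then show "eval_fps (F21 a b (a + b)) (1 - x) =
       f x * (c - k * p x) - Gamma (a + b) / (Gamma a * Gamma b) * Ln x * eval_fps (F21 a b 1) x"
      unfolding z_def f_def[symmetric] k_def[symmetric] by (simp add: algebra_simps)
  qed
qed

section \<open>Raising \<open>c - a - b\<close> by integration\<close>

text \<open>Coefficientwise this is \<open>(i + 1 + n) / (i + 2)_n = (i + 1) / (i + 1)_n\<close>. It
  lets the logarithmic part integrate to the same shape with \<open>i\<close> increased by
  one.\<close>

lemma eval_F21_power_deriv:
  fixes a b :: complex
  assumes a: "a \<notin> \<int>\<^sub>\<le>\<^sub>0" and b: "b \<notin> \<int>\<^sub>\<le>\<^sub>0" and x: "norm x < 1"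
  shows "((\<lambda>x. x ^ Suc i * eval_fps (F21 a b (of_nat (i + 2))) x) has_field_derivative
     of_nat (Suc i) * x ^ i * eval_fps (F21 a b (of_nat (Suc i))) x) (at x)"
proof -
  have c: "of_nat (Suc i) \<notin> (\<int>\<^sub>\<le>\<^sub>0 :: complex set)" "of_nat (i + 2) \<notin> (\<int>\<^sub>\<le>\<^sub>0 :: complex set)"
    by (auto simp: of_nat_in_nonpos_Ints_iff simp del: of_nat_Suc of_nat_add)
  define G where "G = F21 a b (of_nat (i + 2))"
  define H where "H = F21 a b (of_nat (Suc i))"
  have d: "(eval_fps G has_field_derivative eval_fps (fps_deriv G) x) (at x)"
    unfolding G_def by (rule eval_F21_has_field_derivative(1)[OF a b c(2) x])
  have "fps_conv_radius G \<ge> 1" "fps_conv_radius (fps_deriv G) \<ge> 1"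
    using F21_conv_radius[OF a b c(2)] fps_conv_radius_deriv[of G] unfolding G_def by auto
  then have lt: "ereal (norm x) < fps_conv_radius G" "ereal (norm x) < fps_conv_radius (fps_deriv G)"
    using x by (meson ereal_less(3) less_le_trans)+
  have "fps_of_poly [:of_nat (Suc i):] * G + fps_of_poly [:0, 1:] * fps_deriv G = fps_of_poly [:of_nat (Suc i):] * H"
  proof (rule fps_ext)
    fix n
    have p: "of_nat (Suc i + n) * pochhammer (of_nat (Suc i)) n = of_nat (Suc i) * pochhammer (of_nat (i + 2) :: complex) n"
      using pochhammer_rec[of "of_nat (Suc i) :: complex" n] pochhammer_Suc[of "of_nat (Suc i) :: complex" n]
      by (simp add: add_ac mult_ac)
    have nz: "pochhammer (of_nat (Suc i)) n \<noteq> (0::complex)" "pochhammer (of_nat (i + 2)) n \<noteq> (0::complex)"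
      using c by (auto simp: nonpos_Ints_iff_neq pochhammer_eq_0_iff simp del: of_nat_Suc of_nat_add)
    have "fps_nth (fps_of_poly [:of_nat (Suc i):] * G + fps_of_poly [:0, 1:] * fps_deriv G) n = of_nat (Suc i + n) * fps_nth G n"
      by (cases n) (simp_all add: fps_of_poly_pCons algebra_simps)
    also have "\<dots> = of_nat (Suc i) * fps_nth H n"
      unfolding G_def H_def F21_nth using p nz by (simp add: divide_simps mult_ac del: of_nat_Suc of_nat_add)
    finally show "fps_nth (fps_of_poly [:of_nat (Suc i):] * G + fps_of_poly [:0, 1:] * fps_deriv G) n = fps_nth (fps_of_poly [:of_nat (Suc i):] * H) n"
      by (simp add: fps_of_poly_pCons)
  qed
  then have "eval_fps (fps_of_poly [:of_nat (Suc i):] * G + fps_of_poly [:0, 1:] * fps_deriv G) x = eval_fps (fps_of_poly [:of_nat (Suc i):] * H) x"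
    by simp
  moreover have "eval_fps (fps_of_poly [:of_nat (Suc i):] * G + fps_of_poly [:0, 1:] * fps_deriv G) x
     = eval_fps (fps_of_poly [:of_nat (Suc i):] * G) x + eval_fps (fps_of_poly [:0, 1:] * fps_deriv G) x"
  proof (rule eval_fps_add)
    have "min (fps_conv_radius (fps_of_poly [:of_nat (Suc i) :: complex:])) (fps_conv_radius G) \<le> fps_conv_radius (fps_of_poly [:of_nat (Suc i):] * G)"
      by (rule fps_conv_radius_mult)
    then show "ereal (norm x) < fps_conv_radius (fps_of_poly [:of_nat (Suc i):] * G)"
      using lt by (simp add: min_def split: if_splits)
    have "min (fps_conv_radius (fps_of_poly [:0, 1 :: complex:])) (fps_conv_radius (fps_deriv G)) \<le> fps_conv_radius (fps_of_poly [:0, 1:] * fps_deriv G)"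
      by (rule fps_conv_radius_mult)
    then show "ereal (norm x) < fps_conv_radius (fps_of_poly [:0, 1:] * fps_deriv G)"
      using lt by (simp add: min_def split: if_splits)
  qed
  moreover have "ereal (norm x) < fps_conv_radius H"
    using F21_conv_radius[OF a b c(1)] x unfolding H_def by simp
  ultimately have e: "of_nat (Suc i) * eval_fps G x + x * eval_fps (fps_deriv G) x = of_nat (Suc i) * eval_fps H x"
    using lt by (subst (asm) (1 2 3) eval_fps_mult) (simp_all only: fps_conv_radius_fps_of_poly, auto)
  have "((\<lambda>x. x ^ Suc i * eval_fps G x) has_field_derivative (of_nat (Suc i) * x ^ i) * eval_fps G x + eval_fps (fps_deriv G) x * x ^ Suc i) (at x)"
    by (rule DERIV_mult[OF _ d]) (rule DERIV_cong[OF DERIV_power_Suc[OF DERIV_ident]], simp)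
  also have "(of_nat (Suc i) * x ^ i) * eval_fps G x + eval_fps (fps_deriv G) x * x ^ Suc i = x ^ i * (of_nat (Suc i) * eval_fps G x + x * eval_fps (fps_deriv G) x)"
    by (simp add: algebra_simps)
  finally show ?thesis
    unfolding e by (simp add: G_def H_def mult_ac del: of_nat_Suc of_nat_add)
qed

text \<open>Each integration with respect to \<open>x\<close> raises \<open>c - a - b\<close> by one, starting from the zero-balanced case.\<close>

theorem F21_log_expansion:
  fixes a b :: complex
  assumes "a \<notin> \<int>\<^sub>\<le>\<^sub>0" "b \<notin> \<int>\<^sub>\<le>\<^sub>0" "a + b + of_nat i \<notin> \<int>\<^sub>\<le>\<^sub>0"
  shows "\<exists>\<epsilon> P. 0 < \<epsilon> \<and> \<epsilon> \<le> 1 \<and> P holomorphic_on ball 0 \<epsilon> \<and>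
    (\<forall>x \<in> ball 0 \<epsilon> \<inter> ball 1 1. eval_fps (F21 a b (a + b + of_nat i)) (1 - x) =
       P x + (-1) ^ Suc i * Gamma (a + b + of_nat i) / (Gamma a * Gamma b * fact i) * Ln x * x ^ i *
         eval_fps (F21 (a + of_nat i) (b + of_nat i) (of_nat (Suc i))) x)"
  using assms
proof (induction i arbitrary: a b)
  case 0
  then obtain \<epsilon> P where *: "0 < \<epsilon>" "\<epsilon> \<le> 1" "P holomorphic_on ball 0 \<epsilon>"
    "\<And>x. x \<in> ball 0 \<epsilon> \<inter> ball 1 1 \<Longrightarrow> eval_fps (F21 a b (a + b)) (1 - x) =
       P x - Gamma (a + b) / (Gamma a * Gamma b) * Ln x * eval_fps (F21 a b 1) x"
    using F21_zero_balanced_log[of a b] by (metis add.right_neutral of_nat_0)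
  then show ?case
    by (intro exI[of _ \<epsilon>] exI[of _ P]) (simp del: fps_hypergeo_nth)
next
  case (Suc i)
  define c where "c = a + b + of_nat (Suc i)"
  \<comment> \<open>Raising \<open>a\<close> and \<open>b\<close> by one in the derivative while
    lowering the index by one leaves these sums unchanged, so the logarithmic series keeps its upper
    parameters.\<close>
  define A B where "A = a + of_nat (Suc i)" and "B = b + of_nat (Suc i)"
  define k where "k = (-1) ^ Suc i * Gamma (c + 1) / (Gamma (a + 1) * Gamma (b + 1) * fact i)"
  have "c \<notin> \<int>\<^sub>\<le>\<^sub>0" using Suc.prems(3) by (simp only: c_def not_False_eq_True)
  note np = nonpos_Ints_plus_1[OF Suc.prems(1)] nonpos_Ints_plus_1[OF Suc.prems(2)] this nonpos_Ints_plus_1[OF this]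
  have nz: "a \<noteq> 0" "b \<noteq> 0" "c \<noteq> 0"
    using Suc.prems(1,2) np(3) by auto
  have npAB: "A \<notin> \<int>\<^sub>\<le>\<^sub>0" "B \<notin> \<int>\<^sub>\<le>\<^sub>0"
  proof -
    have "z + of_nat j \<notin> \<int>\<^sub>\<le>\<^sub>0" if "z \<notin> \<int>\<^sub>\<le>\<^sub>0" for z :: complex and j
    proof (induction j)
      case (Suc j)
      then show ?case using nonpos_Ints_plus_1[of "z + of_nat j"] by (simp add: add_ac)
    qed (use that in simp)
    then show "A \<notin> \<int>\<^sub>\<le>\<^sub>0" "B \<notin> \<int>\<^sub>\<le>\<^sub>0"
      using Suc.prems unfolding A_def B_def by blast+
  qed
  have e1: "(a + 1) + (b + 1) + of_nat i = c + 1" "(a + 1) + of_nat i = A" "(b + 1) + of_nat i = B"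
    by (simp_all add: c_def A_def B_def)
  obtain \<epsilon> P where \<epsilon>: "0 < \<epsilon>" "\<epsilon> \<le> 1" and P: "P holomorphic_on ball 0 \<epsilon>"
    and IH: "\<And>x. x \<in> ball 0 \<epsilon> \<inter> ball 1 1 \<Longrightarrow> eval_fps (F21 (a + 1) (b + 1) (c + 1)) (1 - x) =
       P x + k * Ln x * x ^ i * eval_fps (F21 A B (of_nat (Suc i))) x"
    using Suc.IH[of "a + 1" "b + 1"] np unfolding e1 k_def by blast
  define Q where "Q x = eval_fps (F21 A B (of_nat (i + 2))) x" for x
  define r where "r = a * b / c"
  have Qhol: "Q holomorphic_on ball 0 \<epsilon>"
  proof -
    have "of_nat (i + 2) \<notin> (\<int>\<^sub>\<le>\<^sub>0 :: complex set)"
      by (auto simp: of_nat_in_nonpos_Ints_iff simp del: of_nat_Suc of_nat_add)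
    then show ?thesis
      unfolding Q_def[abs_def]
      by (intro holomorphic_on_subset[OF eval_F21_holomorphic[OF npAB]]) (use \<epsilon> in auto)
  qed
  \<comment> \<open>Differentiating \<open>Ln x * (x ^ Suc i * Q x)\<close> also produces the
    logarithm-free term \<open>x ^ i * Q x\<close>; \<open>q\<close> collects it together with
    \<open>P\<close>.\<close>
  define q where "q x = - r * P x + r * k / of_nat (Suc i) * (x ^ i * Q x)" for x
  have qhol: "q holomorphic_on ball 0 \<epsilon>"
    unfolding q_def[abs_def] by (intro holomorphic_intros P Qhol) auto
  obtain p where "\<And>x. x \<in> ball 0 \<epsilon> \<Longrightarrow> (p has_field_derivative q x) (at x within ball 0 \<epsilon>)"
    using holomorphic_convex_primitive'[OF convex_ball open_ball qhol] by blast
  then have p: "\<And>x. x \<in> ball 0 \<epsilon> \<Longrightarrow> (p has_field_derivative q x) (at x)"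
    by (metis at_within_open open_ball)
  have phol: "p holomorphic_on ball 0 \<epsilon>"
    unfolding holomorphic_on_open[OF open_ball] using p by blast
  define y where "y x = eval_fps (F21 a b c) (1 - x)" for x
  let ?D = "ball 0 \<epsilon> \<inter> ball (1::complex) 1"
  have d: "((\<lambda>x. y x - (p x - r * k / of_nat (Suc i) * (Ln x * (x ^ Suc i * Q x)))) has_field_derivative 0) (at x within ?D)"
    if x: "x \<in> ?D" for x
  proof -
    have n: "norm (1 - x) < 1" "norm x < 1" using x \<epsilon> by (auto simp: dist_norm)
    have xs: "x \<notin> \<real>\<^sub>\<le>\<^sub>0" using x ball_1_1_nonpos_Reals[of x] by simp
    then have x0: "x \<noteq> 0" by auto
    have m: "((\<lambda>x. 1 - x) has_field_derivative - 1) (at x)"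
      by (auto intro!: derivative_eq_intros)
    have "(y has_field_derivative - eval_fps (fps_deriv (F21 a b c)) (1 - x)) (at x)"
      using DERIV_chain2[OF eval_F21_has_field_derivative(1)[OF Suc.prems(1,2) np(3) n(1)] m]
      by (simp add: y_def[abs_def])
    also have "eval_fps (fps_deriv (F21 a b c)) (1 - x) = r * eval_fps (F21 (a + 1) (b + 1) (c + 1)) (1 - x)"
      unfolding F21_deriv[OF np(3)] r_def
      using n F21_conv_radius[OF np(1,2,4)] by (subst eval_fps_mult) auto
    finally have dy: "(y has_field_derivative - (r * (P x + k * Ln x * x ^ i * eval_fps (F21 A B (of_nat (Suc i))) x))) (at x)"
      unfolding IH[OF x] .
    have dQ: "((\<lambda>x. x ^ Suc i * Q x) has_field_derivative of_nat (Suc i) * x ^ i * eval_fps (F21 A B (of_nat (Suc i))) x) (at x)"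
      unfolding Q_def[abs_def] by (rule eval_F21_power_deriv[OF npAB n(2)])
    have dL: "((\<lambda>x. Ln x * (x ^ Suc i * Q x)) has_field_derivative
       inverse x * (x ^ Suc i * Q x) + (of_nat (Suc i) * x ^ i * eval_fps (F21 A B (of_nat (Suc i))) x) * Ln x) (at x)"
      by (rule DERIV_mult[OF has_field_derivative_Ln[OF xs] dQ])
    have "((\<lambda>x. y x - (p x - r * k / of_nat (Suc i) * (Ln x * (x ^ Suc i * Q x)))) has_field_derivative
       - (r * (P x + k * Ln x * x ^ i * eval_fps (F21 A B (of_nat (Suc i))) x))
       - (q x - r * k / of_nat (Suc i) * (inverse x * (x ^ Suc i * Q x) + (of_nat (Suc i) * x ^ i * eval_fps (F21 A B (of_nat (Suc i))) x) * Ln x))) (at x)"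
      using x p[of x] by (intro DERIV_diff DERIV_cmult dy dL) auto
    also have "- (r * (P x + k * Ln x * x ^ i * eval_fps (F21 A B (of_nat (Suc i))) x))
       - (q x - r * k / of_nat (Suc i) * (inverse x * (x ^ Suc i * Q x) + (of_nat (Suc i) * x ^ i * eval_fps (F21 A B (of_nat (Suc i))) x) * Ln x)) = 0"
    proof -
      have "of_nat (Suc i) \<noteq> (0 :: complex)" by (rule of_nat_neq_0)
      then show ?thesis
        using x0 unfolding q_def by (simp add: divide_simps del: of_nat_Suc) (simp add: algebra_simps)
    qed
    finally show ?thesis by (rule has_field_derivative_at_within)
  qed
  obtain C where C: "\<And>x. x \<in> ?D \<Longrightarrow> y x - (p x - r * k / of_nat (Suc i) * (Ln x * (x ^ Suc i * Q x))) = C"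
    using has_field_derivative_zero_constant[OF convex_lens d] by blast
  \<comment> \<open>The functional equation of \<open>Gamma\<close> absorbs the factor
    \<open>a b / c\<close>. The sign changes because the argument is \<open>1 - x\<close>.\<close>
  have coef: "- (r * k / of_nat (Suc i)) = (-1) ^ Suc (Suc i) * Gamma c / (Gamma a * Gamma b * fact (Suc i))"
  proof -
    have "Gamma (a + 1) = a * Gamma a" "Gamma (b + 1) = b * Gamma b" "Gamma (c + 1) = c * Gamma c"
      using Suc.prems(1,2) np(3) by (auto intro!: Gamma_plus1)
    moreover have "Gamma a \<noteq> 0" "Gamma b \<noteq> 0" "of_nat (Suc i) \<noteq> (0 :: complex)"
      using Suc.prems(1,2) by (auto simp: Gamma_eq_zero_iff simp del: of_nat_Suc)
    ultimately show ?thesis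
      using nz unfolding k_def r_def fact_Suc by (simp add: divide_simps del: of_nat_Suc)
  qed
  show ?case
  proof (intro exI conjI ballI)
    show "0 < \<epsilon>" "\<epsilon> \<le> 1" by fact+
    show "(\<lambda>x. C + p x) holomorphic_on ball 0 \<epsilon>"
      by (intro holomorphic_intros phol)
    fix x assume x: "x \<in> ?D"
    have "y x = C + p x + (- (r * k / of_nat (Suc i))) * Ln x * x ^ Suc i * Q x"
      using C[OF x] by (simp add: algebra_simps)
    then show "eval_fps (F21 a b (a + b + of_nat (Suc i))) (1 - x) = C + p x +
       (-1) ^ Suc (Suc i) * Gamma (a + b + of_nat (Suc i)) / (Gamma a * Gamma b * fact (Suc i)) * Ln x * x ^ Suc i *
         eval_fps (F21 (a + of_nat (Suc i)) (b + of_nat (Suc i)) (of_nat (Suc (Suc i)))) x"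
      unfolding coef y_def Q_def c_def[symmetric] A_def[symmetric] B_def[symmetric]
      by (simp del: of_nat_Suc of_nat_add)
  qed
qed

subsection \<open>Continuation of Mellin transforms\<close>

lemma continuous_on_Icc_from_Ioc:
  fixes \<phi> :: "real \<Rightarrow> complex"
  assumes "continuous_on {0<..1} \<phi>" "(\<phi> \<longlongrightarrow> 0) (at_right 0)" "\<phi> 0 = 0"
  shows "continuous_on {0..1} \<phi>"
  unfolding continuous_on_eq_continuous_within
proof
  fix x :: real assume x: "x \<in> {0..1}"
  show "continuous (at x within {0..1}) \<phi>"
  proof (cases "x = 0")
    case True
    have "at x within {0..1} = at_right 0"
      unfolding True by (rule at_within_Icc_at_right) simp
    then show ?thesis using assms(2,3) True by (simp add: continuous_within)
  next
    case False
    with x have "x > 0" by simp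
    have "at x within {0..1} = at x within {0<..1}"
      by (rule at_within_nhd[of _ "{0<..}"]) (use \<open>x > 0\<close> in auto)
    moreover have "continuous (at x within {0<..1}) \<phi>"
      using assms(1) x \<open>x > 0\<close> by (auto simp: continuous_on_eq_continuous_within)
    ultimately show ?thesis by simp
  qed
qed

lemma powr_ln_tendsto_0:
  fixes a :: real
  assumes "a > 0"
  shows "((\<lambda>x. x powr a * ln x ^ i) \<longlongrightarrow> 0) (at_right 0)"
proof (cases "i = 0")
  case True
  then show ?thesis using assms by simp real_asymp
next
  case False
  \<comment> \<open>The power is distributed over the logarithms:
    \<open>x^a (ln x)^i = (x^(a/i) ln x)^i\<close>.\<close>
  define b where "b = a / real i"
  have "b > 0" using assms False by (simp add: b_def)
  then have "((\<lambda>x. x powr b * ln x) \<longlongrightarrow> 0) (at_right 0)"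
    by real_asymp
  then have "((\<lambda>x. (x powr b * ln x) ^ i) \<longlongrightarrow> 0 ^ i) (at_right 0)"
    by (intro tendsto_intros)
  moreover have "(0::real) ^ i = 0" using False by simp
  ultimately have "((\<lambda>x. (x powr b * ln x) ^ i) \<longlongrightarrow> 0) (at_right 0)"
    by (simp only:)
  moreover have "\<forall>\<^sub>F x in at_right 0. (x powr b * ln x) ^ i = x powr a * ln x ^ i"
    using eventually_at_right_less[of "0::real"]
  proof eventually_elim
    case (elim x)
    have "(x powr b) ^ i = x powr a"
      using False elim by (simp add: b_def powr_realpow[symmetric] powr_powr)
    then show ?case by (simp add: power_mult_distrib)
  qed
  ultimately show ?thesis
    by (rule Lim_transform_eventually)
qed

lemma cpowr_Ln_tendsto_0:
  assumes "Re w > 0"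
  shows "((\<lambda>x. of_real x powr w * Ln (of_real x) ^ i) \<longlongrightarrow> 0) (at_right 0)"
proof (rule tendsto_norm_zero_cancel)
  have "((\<lambda>x. \<bar>x powr Re w * ln x ^ i\<bar>) \<longlongrightarrow> 0) (at_right 0)"
    by (rule tendsto_rabs_zero[OF powr_ln_tendsto_0[OF assms]])
  then show "((\<lambda>x. norm (of_real x powr w * Ln (of_real x) ^ i)) \<longlongrightarrow> 0) (at_right 0)"
  proof (rule Lim_transform_eventually)
    show "\<forall>\<^sub>F x in at_right 0. \<bar>x powr Re w * ln x ^ i\<bar> = norm (of_real x powr w * Ln (of_real x) ^ i)"
      using eventually_at_right_less[of "0::real"]
      by eventually_elim (simp add: norm_mult norm_powr_real_powr abs_mult norm_power power_abs Ln_of_real)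
  qed
qed

lemma continuous_on_cpowr_Ln:
  assumes "Re w > 0"
  shows "continuous_on {0..1} (\<lambda>x. of_real x powr w * Ln (of_real x) ^ i)"
proof (rule continuous_on_Icc_from_Ioc)
  show "continuous_on {0<..1} (\<lambda>x. of_real x powr w * Ln (complex_of_real x) ^ i)"
    by (intro continuous_intros) (auto simp: complex_nonpos_Reals_iff)
qed (use cpowr_Ln_tendsto_0[OF assms] in auto)

text \<open>Integration by parts against \<open>x^(s+1) Ln(x)^i\<close> lowers the power of the
  logarithm by one and divides by \<open>s + 1\<close>. These values become the principal parts of
  the continuation.\<close>

lemma has_integral_cpowr_Ln:
  assumes "Re s > -1"
  shows "((\<lambda>x. of_real x powr s * Ln (of_real x) ^ i) has_integral (-1) ^ i * fact i / (s + 1) ^ Suc i) {0..1::real}"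
proof (induction i)
  have ne: "s + 1 \<noteq> 0" using assms by (auto simp: complex_eq_iff)
  have deriv: "((\<lambda>x. of_real x powr (s + 1) * Ln (of_real x) ^ i) has_vector_derivative
      (s + 1) * (of_real x powr s * Ln (of_real x) ^ i) + of_nat i * (of_real x powr s * Ln (of_real x) ^ (i - 1))) (at x)"
    if "x \<in> {0<..<1}" for x :: real and i
  proof (rule has_vector_derivative_real_field)
    have nz: "complex_of_real x \<notin> \<real>\<^sub>\<le>\<^sub>0" "complex_of_real x \<noteq> 0" using that by (auto simp: complex_nonpos_Reals_iff)
    have "complex_of_real x powr (s + 1) = of_real x powr s * of_real x"
      using that by (simp add: powr_add)
    then show "((\<lambda>x. x powr (s + 1) * Ln x ^ i) has_field_derivative
      (s + 1) * (of_real x powr s * Ln (of_real x) ^ i) + of_nat i * (of_real x powr s * Ln (of_real x) ^ (i - 1))) (at (of_real x))"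
      using nz by (auto intro!: derivative_eq_intros simp: field_simps)
  qed
  \<comment> \<open>The boundary term at 0 vanishes because \<open>0 powr w = 0\<close>, and the one
    at 1 survives only for \<open>i = 0\<close>. In that case the truncated exponent
    \<open>i - 1\<close> is multiplied by 0.\<close>
  have FTC: "((\<lambda>x. (s + 1) * (of_real x powr s * Ln (of_real x) ^ i) + of_nat i * (of_real x powr s * Ln (of_real x) ^ (i - 1)))
      has_integral (if i = 0 then 1 else 0)) {0..1::real}" for i
  proof -
    have "((\<lambda>x. (s + 1) * (of_real x powr s * Ln (of_real x) ^ i) + of_nat i * (of_real x powr s * Ln (of_real x) ^ (i - 1)))
      has_integral (of_real 1 powr (s + 1) * Ln (of_real 1) ^ i - of_real 0 powr (s + 1) * Ln (of_real 0) ^ i)) {0..1::real}"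
      using assms by (intro fundamental_theorem_of_calculus_interior continuous_on_cpowr_Ln deriv) auto
    then show ?thesis by (cases i) auto
  qed
  {
    case 0
    have "((\<lambda>x. inverse (s + 1) * ((s + 1) * (of_real x powr s))) has_integral inverse (s + 1) * 1) {0..1::real}"
      using FTC[of 0] by (intro has_integral_mult_right) simp
    then show ?case using ne by (simp add: inverse_eq_divide flip: mult.assoc)
  next
    case (Suc i)
    have "((\<lambda>x. inverse (s + 1) * (((s + 1) * (of_real x powr s * Ln (of_real x) ^ Suc i) + of_nat (Suc i) * (of_real x powr s * Ln (of_real x) ^ i))
        - of_nat (Suc i) * (of_real x powr s * Ln (of_real x) ^ i))) has_integral
        inverse (s + 1) * (0 - of_nat (Suc i) * ((-1) ^ i * fact i / (s + 1) ^ Suc i))) {0..1::real}"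
      using FTC[of "Suc i"] Suc.IH by (intro has_integral_mult_right has_integral_diff) auto
    also have "inverse (s + 1) * (0 - of_nat (Suc i) * ((-1) ^ i * fact i / (s + 1) ^ Suc i)) = (-1) ^ Suc i * fact (Suc i) / (s + 1) ^ Suc (Suc i)"
      using ne by (simp add: divide_simps)
    also have "(\<lambda>x::real. inverse (s + 1) * (((s + 1) * (of_real x powr s * Ln (of_real x) ^ Suc i) + of_nat (Suc i) * (of_real x powr s * Ln (of_real x) ^ i))
        - of_nat (Suc i) * (of_real x powr s * Ln (of_real x) ^ i))) = (\<lambda>x. of_real x powr s * Ln (of_real x) ^ Suc i)"
      using ne by (simp add: fun_eq_iff)
    finally show ?case .
  }
qed

lemma continuous_on_mellin:
  assumes "continuous_on {0..1} G"
  shows "continuous_on ({s. Re s > 0} \<times> {0..1::real}) (\<lambda>(s, x). of_real x powr s * G x)"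
proof -
  have "continuous_on ({s. Re s > 0} \<times> {0..1::real}) (\<lambda>p. complex_of_real (snd p) powr fst p * G (snd p))"
    by (intro continuous_intros continuous_on_compose2[OF assms]) auto
  then show ?thesis by (simp add: case_prod_beta)
qed

lemma mellin_integrable:
  assumes "continuous_on {0..1} G" "Re s > 0"
  shows "(\<lambda>x. of_real x powr s * G x) integrable_on {0..1::real}"
proof (rule integrable_continuous_real)
  show "continuous_on {0..1} (\<lambda>x. of_real x powr s * G x)"
    using assms by (intro continuous_intros) auto
qed

text \<open>Differentiation in \<open>s\<close> brings down a factor \<open>Ln x\<close>. Continuity
  of \<open>Ln x * G x\<close> up to 0 keeps the differentiated integrand jointly continuous, which
  justifies differentiating under the integral.\<close>

lemma mellin_holomorphic:
  assumes G: "continuous_on {0..1} G" "continuous_on {0..1} (\<lambda>x. Ln (of_real x) * G x)"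
  shows "(\<lambda>s. integral {0..1} (\<lambda>x. of_real x powr s * G x)) holomorphic_on {s. Re s > 0}"
proof -
  have "(\<lambda>s. integral (cbox 0 1) (\<lambda>x::real. of_real x powr s * G x)) holomorphic_on {s. Re s > 0}"
  proof (rule leibniz_rule_holomorphic[where fx = "\<lambda>s x. of_real x powr s * (Ln (of_real x) * G x)"])
    show "((\<lambda>s. of_real x powr s * G x) has_field_derivative of_real x powr s * (Ln (of_real x) * G x)) (at s within {s. Re s > 0})"
      if "s \<in> {s. Re s > 0}" for s and x :: real
    proof (cases "x = 0")
      case False
      then have "((\<lambda>s. of_real x powr s * G x) has_field_derivative (Ln (of_real x) * of_real x powr s) * G x) (at s)"
        by (intro DERIV_cmult_right has_field_derivative_powr_right) simp
      then show ?thesis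
        by (auto simp: mult_ac intro: has_field_derivative_at_within)
    qed simp
    show "(\<lambda>x. of_real x powr s * G x) integrable_on cbox 0 1" if "s \<in> {s. Re s > 0}" for s
      using mellin_integrable[OF G(1), of s] that by simp
    show "continuous_on ({s. 0 < Re s} \<times> cbox 0 1) (\<lambda>(s, x). of_real x powr s * (Ln (of_real x) * G x))"
      using continuous_on_mellin[OF G(2)] by simp
    show "convex {s. 0 < Re s}" by (rule convex_halfspace_Re_gt)
  qed
  then show ?thesis by simp
qed

lemma eval_fps_split:
  fixes F :: "complex fps"
  assumes "norm z < fps_conv_radius F"
  shows "eval_fps F z = (\<Sum>j<n. fps_nth F j * z ^ j) + z ^ n * eval_fps (fps_shift n F) z"
proof -
  have s: "summable (\<lambda>j. fps_nth F j * z ^ j)" using assms by (rule summable_fps)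
  have "summable (\<lambda>j. fps_nth (fps_shift n F) j * z ^ j)"
    using assms by (intro summable_fps) simp
  then have "(\<Sum>j. z ^ n * (fps_nth (fps_shift n F) j * z ^ j)) = z ^ n * eval_fps (fps_shift n F) z"
    unfolding eval_fps_def by (rule suminf_mult)
  then have "(\<Sum>j. fps_nth F (j + n) * z ^ (j + n)) = z ^ n * eval_fps (fps_shift n F) z"
    by (simp add: power_add mult_ac)
  then show ?thesis
    using suminf_split_initial_segment[OF s, of n] by (simp add: eval_fps_def)
qed

text \<open>Removing the Taylor terms with \<open>j <= K\<close> and dividing by \<open>x^K\<close>
  leaves a remainder of size \<open>x\<close> times powers of the logarithm: the one extra term
  makes it continuous on \<open>[0, 1]\<close> with value 0. Its Mellin integral is holomorphic for
  \<open>Re s > -K\<close>, while the removed terms integrate explicitly. Away from 0 only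
  continuity of \<open>f\<close> is used.\<close>

theorem mellin_continuation:
  fixes f :: "real \<Rightarrow> complex" and F :: "nat \<Rightarrow> complex fps"
  assumes f: "continuous_on {0<..1} f"
    and F: "\<And>i. i < d \<Longrightarrow> fps_conv_radius (F i) > 0"
    and ev: "\<forall>\<^sub>F x in at_right 0. f x = (\<Sum>i<d. eval_fps (F i) (of_real x) * Ln (of_real x) ^ i)"
  obtains M where "\<And>s. Re s > -1 \<Longrightarrow> M s = integral {0..1} (\<lambda>x. of_real x powr s * f x)"
    and "\<And>K. \<exists>R. R holomorphic_on {s. Re s > - real K} \<and> (\<forall>s. Re s > - real K \<longrightarrow>
       M s = R s + (\<Sum>j<Suc K. \<Sum>i<d. fps_nth (F i) j * ((-1) ^ i * fact i / (s + of_nat j + 1) ^ Suc i)))"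
proof -
  define G where "G K x = (if x = 0 then 0 else
     (f x - (\<Sum>j<Suc K. \<Sum>i<d. fps_nth (F i) j * (of_real x ^ j * Ln (of_real x) ^ i))) / of_real x ^ K)" for K and x :: real
  define R where "R K s = integral {0..1} (\<lambda>x. of_real x powr (s + of_nat K) * G K x)" for K s
  define T where "T s j = (\<Sum>i<d. fps_nth (F i) j * ((-1) ^ i * fact i / (s + of_nat j + 1) ^ Suc i))" for s :: complex and j
  define M' where "M' K s = R K s + (\<Sum>j<Suc K. T s j)" for K s
  have T: "((\<lambda>x. \<Sum>i<d. fps_nth (F i) j * (of_real x powr (s + of_nat j) * Ln (of_real x) ^ i)) has_integral T s j) {0..1::real}"
    if "Re s > -1 - real j" for s j
    unfolding T_def using that by (intro has_integral_sum has_integral_mult_right has_integral_cpowr_Ln) auto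
  have lim: "((\<lambda>x. Ln (of_real x) ^ e * G K x) \<longlongrightarrow> 0) (at_right 0)" for e K
  proof -
    have ev': "\<forall>\<^sub>F x in at_right 0. (\<Sum>i<d. eval_fps (fps_shift (Suc K) (F i)) (of_real x) * (of_real x powr 1 * Ln (of_real x) ^ (i + e)))
        = Ln (of_real x) ^ e * G K x"
    proof -
      have "\<forall>\<^sub>F x in at_right 0. \<forall>i<d. norm (complex_of_real x) < fps_conv_radius (F i)"
      proof -
        have "\<forall>\<^sub>F x in at_right 0. \<forall>i\<in>{..<d}. norm (complex_of_real x) < fps_conv_radius (F i)"
        proof (rule eventually_ball_finite; safe)
          fix i assume "i < d"
          then have "open (eball 0 (fps_conv_radius (F i)))" "0 \<in> eball 0 (fps_conv_radius (F i))"
            using F by (auto simp: zero_ereal_def)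
          then have "\<forall>\<^sub>F z in nhds 0. z \<in> eball 0 (fps_conv_radius (F i))"
            by (rule eventually_nhds_in_open)
          moreover have "((\<lambda>x. complex_of_real x) \<longlongrightarrow> complex_of_real 0) (at_right 0)"
            by (intro tendsto_intros)
          ultimately have "\<forall>\<^sub>F x in at_right 0. complex_of_real x \<in> eball 0 (fps_conv_radius (F i))"
            by (auto simp: filterlim_iff)
          then show "\<forall>\<^sub>F x in at_right 0. norm (complex_of_real x) < fps_conv_radius (F i)"
            by (auto elim!: eventually_mono)
        qed
        then show ?thesis by (auto elim!: eventually_mono)
      qed
      then show ?thesis
        using ev eventually_at_right_less[of "0::real"]
      proof eventually_elim
        case (elim x)
        have "f x = (\<Sum>i<d. (\<Sum>j<Suc K. fps_nth (F i) j * of_real x ^ j) * Ln (of_real x) ^ i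
           + of_real x ^ Suc K * eval_fps (fps_shift (Suc K) (F i)) (of_real x) * Ln (of_real x) ^ i)"
          unfolding elim(2) using elim(1)
          by (intro sum.cong refl) (subst eval_fps_split[of _ _ "Suc K"], auto simp: algebra_simps)
        also have "\<dots> = (\<Sum>i<d. \<Sum>j<Suc K. fps_nth (F i) j * (of_real x ^ j * Ln (of_real x) ^ i))
           + (\<Sum>i<d. of_real x ^ Suc K * eval_fps (fps_shift (Suc K) (F i)) (of_real x) * Ln (of_real x) ^ i)"
          unfolding sum.distrib sum_distrib_right mult.assoc ..
        also have "(\<Sum>i<d. \<Sum>j<Suc K. fps_nth (F i) j * (of_real x ^ j * Ln (of_real x) ^ i))
            = (\<Sum>j<Suc K. \<Sum>i<d. fps_nth (F i) j * (of_real x ^ j * Ln (of_real x) ^ i))"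
          by (rule sum.swap)
        finally have "G K x = (\<Sum>i<d. of_real x ^ Suc K * eval_fps (fps_shift (Suc K) (F i)) (of_real x) * Ln (of_real x) ^ i) / of_real x ^ K"
          using elim(3) by (simp add: G_def)
        then show ?case
          using elim(3) by (simp add: sum_distrib_left sum_divide_distrib power_add field_simps)
      qed
    qed
    have "((\<lambda>x. \<Sum>i<d. eval_fps (fps_shift (Suc K) (F i)) (of_real x) * (of_real x powr 1 * Ln (of_real x) ^ (i + e))) \<longlongrightarrow>
         (\<Sum>i<d. eval_fps (fps_shift (Suc K) (F i)) (of_real 0) * 0)) (at_right 0)"
    proof (intro tendsto_sum tendsto_mult cpowr_Ln_tendsto_0)
      fix i assume "i \<in> {..<d}"
      then have "isCont (eval_fps (fps_shift (Suc K) (F i))) (complex_of_real 0)"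
        using F by (intro continuous_eval_fps) (auto simp: zero_ereal_def)
      then show "((\<lambda>x. eval_fps (fps_shift (Suc K) (F i)) (of_real x)) \<longlongrightarrow> eval_fps (fps_shift (Suc K) (F i)) (of_real 0)) (at_right 0)"
        by (rule isCont_tendsto_compose) (intro tendsto_intros)
    qed simp
    then have "((\<lambda>x. \<Sum>i<d. eval_fps (fps_shift (Suc K) (F i)) (of_real x) * (of_real x powr 1 * Ln (of_real x) ^ (i + e))) \<longlongrightarrow> 0) (at_right 0)"
      by (simp only: mult_zero_right sum.neutral_const)
    then show ?thesis
      using ev' by (rule Lim_transform_eventually)
  qed
  have cont: "continuous_on {0..1} (\<lambda>x. Ln (of_real x) ^ e * G K x)" for e K
  proof (rule continuous_on_Icc_from_Ioc)
    have "continuous_on {0<..1} (\<lambda>x. Ln (of_real x) ^ e *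
       ((f x - (\<Sum>j<Suc K. \<Sum>i<d. fps_nth (F i) j * (of_real x ^ j * Ln (of_real x) ^ i))) / of_real x ^ K))"
      by (intro continuous_intros f) (auto simp: complex_nonpos_Reals_iff)
    then show "continuous_on {0<..1} (\<lambda>x. Ln (of_real x) ^ e * G K x)"
      by (rule continuous_on_eq) (simp add: G_def)
  qed (use lim in \<open>auto simp: G_def\<close>)
  have cont0: "continuous_on {0..1} (G K)" and cont1: "continuous_on {0..1} (\<lambda>x. Ln (of_real x) * G K x)" for K
    using cont[of 0 K] cont[of 1 K] by simp_all
  have Rint: "((\<lambda>x. of_real x powr (s + of_nat K) * G K x) has_integral R K s) {0..1}" if "Re s > - real K" for s K
    unfolding R_def by (rule integrable_integral, rule mellin_integrable[OF cont0]) (use that in simp)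
  have Rhol: "R K holomorphic_on {s. Re s > - real K}" for K
  proof -
    have "(\<lambda>s. integral {0..1} (\<lambda>x. of_real x powr s * G K x)) \<circ> (\<lambda>s. s + of_nat K) holomorphic_on {s. Re s > - real K}"
      by (rule holomorphic_on_compose_gen[OF _ mellin_holomorphic[OF cont0 cont1]]) (auto intro!: holomorphic_intros)
    then show ?thesis by (simp add: R_def[abs_def] o_def)
  qed
  \<comment> \<open>On the common half-plane both representations integrate the same function: one
    more Taylor term is moved from the integral to the explicit sum.\<close>
  have step: "M' (Suc K) s = M' K s" if "Re s > - real K" for s K
  proof -
    have "((\<lambda>x. of_real x powr (s + of_nat (Suc K)) * G (Suc K) x + 
       (\<Sum>i<d. fps_nth (F i) (Suc K) * (of_real x powr (s + of_nat (Suc K)) * Ln (of_real x) ^ i))) has_integral R (Suc K) s + T s (Suc K)) {0..1}"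
      using that by (intro has_integral_add Rint T) auto
    moreover have "of_real x powr (s + of_nat (Suc K)) * G (Suc K) x + 
       (\<Sum>i<d. fps_nth (F i) (Suc K) * (of_real x powr (s + of_nat (Suc K)) * Ln (of_real x) ^ i)) = of_real x powr (s + of_nat K) * G K x" for x :: real
    proof (cases "x = 0")
      case False
      have p: "complex_of_real x powr (s + of_nat (Suc K)) = of_real x powr (s + of_nat K) * of_real x"
        using False powr_add[of "complex_of_real x" "s + of_nat K" 1] by (simp add: add_ac)
      have "G (Suc K) x * of_real x = G K x - (\<Sum>i<d. fps_nth (F i) (Suc K) * (of_real x ^ Suc K * Ln (of_real x) ^ i)) / of_real x ^ K"
      proof -
        have "(u - (v + w)) / y ^ Suc K * y = (u - v) / y ^ K - w / y ^ K" if "y \<noteq> 0" for u v w y :: complex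
          using that by (simp add: divide_simps)
        then show ?thesis
          using False by (simp only: G_def sum.lessThan_Suc[of _ "Suc K"] if_False of_real_eq_0_iff not_False_eq_True)
      qed
      also have "(\<Sum>i<d. fps_nth (F i) (Suc K) * (of_real x ^ Suc K * Ln (of_real x) ^ i)) / of_real x ^ K
          = of_real x * (\<Sum>i<d. fps_nth (F i) (Suc K) * Ln (of_real x) ^ i)"
        using False by (simp add: sum_divide_distrib sum_distrib_left mult_ac)
      finally have "G K x = of_real x * (G (Suc K) x + (\<Sum>i<d. fps_nth (F i) (Suc K) * Ln (of_real x) ^ i))"
        by (simp only: distrib_left) (simp add: mult.commute)
      then show ?thesis
        unfolding p by (simp only: distrib_left sum_distrib_left mult_ac)
    qed simp
    ultimately have "((\<lambda>x. of_real x powr (s + of_nat K) * G K x) has_integral R (Suc K) s + T s (Suc K)) {0..1}"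
      by simp
    then have "R K s = R (Suc K) s + T s (Suc K)"
      using Rint[OF that] by (rule has_integral_unique[rotated])
    then show ?thesis by (simp add: M'_def)
  qed
  have steps: "M' (K + i) s = M' K s" if "Re s > - real K" for s K i
  proof (induction i)
    case (Suc i)
    then show ?case using step[of "K + i" s] that by simp
  qed simp
  \<comment> \<open>The order of the expansion depends on \<open>s\<close>; by \<open>steps\<close>
    any \<open>K\<close> with \<open>Re s > -K\<close> gives the same value.\<close>
  define M where "M s = M' (nat \<lceil>- Re s\<rceil> + 1) s" for s
  have M: "M s = M' K s" if "Re s > - real K" for s K
  proof -
    have "Re s > - real (nat \<lceil>- Re s\<rceil> + 1)" by linarith
    then show ?thesis
      using steps[OF that, of "nat \<lceil>- Re s\<rceil> + 1 - K"] steps[of "nat \<lceil>- Re s\<rceil> + 1" s "K - (nat \<lceil>- Re s\<rceil> + 1)"]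
      unfolding M_def by (cases "K \<le> nat \<lceil>- Re s\<rceil> + 1") (auto simp del: of_nat_add)
  qed
  show ?thesis
  proof (rule that[of M])
    fix s assume s: "Re s > -1"
    \<comment> \<open>The choice \<open>K = 1\<close> is the smallest for which the remainder
      integral is available on all of \<open>Re s > -1\<close>.\<close>
    have "((\<lambda>x. of_real x powr (s + of_nat 1) * G 1 x + (\<Sum>j<2.
       (\<Sum>i<d. fps_nth (F i) j * (of_real x powr (s + of_nat j) * Ln (of_real x) ^ i)))) has_integral R 1 s + (\<Sum>j<2. T s j)) {0..1}"
      (is "(?I has_integral _) _") using s by (intro has_integral_add has_integral_sum Rint T) auto
    moreover have "M s = R 1 s + (\<Sum>j<2. T s j)"
      using M[of 1 s] s unfolding M'_def by (simp add: numeral_2_eq_2)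
    ultimately have I: "(?I has_integral M s) {0..1}" by (simp only:)
    have "of_real x powr (s + of_nat 1) * G 1 x + (\<Sum>j<2.
       (\<Sum>i<d. fps_nth (F i) j * (of_real x powr (s + of_nat j) * Ln (of_real x) ^ i))) = of_real x powr s * f x" for x :: real
    proof (cases "x = 0")
      case False
      have p: "complex_of_real x powr (s + of_nat 1) = of_real x powr s * of_real x" "complex_of_real x powr (s + 1) = of_real x powr s * of_real x"
        using False powr_add[of "complex_of_real x" "s" 1] by simp_all
      have "of_real x * G 1 x = f x - (\<Sum>j<2. \<Sum>i<d. fps_nth (F i) j * (of_real x ^ j * Ln (of_real x) ^ i))"
        using False by (simp add: G_def numeral_2_eq_2)
      then have "of_real x powr (s + of_nat 1) * G 1 x = of_real x powr s * (f x - (\<Sum>j<2. \<Sum>i<d. fps_nth (F i) j * (of_real x ^ j * Ln (of_real x) ^ i)))"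
        unfolding p by (simp add: mult.assoc)
      moreover have "(\<Sum>j<2. \<Sum>i<d. fps_nth (F i) j * (of_real x powr (s + of_nat j) * Ln (of_real x) ^ i))
          = of_real x powr s * (\<Sum>j<2. \<Sum>i<d. fps_nth (F i) j * (of_real x ^ j * Ln (of_real x) ^ i))"
      proof -
        have "complex_of_real x powr (s + of_nat j) = of_real x powr s * of_real x ^ j" for j
          using False by (simp add: powr_add powr_nat')
        then show ?thesis
          unfolding sum_distrib_left by (simp only: mult_ac)
      qed
      ultimately show ?thesis
        by (simp only: right_diff_distrib diff_add_cancel)
    qed simp
    then have "?I = (\<lambda>x. of_real x powr s * f x)" by (intro ext)
    with I have "((\<lambda>x. of_real x powr s * f x) has_integral M s) {0..1}" by (simp only:)
    then show "M s = integral {0..1} (\<lambda>x. of_real x powr s * f x)"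
      by (rule integral_unique[symmetric])
  next
    fix K
    show "\<exists>R. R holomorphic_on {s. Re s > - real K} \<and> (\<forall>s. Re s > - real K \<longrightarrow>
       M s = R s + (\<Sum>j<Suc K. \<Sum>i<d. fps_nth (F i) j * ((-1) ^ i * fact i / (s + of_nat j + 1) ^ Suc i)))"
      using Rhol[of K] M[of K] unfolding M'_def T_def by blast
  qed
qed

subsection \<open>The integrand near the endpoint\<close>

lemma integral_reflect_unit:
  fixes f :: "real \<Rightarrow> complex"
  shows "integral {0..1} (\<lambda>x. f (1 - x)) = integral {0..1} f"
proof -
  have *: "((\<lambda>x. g (1 - x)) has_integral i) {0..1}" if "(g has_integral i) {0..1}" for g :: "real \<Rightarrow> complex" and i
  proof -
    have "((\<lambda>x. g (-1 *\<^sub>R x + 1)) has_integral (1 / (\<bar>-1\<bar> ^ DIM(real))) *\<^sub>R i) ((\<lambda>x. (1 / -1) *\<^sub>R x + -((1 / -1) *\<^sub>R 1)) ` cbox 0 1)"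
      using that by (intro has_integral_affinity) auto
    moreover have "(\<lambda>x::real. (1 / -1) *\<^sub>R x + -((1 / -1) *\<^sub>R 1)) ` cbox 0 1 = {0..1}"
      by (auto simp: image_iff intro!: bexI[of _ "1 - x" for x])
    ultimately show ?thesis by simp
  qed
  show ?thesis
  proof (cases "f integrable_on {0..1}")
    case True
    then show ?thesis using * by (blast intro: integral_unique dest: integrable_integral)
  next
    case False
    moreover have "\<not> (\<lambda>x. f (1 - x)) integrable_on {0..1}"
      using False *[of "\<lambda>x. f (1 - x)"] by (auto simp: integrable_on_def)
    ultimately show ?thesis by (simp add: not_integrable_integral)
  qed
qed

lemma of_real_F21_nth:
  "complex_of_real (fps_nth (F21 a b c) l) = fps_nth (F21 (of_real a) (of_real b) (of_real c)) l"
  unfolding F21_nth by (simp add: pochhammer_of_real)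

lemma of_real_hypergeo_F21:
  assumes "norm (complex_of_real t) < fps_conv_radius (F21 (of_real a) (of_real b) (of_real c) :: complex fps)"
  shows "complex_of_real (hypergeo [a, b] [c] t) = eval_fps (F21 (of_real a) (of_real b) (of_real c)) (of_real t)"
proof -
  have "(\<lambda>l. complex_of_real (fps_nth (F21 a b c) l * t ^ l)) sums eval_fps (F21 (of_real a) (of_real b) (of_real c)) (of_real t)"
    unfolding of_real_mult of_real_F21_nth of_real_power by (rule sums_eval_fps[OF assms])
  moreover from this have "summable (\<lambda>l. fps_nth (F21 a b c) l * t ^ l)"
    using summable_Re[OF sums_summable[OF calculation]] by (simp only: Re_complex_of_real)
  then have "(\<lambda>l. complex_of_real (fps_nth (F21 a b c) l * t ^ l)) sums complex_of_real (hypergeo [a, b] [c] t)"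
    unfolding hypergeo_def eval_fps_def by (intro sums_of_real summable_sums)
  ultimately show ?thesis by (rule sums_unique2[symmetric])
qed

lemma odd_half_nonpos_Ints:
  fixes n :: nat
  assumes "odd n"
  shows "of_int i + complex_of_nat n / 2 \<notin> \<int>" "of_int i - complex_of_nat n / 2 \<notin> \<int>"
proof -
  have *: "complex_of_nat n / 2 \<notin> \<int>"
  proof
    assume "complex_of_nat n / 2 \<in> \<int>"
    then obtain j where "complex_of_nat n / 2 = of_int j" by (auto elim: Ints_cases)
    then have "complex_of_int (int n) = of_int (2 * j)" by (simp add: field_simps)
    then have "int n = 2 * j" by (simp only: of_int_eq_iff)
    with assms show False by presburger
  qed
  show "of_int i + complex_of_nat n / 2 \<notin> \<int>" "of_int i - complex_of_nat n / 2 \<notin> \<int>"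
    using * Ints_diff[of "of_int i + complex_of_nat n / 2" "of_int i"] Ints_diff[of "of_int i :: complex" "of_int i - complex_of_nat n / 2"]
    by (auto simp del: Ints_diff)
qed

section \<open>Logarithmic parts of \<open>S_fun\<close> and of the integrand in
  \<open>x = 1 - t\<close>\<close>

definition S_prefactor :: "nat \<Rightarrow> nat \<Rightarrow> complex" where
  "S_prefactor n m = pochhammer (of_nat n - 1) m / pochhammer (of_nat n / 2) m"

text \<open>The connection coefficient of \<open>F21_log_expansion\<close> for \<open>a = m\<close>,
  \<open>b = 1 - n/2\<close>, \<open>i = n - 1\<close>, times the prefactor of \<open>S_fun\<close>;
  the sign \<open>(-1)^n\<close> is \<open>(-1)^Suc i\<close>. For \<open>m = 0\<close> the function
  is constantly 1 and carries no logarithm.\<close>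

definition S_log_coeff :: "nat \<Rightarrow> nat \<Rightarrow> complex" where
  "S_log_coeff n m = (if m = 0 then 0 else S_prefactor n m * ((-1) ^ n * Gamma (of_nat m + of_nat n / 2) / (Gamma (of_nat m) * Gamma (1 - of_nat n / 2) * fact (n - 1))))"

definition S_log_fps :: "nat \<Rightarrow> nat \<Rightarrow> complex fps" where
  "S_log_fps n m = fps_const (S_log_coeff n m) * (fps_X ^ (n - 1) * F21 (of_nat m + of_nat n - 1) (of_nat n / 2) (of_nat n))"

definition I_integrand :: "nat \<Rightarrow> nat \<Rightarrow> real \<Rightarrow> complex" where
  "I_integrand n m x = of_real ((1 - x) powr (real m + real n / 2 - 1)) * of_real (S_fun n m (1 - x) ^ 2)"

context
  fixes n m :: nat
  assumes n: "odd n" "n \<ge> 3"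
begin

lemma S_params:
  assumes "m \<ge> 1"
  shows "of_nat m \<notin> (\<int>\<^sub>\<le>\<^sub>0 :: complex set)" "1 - of_nat n / 2 \<notin> (\<int>\<^sub>\<le>\<^sub>0 :: complex set)"
    "of_nat m + of_nat n / 2 \<notin> (\<int>\<^sub>\<le>\<^sub>0 :: complex set)"
  using odd_half_nonpos_Ints[OF n(1), of 1] odd_half_nonpos_Ints[OF n(1), of "int m"] assms
  by (auto simp: of_nat_in_nonpos_Ints_iff dest: nonpos_Ints_Int)

lemma of_real_S_fun:
  assumes "m \<ge> 1" "\<bar>t\<bar> < 1"
  shows "complex_of_real (S_fun n m t) = S_prefactor n m * eval_fps (F21 (of_nat m) (1 - of_nat n / 2) (of_nat m + of_nat n / 2)) (of_real t)"
proof -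
  have "norm (complex_of_real t) < fps_conv_radius (F21 (of_real (real m)) (of_real (1 - real n / 2)) (of_real (real m + real n / 2)) :: complex fps)"
    using F21_conv_radius[OF S_params[OF assms(1)]] assms(2) by simp
  from of_real_hypergeo_F21[OF this] show ?thesis
    unfolding S_fun_def S_prefactor_def of_real_mult of_real_divide by (simp flip: pochhammer_of_real)
qed

lemma S_fun_0: "S_fun n 0 t = 1"
proof -
  have "fps_hypergeo [0, 1 - real n / 2] [real n / 2] 1 = 1"
    by (rule fps_ext) (auto simp: pochhammer_0_left)
  then show ?thesis by (simp add: S_fun_def hypergeo_def)
qed

lemma continuous_on_S_fun: "continuous_on {0<..1} (\<lambda>x. complex_of_real (S_fun n m (1 - x)))"
proof (cases "m = 0")
  case True
  then show ?thesis by (simp add: S_fun_0)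
next
  case False
  have "continuous_on {0<..1} (\<lambda>x::real. S_prefactor n m * eval_fps (F21 (of_nat m) (1 - of_nat n / 2) (of_nat m + of_nat n / 2)) (of_real (1 - x)))"
  proof (intro continuous_intros)
    have "dist 0 (complex_of_real (1 - x)) = \<bar>1 - x\<bar>" for x
      by (simp only: dist_0_norm norm_of_real)
    then show "(\<lambda>x. complex_of_real (1 - x)) ` {0<..1} \<subseteq> eball 0 (fps_conv_radius (F21 (of_nat m) (1 - of_nat n / 2) (of_nat m + of_nat n / 2) :: complex fps))"
      using F21_conv_radius[OF S_params] False by (auto simp del: of_real_diff)
  qed
  then show ?thesis
    by (rule continuous_on_eq) (use False in \<open>auto simp: of_real_S_fun\<close>)
qed

lemma S_fun_expansion:
  obtains P Q p where "P has_fps_expansion p" "Q has_fps_expansion S_log_fps n m"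
    "\<forall>\<^sub>F x in at_right 0. complex_of_real (S_fun n m (1 - x)) = P (of_real x) + Ln (of_real x) * Q (of_real x)"
proof (cases "m = 0")
  case True
  have "S_log_fps n m = 0" unfolding S_log_fps_def S_log_coeff_def using True by simp
  then show ?thesis
    using True by (intro that[of "\<lambda>_. 1" 1 "\<lambda>_. 0"]) (simp_all add: S_fun_0)
next
  case False
  then have m: "m \<ge> 1" by simp
  let ?a = "of_nat m :: complex" and ?b = "1 - of_nat n / 2 :: complex"
  \<comment> \<open>The excess of the lower over the upper parameters is \<open>n - 1\<close>;
    shifting the upper ones by it gives \<open>m + n - 1\<close> and \<open>n / 2\<close>.\<close>
  have e: "?a + ?b + of_nat (n - 1) = of_nat m + of_nat n / 2" "?a + of_nat (n - 1) = of_nat m + of_nat n - 1"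
    "?b + of_nat (n - 1) = of_nat n / 2" "Suc (n - 1) = n"
    using n by (simp_all add: of_nat_diff field_simps)
  obtain \<epsilon> P where \<epsilon>: "0 < \<epsilon>" "\<epsilon> \<le> 1" and P: "P holomorphic_on ball 0 \<epsilon>"
    and eq: "\<And>x. x \<in> ball 0 \<epsilon> \<inter> ball 1 1 \<Longrightarrow> eval_fps (F21 ?a ?b (of_nat m + of_nat n / 2)) (1 - x) =
       P x + (-1) ^ n * Gamma (of_nat m + of_nat n / 2) / (Gamma ?a * Gamma ?b * fact (n - 1)) * Ln x * x ^ (n - 1) *
         eval_fps (F21 (of_nat m + of_nat n - 1) (of_nat n / 2) (of_nat n)) x"
    using F21_log_expansion[of ?a ?b "n - 1", unfolded e] S_params[OF m] by blast
  let ?F = "F21 (of_nat m + of_nat n - 1) (of_nat n / 2) (of_nat n) :: complex fps"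
  have "P has_fps_expansion fps_expansion P 0"
    using P \<epsilon> by (intro analytic_at_imp_has_fps_expansion_0) (meson analytic_at centre_in_ball open_ball)
  then have p: "(\<lambda>x. S_prefactor n m * P x) has_fps_expansion fps_const (S_prefactor n m) * fps_expansion P 0"
    by (intro fps_expansion_intros)
  have "of_nat m + of_nat n - 1 \<notin> (\<int>\<^sub>\<le>\<^sub>0 :: complex set)"
    using n m of_nat_in_nonpos_Ints_iff[of "m + n - 1", where 'a = complex] by (simp add: of_nat_diff)
  moreover have "of_nat n / 2 \<notin> (\<int>\<^sub>\<le>\<^sub>0 :: complex set)" "of_nat n \<notin> (\<int>\<^sub>\<le>\<^sub>0 :: complex set)"
    using odd_half_nonpos_Ints[OF n(1), of 0] n by (auto simp: of_nat_in_nonpos_Ints_iff dest: nonpos_Ints_Int)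
  ultimately have "fps_conv_radius ?F > 0"
    by (simp add: F21_conv_radius)
  then have "eval_fps ?F has_fps_expansion ?F"
    by (rule eval_fps_has_fps_expansion)
  then have q: "(\<lambda>x. S_log_coeff n m * (x ^ (n - 1) * eval_fps ?F x)) has_fps_expansion S_log_fps n m"
    unfolding S_log_fps_def by (intro fps_expansion_intros)
  have "\<forall>\<^sub>F x in at_right 0. complex_of_real (S_fun n m (1 - x)) = S_prefactor n m * P (of_real x)
       + Ln (of_real x) * (S_log_coeff n m * (of_real x ^ (n - 1) * eval_fps ?F (of_real x)))"
    using eventually_in_lens[OF \<epsilon>(1)] eventually_at_right_real[OF zero_less_one]
  proof eventually_elim
    case (elim x)
    then have "complex_of_real (S_fun n m (1 - x)) = S_prefactor n m * eval_fps (F21 ?a ?b (of_nat m + of_nat n / 2)) (1 - of_real x)"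
      using of_real_S_fun[OF m, of "1 - x"] by simp
    then show ?case
      unfolding eq[OF elim(1)] S_log_coeff_def using m by (simp add: algebra_simps del: fps_hypergeo_nth)
  qed
  then show ?thesis by (rule that[OF p q])
qed

lemma continuous_on_I_integrand: "continuous_on {0<..1} (I_integrand n m)"
proof -
  have "continuous_on {0<..1} (\<lambda>x. (1 - x) powr (real m + real n / 2 - 1))"
    using n by (intro continuous_on_powr' continuous_intros) auto
  then show ?thesis
    unfolding I_integrand_def of_real_power
    by (intro continuous_on_mult continuous_on_of_real continuous_on_power continuous_on_S_fun)
qed

lemma I_integral_eq:
  "I_integral n m s = Gamma (of_nat n / 2 + s + 1) / (Gamma (of_nat n / 2) * Gamma (s + 1)) *
     integral {0..1} (\<lambda>x. of_real x powr s * I_integrand n m x)"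
proof -
  have "integral {0..1} (\<lambda>x. of_real x powr s * I_integrand n m x) = integral {0..1} (\<lambda>t. 
       of_real (t powr (real m + real n / 2 - 1)) * of_real (1 - t) powr s * of_real (S_fun n m t ^ 2))"
    by (subst integral_reflect_unit[symmetric]) (simp add: I_integrand_def mult_ac)
  then show ?thesis by (simp add: I_integral_def)
qed

text \<open>The generalized binomial theorem at \<open>-x\<close>. The coefficients differ from
  those of \<open>fps_binomial\<close> only by signs, so the radius is inherited through their
  norms.\<close>

lemma has_fps_expansion_one_minus_powr:
  "(\<lambda>x. (1 - x) powr c) has_fps_expansion geo_pow (- c)" for c :: complex
proof -
  have nth: "(c gchoose k) * (- x) ^ k = fps_nth (geo_pow (- c)) k * x ^ k" for k and x :: complex
  proof -
    have "(- x) ^ k = (-1) ^ k * x ^ k" by (rule power_minus)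
    moreover have "(-1) ^ k * ((-1) ^ k * z) = z" for z :: complex
      by (simp flip: mult.assoc power_mult_distrib)
    ultimately show ?thesis by (simp add: gbinomial_pochhammer)
  qed
  have "norm (fps_nth (geo_pow (- c)) k) = norm (fps_nth (fps_binomial c) k)" for k
    using arg_cong[OF nth[of k 1], of norm] by (simp add: norm_mult norm_power del: fps_hypergeo_nth)
  then have "fps_conv_radius (geo_pow (- c)) = fps_conv_radius (fps_binomial c)"
    by (metis (no_types, lifting) ext fps_conv_radius_norm)
  then have r: "fps_conv_radius (geo_pow (- c)) > 0"
    by (simp add: fps_conv_radius_binomial)
  have "\<forall>\<^sub>F x in nhds 0. norm (x :: complex) < 1"
    using eventually_nhds_in_open[of "ball (0::complex) 1" 0] by simp
  then have "\<forall>\<^sub>F x in nhds 0. eval_fps (geo_pow (- c)) x = (1 - x) powr c"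
  proof eventually_elim
    case (elim x)
    then have "(\<lambda>k. (c gchoose k) * (- x) ^ k) sums (1 + - x) powr c"
      by (intro gen_binomial_complex) simp
    then show ?case unfolding nth by (simp add: eval_fps_def sums_iff del: fps_hypergeo_nth)
  qed
  then show ?thesis using r by (simp add: has_fps_expansion_def)
qed

text \<open>Expanding the square of \<open>P + Ln * Q\<close> sorts the integrand by powers of the
  logarithm. Only the part \<open>F 2\<close> is made explicit, since it alone feeds the cubic poles
  of the Mellin integral.\<close>

lemma I_integrand_expansion:
  obtains F :: "nat \<Rightarrow> complex fps" where "\<And>i. i < 3 \<Longrightarrow> fps_conv_radius (F i) > 0"
    "\<forall>\<^sub>F x in at_right 0. I_integrand n m x = (\<Sum>i<3. eval_fps (F i) (of_real x) * Ln (of_real x) ^ i)"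
    "F 2 = geo_pow (1 - of_nat m - of_nat n / 2) * S_log_fps n m ^ 2"
proof -
  obtain P Q p where P: "P has_fps_expansion p" and Q: "Q has_fps_expansion S_log_fps n m"
    and ev: "\<forall>\<^sub>F x in at_right 0. complex_of_real (S_fun n m (1 - x)) = P (of_real x) + Ln (of_real x) * Q (of_real x)"
    by (rule S_fun_expansion)
  define c where "c = of_nat m + complex_of_nat n / 2 - 1"
  define w where "w = geo_pow (- c)"
  define W where "W x = (1 - x) powr c" for x
  have W: "W has_fps_expansion w"
    unfolding W_def[abs_def] w_def by (rule has_fps_expansion_one_minus_powr)
  define F where "F i = (if i = 0 then w * p ^ 2 else if i = 1 then 2 * w * p * S_log_fps n m else w * S_log_fps n m ^ 2)" for i :: nat
  define G where "G i x = (if i = 0 then W x * P x ^ 2 else if i = 1 then 2 * W x * P x * Q x else W x * Q x ^ 2)" for i :: nat and x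
  have GF: "G i has_fps_expansion F i" for i
  proof -
    have "(\<lambda>x. W x * P x ^ 2) has_fps_expansion w * p ^ 2" "(\<lambda>x. 2 * W x * P x * Q x) has_fps_expansion 2 * w * p * S_log_fps n m"
      "(\<lambda>x. W x * Q x ^ 2) has_fps_expansion w * S_log_fps n m ^ 2"
      by (intro fps_expansion_intros W P Q)+
    then show ?thesis unfolding G_def[abs_def] F_def by auto
  qed
  have lim: "filterlim (\<lambda>x. complex_of_real x) (nhds 0) (at_right 0)"
    using tendsto_of_real[OF tendsto_ident_at, of 0 "{0<..}"] by simp
  have GF_ev: "\<forall>\<^sub>F x in at_right 0. eval_fps (F i) (complex_of_real x) = G i (of_real x)" for i
    using GF[of i] lim by (auto simp: has_fps_expansion_def filterlim_iff)
  show ?thesis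
  proof (rule that[of F])
    show "fps_conv_radius (F i) > 0" for i
      using GF[of i] by (simp add: has_fps_expansion_def)
    show "F 2 = geo_pow (1 - of_nat m - of_nat n / 2) * S_log_fps n m ^ 2"
      by (simp add: F_def w_def c_def algebra_simps del: fps_hypergeo_nth)
    show "\<forall>\<^sub>F x in at_right 0. I_integrand n m x = (\<Sum>i<3. eval_fps (F i) (of_real x) * Ln (of_real x) ^ i)"
      using ev GF_ev[of 0] GF_ev[of 1] GF_ev[of 2] eventually_at_right_real[OF zero_less_one]
    proof eventually_elim
      case (elim x)
      have "complex_of_real ((1 - x) powr (real m + real n / 2 - 1)) = W (of_real x)"
        using elim(5) by (simp add: W_def c_def powr_of_real[symmetric])
      then have "I_integrand n m x = W (of_real x) * (P (of_real x) + Ln (of_real x) * Q (of_real x)) ^ 2"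
        by (simp add: I_integrand_def elim(1))
      also have "\<dots> = (\<Sum>i<3. G i (of_real x) * Ln (of_real x) ^ i)"
        by (simp add: G_def numeral_3_eq_3 power2_eq_square algebra_simps)
      finally show ?case using elim(2-4) by (simp add: numeral_3_eq_3 numeral_2_eq_2)
    qed
  qed
qed

end

subsection \<open>Poles of the continuation\<close>

text \<open>A finite limit excludes a pole of \<open>(s - z)^2 f\<close>, so its constant Laurent
  coefficient is that limit. Since \<open>L = 0\<close> is allowed, the lemma also certifies the
  absence of a term of order two.\<close>

lemma laurent_coeff_2_eqI:
  assumes f: "f meromorphic_on {z}" and lim: "((\<lambda>s. (s - z) ^ 2 * f s) \<longlongrightarrow> L) (at z)"
  shows "fls_nth (laurent_expansion f z) (-2) = L"
proof -
  define F where "F = laurent_expansion f z"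
  have F: "(\<lambda>w. f (z + w)) has_laurent_expansion F"
    unfolding F_def using f by (rule meromorphic_on_imp_has_laurent_expansion) simp
  have G: "(\<lambda>w. w ^ 2 * f (z + w)) has_laurent_expansion fls_X ^ 2 * F"
    by (intro laurent_expansion_intros F)
  have "at z = filtermap (\<lambda>w. z + w) (at 0)"
    using at_to_0[of z] by (simp add: add.commute)
  then have lim0: "((\<lambda>w. w ^ 2 * f (z + w)) \<longlongrightarrow> L) (at 0)"
    using lim by (simp add: filterlim_filtermap)
  have "fls_subdegree (fls_X ^ 2 * F) \<ge> 0"
  proof (rule ccontr)
    assume "\<not> ?thesis"
    then have "is_pole (\<lambda>w. w ^ 2 * f (z + w)) 0"
      using G by (intro has_laurent_expansion_imp_is_pole_0) auto
    then show False
      using lim0 not_tendsto_and_filterlim_at_infinity[of "at (0::complex)"] unfolding is_pole_def by auto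
  qed
  from has_laurent_expansion_imp_tendsto_0[OF G this] have "fls_nth (fls_X ^ 2 * F) 0 = L"
    using lim0 by (rule LIM_unique)
  then show ?thesis
    by (simp add: F_def fls_X_power_times_conv_shift)
qed

lemma is_pole_if_double_limit:
  fixes f :: "complex \<Rightarrow> complex"
  assumes lim: "((\<lambda>s. (s - z) ^ 2 * f s) \<longlongrightarrow> L) (at z)" and "L \<noteq> 0"
  shows "is_pole f z"
proof -
  have "filterlim (\<lambda>s. (s - z) ^ 2 * f s / (s - z) ^ 2) at_infinity (at z)"
    using assms
    by (intro filterlim_divide_at_infinity[OF lim]) (auto simp: filterlim_at eventually_at_filter intro!: tendsto_eq_intros)
  moreover have "\<forall>\<^sub>F s in at z. (s - z) ^ 2 * f s / (s - z) ^ 2 = f s"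
    by (auto simp: eventually_at_filter)
  ultimately show ?thesis
    unfolding is_pole_def by (rule filterlim_mono_eventually[OF _ order_refl order_refl])
qed

lemma Gamma_shift_meromorphic: "(\<lambda>s. Gamma (c + s + 1)) meromorphic_on A"
proof -
  have "(\<lambda>s. inverse (rGamma (c + s + 1))) meromorphic_on A"
    by (intro meromorphic_intros analytic_on_imp_meromorphic_on analytic_intros)
  then show ?thesis by (simp add: rGamma_inverse_Gamma)
qed

text \<open>Identity theorem: the difference is zero, or else nonzero, outside a sparse set, and
  agreement on an open set excludes the latter. It transfers limits of an explicit formula to the
  continuation chosen by \<open>SOME\<close>.\<close>

lemma nicely_meromorphic_eventually_eq:
  assumes f: "f nicely_meromorphic_on UNIV" and g: "g meromorphic_on UNIV"
    and U: "open U" "z0 \<in> U" "\<And>s. s \<in> U \<Longrightarrow> f s = g s"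
  shows "\<forall>\<^sub>F s in at z. f s = g s"
proof -
  have "f meromorphic_on UNIV" using f by (simp add: nicely_meromorphic_on_def)
  then have m: "(\<lambda>s. f s - g s) meromorphic_on UNIV"
    using g by (intro meromorphic_intros)
  consider "eventually (\<lambda>s. f s - g s = 0) (cosparse UNIV)" | "eventually (\<lambda>s. f s - g s \<noteq> 0) (cosparse UNIV)"
    using meromorphic_imp_constant_or_avoid[OF m, of 0] by auto
  then show ?thesis
  proof cases
    case 1
    then show ?thesis by (simp add: eventually_cosparse_open_eq)
  next
    case 2
    then have "\<forall>\<^sub>F s in at z0. f s - g s \<noteq> 0"
      by (simp add: eventually_cosparse_open_eq)
    moreover have "\<forall>\<^sub>F s in at z0. s \<in> U"
      using U by (intro eventually_at_in_open')
    ultimately have "\<forall>\<^sub>F s in at z0. False"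
      by eventually_elim (use U in auto)
    then show ?thesis by simp
  qed
qed

context
  fixes n m :: nat
  assumes n: "odd n" "n \<ge> 3"
begin

text \<open>At \<open>-j - 1\<close> a cubic pole with coefficient
  \<open>2 * fps_nth (F 2) j\<close> meets the zero of \<open>rGamma\<close>, whose slope is
  \<open>(-1)^j j!\<close>; the other Gamma factor is finite there because its argument is a
  half-integer. At all other points the Mellin part is continuous and \<open>Gamma\<close> has at
  most a simple pole.\<close>

lemma I_fun_double_limits:
  "I_fun n m meromorphic_on UNIV"
  "((\<lambda>s. (s + of_nat j + 1) ^ 2 * I_fun n m s) \<longlongrightarrow>
     Gamma (of_nat n / 2 - of_nat j) / Gamma (of_nat n / 2) * ((-1) ^ j * fact j) *
       (2 * fps_nth (geo_pow (1 - of_nat m - of_nat n / 2) * S_log_fps n m ^ 2) j)) (at (- of_nat j - 1))"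
  "\<forall>j. s0 \<noteq> - of_nat j - 1 \<Longrightarrow> ((\<lambda>s. (s - s0) ^ 2 * I_fun n m s) \<longlongrightarrow> 0) (at s0)"
proof -
  obtain F where F: "\<And>i. i < 3 \<Longrightarrow> fps_conv_radius (F i) > 0"
    "\<forall>\<^sub>F x in at_right 0. I_integrand n m x = (\<Sum>i<3. eval_fps (F i) (of_real x) * Ln (of_real x) ^ i)"
    and F2: "F 2 = geo_pow (1 - of_nat m - of_nat n / 2) * S_log_fps n m ^ 2"
    using I_integrand_expansion[OF n] by blast
  obtain M where M: "\<And>s. Re s > -1 \<Longrightarrow> M s = integral {0..1} (\<lambda>x. of_real x powr s * I_integrand n m x)"
    and MK: "\<And>K. \<exists>R. R holomorphic_on {s. Re s > - real K} \<and> (\<forall>s. Re s > - real K \<longrightarrow>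
       M s = R s + (\<Sum>j<Suc K. \<Sum>i<3. fps_nth (F i) j * ((-1) ^ i * fact i / (s + of_nat j + 1) ^ Suc i)))"
    using mellin_continuation[OF continuous_on_I_integrand[OF n] F] by blast
  define h where "h = complex_of_nat n / 2"
  have hG: "Gamma h \<noteq> 0"
    using odd_half_nonpos_Ints(1)[OF n(1), of 0] by (auto simp: Gamma_eq_zero_iff h_def dest: nonpos_Ints_Int)
  \<comment> \<open>\<open>rGamma\<close> replaces the division by \<open>Gamma (s + 1)\<close>: it
    is entire, and its zeros and slopes are known.\<close>
  define I where "I s = Gamma (h + s + 1) / Gamma h * rGamma (s + 1) * M s" for s
  have open_half: "open {s. Re s > - real K}" for K
    by (rule open_halfspace_Re_gt)
  have Mmero: "M meromorphic_on UNIV"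
    unfolding meromorphic_on_meromorphic_at[of M UNIV]
  proof
    fix z :: complex
    define K where "K = nat \<lceil>\<bar>Re z\<bar>\<rceil> + 1"
    have z: "Re z > - real K" unfolding K_def by linarith
    obtain R where R: "R holomorphic_on {s. Re s > - real K}" "\<And>s. Re s > - real K \<Longrightarrow>
       M s = R s + (\<Sum>j<Suc K. \<Sum>i<3. fps_nth (F i) j * ((-1) ^ i * fact i / (s + of_nat j + 1) ^ Suc i))"
      using MK[of K] by blast
    have "R meromorphic_on {z}"
      using R(1) z open_half by (meson analytic_at analytic_on_imp_meromorphic_on mem_Collect_eq)
    then have "(\<lambda>s. R s + (\<Sum>j<Suc K. \<Sum>i<3. fps_nth (F i) j * ((-1) ^ i * fact i / (s + of_nat j + 1) ^ Suc i))) meromorphic_on {z}"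
      by (intro meromorphic_intros)
    moreover have "\<forall>\<^sub>F s in at z. s \<in> {s. Re s > - real K}"
      using z open_half by (intro eventually_at_in_open') auto
    then have "\<forall>\<^sub>F s in at z. M s = R s + (\<Sum>j<Suc K. \<Sum>i<3. fps_nth (F i) j * ((-1) ^ i * fact i / (s + of_nat j + 1) ^ Suc i))"
      by eventually_elim (use R(2) in auto)
    ultimately show "M meromorphic_on {z}"
      by (subst meromorphic_on_cong) auto
  qed
  have Mcont: "isCont M z" if "\<forall>j. z \<noteq> - of_nat j - 1" for z
  proof -
    define K where "K = nat \<lceil>\<bar>Re z\<bar>\<rceil> + 1"
    have z: "Re z > - real K" unfolding K_def by linarith
    obtain R where R: "R holomorphic_on {s. Re s > - real K}" "\<And>s. Re s > - real K \<Longrightarrow>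
       M s = R s + (\<Sum>j<Suc K. \<Sum>i<3. fps_nth (F i) j * ((-1) ^ i * fact i / (s + of_nat j + 1) ^ Suc i))"
      using MK[of K] by blast
    have "isCont R z"
      using R(1) z open_half[of K] by (metis continuous_on_eq_continuous_at holomorphic_on_imp_continuous_on mem_Collect_eq)
    moreover have "z + of_nat j + 1 \<noteq> 0" for j
      using that by (metis add.assoc add_eq_0_iff2 diff_conv_add_uminus minus_add_distrib)
    ultimately have "isCont (\<lambda>s. R s + (\<Sum>j<Suc K. \<Sum>i<3. fps_nth (F i) j * ((-1) ^ i * fact i / (s + of_nat j + 1) ^ Suc i))) z"
      by (intro continuous_intros) auto
    moreover have "\<forall>\<^sub>F s in nhds z. s \<in> {s. Re s > - real K}"
      using z open_half by (intro eventually_nhds_in_open) auto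
    then have "\<forall>\<^sub>F s in nhds z. M s = R s + (\<Sum>j<Suc K. \<Sum>i<3. fps_nth (F i) j * ((-1) ^ i * fact i / (s + of_nat j + 1) ^ Suc i))"
      by eventually_elim (use R(2) in auto)
    ultimately show ?thesis by (simp add: isCont_cong)
  qed
  \<comment> \<open>Among the finitely many principal terms only \<open>j = l\<close>,
    \<open>i = 2\<close> survives the cubic factor; the 2 is \<open>2!\<close>.\<close>
  have Mlim: "((\<lambda>s. (s + of_nat l + 1) ^ 3 * M s) \<longlongrightarrow> 2 * fps_nth (F 2) l) (at (- of_nat l - 1))" for l
  proof -
    define z where "z = - complex_of_nat l - 1"
    define K where "K = l + 2"
    have z: "Re z > - real K" by (simp add: z_def K_def)
    obtain R where R: "R holomorphic_on {s. Re s > - real K}" "\<And>s. Re s > - real K \<Longrightarrow>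
       M s = R s + (\<Sum>j<Suc K. \<Sum>i<3. fps_nth (F i) j * ((-1) ^ i * fact i / (s + of_nat j + 1) ^ Suc i))"
      using MK[of K] by blast
    have "isCont R z"
      using R(1) z open_half[of K] by (metis continuous_on_eq_continuous_at holomorphic_on_imp_continuous_on mem_Collect_eq)
    then have Rl: "(R \<longlongrightarrow> R z) (at z)" by (simp add: isCont_def)
    have z0: "((\<lambda>s. s + of_nat l + 1) \<longlongrightarrow> 0) (at z)"
      by (auto intro!: tendsto_eq_intros simp: z_def)
    have term_lim: "((\<lambda>s. (s + of_nat l + 1) ^ 3 * (fps_nth (F i) j * ((-1) ^ i * fact i / (s + of_nat j + 1) ^ Suc i))) \<longlongrightarrow>
        (if j = l \<and> i = 2 then 2 * fps_nth (F 2) l else 0)) (at z)" if i: "i < 3" for i j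
    proof (cases "j = l")
      case False
      then have "z + of_nat j + 1 \<noteq> 0" by (auto simp: z_def)
      then have "((\<lambda>s. (s + of_nat l + 1) ^ 3 * (fps_nth (F i) j * ((-1) ^ i * fact i / (s + of_nat j + 1) ^ Suc i))) \<longlongrightarrow>
        0 ^ 3 * (fps_nth (F i) j * ((-1) ^ i * fact i / (z + of_nat j + 1) ^ Suc i))) (at z)"
        by (intro tendsto_intros z0) auto
      then show ?thesis using False by simp
    next
      case True
      have "((\<lambda>s. (s + of_nat l + 1) ^ (2 - i) * (fps_nth (F i) l * ((-1) ^ i * fact i))) \<longlongrightarrow>
          0 ^ (2 - i) * (fps_nth (F i) l * ((-1) ^ i * fact i))) (at z)"
        by (intro tendsto_intros z0)
      also have "0 ^ (2 - i) * (fps_nth (F i) l * ((-1) ^ i * fact i)) = (if j = l \<and> i = 2 then 2 * fps_nth (F 2) l else 0)"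
        using i True by (auto simp: less_Suc_eq numeral_3_eq_3 numeral_2_eq_2)
      finally show ?thesis
      proof (rule Lim_transform_eventually)
        have "\<forall>\<^sub>F s in at z. s \<noteq> z" by (simp add: eventually_at_filter)
        then show "\<forall>\<^sub>F s in at z. (s + of_nat l + 1) ^ (2 - i) * (fps_nth (F i) l * ((-1) ^ i * fact i)) =
            (s + of_nat l + 1) ^ 3 * (fps_nth (F i) j * ((-1) ^ i * fact i / (s + of_nat j + 1) ^ Suc i))"
        proof eventually_elim
          case (elim s)
          then have "s + of_nat l + 1 \<noteq> 0" by (auto simp: z_def add_eq_0_iff2 add.assoc)
          moreover have "(s + of_nat l + 1) ^ 3 = (s + of_nat l + 1) ^ (2 - i) * (s + of_nat l + 1) ^ Suc i"
          proof -
            have "3 = (2 - i) + Suc i" using i by simp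
            then show ?thesis by (metis power_add)
          qed
          ultimately show ?case using True by (simp del: power_Suc)
        qed
      qed
    qed
    have "((\<lambda>s. (s + of_nat l + 1) ^ 3 * R s + (\<Sum>j<Suc K. \<Sum>i<3. (s + of_nat l + 1) ^ 3 *
         (fps_nth (F i) j * ((-1) ^ i * fact i / (s + of_nat j + 1) ^ Suc i)))) \<longlongrightarrow>
       0 ^ 3 * R z + (\<Sum>j<Suc K. \<Sum>i<(3::nat). (if j = l \<and> i = 2 then 2 * fps_nth (F 2) l else 0))) (at z)"
      by (intro tendsto_add tendsto_mult tendsto_power z0 Rl tendsto_sum term_lim) auto
    also have "(\<Sum>j<Suc K. \<Sum>i<(3::nat). (if j = l \<and> i = 2 then 2 * fps_nth (F 2) l else 0)) = (\<Sum>j<Suc K. if j = l then 2 * fps_nth (F 2) l else 0)"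
      by (intro sum.cong) (auto simp: numeral_3_eq_3 numeral_2_eq_2)
    also have "0 ^ 3 * R z + (\<Sum>j<Suc K. if j = l then 2 * fps_nth (F 2) l else 0) = 2 * fps_nth (F 2) l"
      by (subst sum.delta) (simp_all add: K_def)
    finally have "((\<lambda>s. (s + of_nat l + 1) ^ 3 * M s) \<longlongrightarrow> 2 * fps_nth (F 2) l) (at z)"
    proof (rule Lim_transform_eventually)
      have "\<forall>\<^sub>F s in at z. s \<in> {s. Re s > - real K}"
        using z open_half by (intro eventually_at_in_open') auto
      then show "\<forall>\<^sub>F s in at z. (s + of_nat l + 1) ^ 3 * R s + (\<Sum>j<Suc K. \<Sum>i<3. (s + of_nat l + 1) ^ 3 *
         (fps_nth (F i) j * ((-1) ^ i * fact i / (s + of_nat j + 1) ^ Suc i))) = (s + of_nat l + 1) ^ 3 * M s"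
      proof eventually_elim
        case (elim s)
        then have "M s = R s + (\<Sum>j<Suc K. \<Sum>i<3. fps_nth (F i) j * ((-1) ^ i * fact i / (s + of_nat j + 1) ^ Suc i))"
          by (intro R(2)) simp
        then show ?case by (simp only: distrib_left sum_distrib_left)
      qed
    qed
    then show ?thesis by (simp add: z_def)
  qed
  have Imero: "I meromorphic_on UNIV"
    unfolding I_def[abs_def]
    by (intro meromorphic_intros Gamma_shift_meromorphic Mmero analytic_on_imp_meromorphic_on analytic_intros)
  have Iint: "I s = I_integral n m s" if "Re s > -1" for s
    using M[OF that] by (simp add: I_def I_integral_eq[OF n] h_def rGamma_inverse_Gamma field_simps)
  have h_np: "h + s + 1 \<notin> \<int>\<^sub>\<le>\<^sub>0" if "Re s > -1" for s
    using that by (auto simp: h_def nonpos_Ints_def complex_eq_iff)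
  have Icont: "isCont I s" if "Re s > -1" for s
  proof -
    have "s \<noteq> - of_nat j - 1" for j using that by auto
    then have "isCont M s" by (intro Mcont) auto
    then show ?thesis
      unfolding I_def[abs_def] using h_np[OF that] hG
      by (intro continuous_intros) auto
  qed
  \<comment> \<open>Witness for the \<open>SOME\<close> in \<open>I_fun\<close>. For
    \<open>Re s > -1\<close> the formula is continuous, so removing singularities changes no value
    there.\<close>
  have "remove_sings I nicely_meromorphic_on UNIV"
    by (rule remove_sings_nicely_meromorphic[OF Imero])
  moreover have "\<forall>s. Re s > -1 \<longrightarrow> remove_sings I s = I_integral n m s"
    using Icont Iint by (auto intro!: remove_sings_eqI simp: isCont_def)
  ultimately have "\<exists>f. f nicely_meromorphic_on UNIV \<and> (\<forall>s. Re s > -1 \<longrightarrow> f s = I_integral n m s)"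
    by blast
  then have I_fun: "I_fun n m nicely_meromorphic_on UNIV" "\<And>s. Re s > -1 \<Longrightarrow> I_fun n m s = I_integral n m s"
    unfolding I_fun_def by (rule someI2_ex; blast)+
  then show "I_fun n m meromorphic_on UNIV"
    by (simp add: nicely_meromorphic_on_def)
  have ev: "\<forall>\<^sub>F s in at z. I s = I_fun n m s" for z
    using nicely_meromorphic_eventually_eq[OF I_fun(1) Imero, of "{s. Re s > -1}" 0 z] I_fun(2) Iint
    by (simp add: open_halfspace_Re_gt eq_commute)
  show "((\<lambda>s. (s + of_nat j + 1) ^ 2 * I_fun n m s) \<longlongrightarrow>
     Gamma (of_nat n / 2 - of_nat j) / Gamma (of_nat n / 2) * ((-1) ^ j * fact j) *
       (2 * fps_nth (geo_pow (1 - of_nat m - of_nat n / 2) * S_log_fps n m ^ 2) j)) (at (- of_nat j - 1))"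
  proof -
    define z where "z = - complex_of_nat j - 1"
    have hz: "h + z + 1 \<notin> \<int>\<^sub>\<le>\<^sub>0" "h + z + 1 = h - of_nat j"
      using odd_half_nonpos_Ints(1)[OF n(1), of "- int j"] by (auto simp: z_def h_def dest: nonpos_Ints_Int)
    have L1: "((\<lambda>s. Gamma (h + s + 1)) \<longlongrightarrow> Gamma (h + z + 1)) (at z)"
      by (intro tendsto_intros hz(1))
    have L2: "((\<lambda>s. rGamma (s + 1) / (s + 1 + of_nat j)) \<longlongrightarrow> (-1) ^ j * fact j) (at z)"
    proof -
      have "at (- of_nat j) = filtermap (\<lambda>s. s + 1) (at z)"
        using filtermap_at_shift[of "-1" z] by (simp add: z_def)
      then show ?thesis
        using rGamma_zeros[of j, where 'a = complex] by (simp add: filterlim_filtermap)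
    qed
    have "((\<lambda>s. Gamma (h + s + 1) / Gamma h * (rGamma (s + 1) / (s + 1 + of_nat j)) * ((s + of_nat j + 1) ^ 3 * M s)) \<longlongrightarrow>
       Gamma (h + z + 1) / Gamma h * ((-1) ^ j * fact j) * (2 * fps_nth (F 2) j)) (at z)"
      by (rule tendsto_mult[OF tendsto_mult[OF tendsto_divide[OF L1 tendsto_const hG] L2] Mlim[of j, folded z_def]])
    moreover have "\<forall>\<^sub>F s in at z. Gamma (h + s + 1) / Gamma h * (rGamma (s + 1) / (s + 1 + of_nat j)) * ((s + of_nat j + 1) ^ 3 * M s)
        = (s + of_nat j + 1) ^ 2 * I_fun n m s"
    proof -
      have "\<forall>\<^sub>F s in at z. s \<noteq> z" by (simp add: eventually_at_filter)
      then show ?thesis using ev[of z]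
      proof eventually_elim
        case (elim s)
        then have "s + 1 + of_nat j \<noteq> 0" by (auto simp: z_def add_eq_0_iff2 add.assoc)
        then have "r / (s + 1 + of_nat j) * ((s + 1 + of_nat j) ^ 3 * y) = (s + 1 + of_nat j) ^ 2 * (r * y)" for r y
          by (simp add: power3_eq_cube power2_eq_square)
        moreover have "s + of_nat j + 1 = s + 1 + of_nat j" by simp
        ultimately show ?case
          unfolding elim(2)[symmetric] I_def by (simp only: mult.assoc) (simp only: mult_ac)
      qed
    qed
    ultimately show ?thesis
      unfolding hz(2) by (simp add: Lim_transform_eventually h_def z_def F2)
  qed
  show "((\<lambda>s. (s - s0) ^ 2 * I_fun n m s) \<longlongrightarrow> 0) (at s0)" if s0: "\<forall>j. s0 \<noteq> - of_nat j - 1"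
  proof -
    \<comment> \<open>One factor \<open>s - s0\<close> compensates a possible pole of
      \<open>Gamma\<close>; the second one then sends the product to 0.\<close>
    have "\<exists>c. ((\<lambda>s. (s - s0) * Gamma (h + s + 1)) \<longlongrightarrow> c) (at s0)"
    proof (cases "h + s0 + 1 \<in> \<int>\<^sub>\<le>\<^sub>0")
      case True
      then obtain j where j: "h + s0 + 1 = - of_nat j" by (auto elim: nonpos_Ints_cases')
      have "at (- of_nat j) = filtermap (\<lambda>s. s + (h + 1)) (at s0)"
        using filtermap_at_shift[of "- (h + 1)" s0] j by (simp add: algebra_simps)
      then have "((\<lambda>s. Gamma (s + (h + 1)) * (s + (h + 1) + of_nat j)) \<longlongrightarrow> (-1) ^ j / fact j) (at s0)"
        using Gamma_residues[of j, where 'a = complex] by (simp add: filterlim_filtermap)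
      moreover have "Gamma (s + (h + 1)) * (s + (h + 1) + of_nat j) = (s - s0) * Gamma (h + s + 1)" for s
      proof -
        have "s0 = - of_nat j - (h + 1)" unfolding j[symmetric] by simp
        then have "s + (h + 1) + of_nat j = s - s0" by simp
        moreover have "s + (h + 1) = h + s + 1" by simp
        ultimately show ?thesis by (simp only: mult.commute)
      qed
      ultimately show ?thesis by (simp only:) blast
    next
      case False
      then have "((\<lambda>s. (s - s0) * Gamma (h + s + 1)) \<longlongrightarrow> (s0 - s0) * Gamma (h + s0 + 1)) (at s0)"
        by (intro tendsto_intros) auto
      then show ?thesis by blast
    qed
    then obtain c where c: "((\<lambda>s. (s - s0) * Gamma (h + s + 1)) \<longlongrightarrow> c) (at s0)" by blast
    have "((\<lambda>s. (s - s0) * ((s - s0) * Gamma (h + s + 1)) * (inverse (Gamma h) * rGamma (s + 1) * M s)) \<longlongrightarrow>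
       (s0 - s0) * c * (inverse (Gamma h) * rGamma (s0 + 1) * M s0)) (at s0)"
    proof (intro tendsto_intros c)
      have "isCont (\<lambda>s. rGamma (s + 1)) s0" by (intro continuous_intros)
      then show "((\<lambda>s. rGamma (s + 1)) \<longlongrightarrow> rGamma (s0 + 1)) (at s0)" by (simp add: isCont_def)
      show "(M \<longlongrightarrow> M s0) (at s0)" using Mcont[OF s0] by (simp add: isCont_def)
    qed
    then have "((\<lambda>s. (s - s0) * ((s - s0) * Gamma (h + s + 1)) * (inverse (Gamma h) * rGamma (s + 1) * M s)) \<longlongrightarrow> 0) (at s0)"
      by simp
    then show ?thesis
    proof (rule Lim_transform_eventually)
      show "\<forall>\<^sub>F s in at s0. (s - s0) * ((s - s0) * Gamma (h + s + 1)) * (inverse (Gamma h) * rGamma (s + 1) * M s) = (s - s0) ^ 2 * I_fun n m s"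
        using ev[of s0]
      proof eventually_elim
        case (elim s)
        show ?case unfolding elim[symmetric] I_def by (simp add: power2_eq_square divide_inverse mult_ac)
      qed
    qed
  qed
qed

end

section \<open>Signs and closed form of the double-pole coefficients\<close>

lemma half_nat_neq:
  assumes "n \<ge> 1"
  shows "2 * (real n / 2) \<noteq> - real j" "4 * (real n / 2) \<noteq> 1 - real j"
  using assms by linarith+

text \<open>Here \<open>2 b - a = 1 - m\<close>, and the sign of \<open>(1 - m)_l\<close> cancels
  that of \<open>(-1/4)^l\<close>. All summands are therefore nonnegative, and the one with
  \<open>l = 0\<close> is positive.\<close>

lemma F21_square_quadratic_pos:
  assumes "n \<ge> 1" "m \<ge> 1"
  shows "fps_nth (geo_pow (real n / 2 - (real m + real n - 1)) * F21 (real m + real n - 1) (real n / 2) (real n) ^ 2) k > 0"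
proof -
  let ?a = "real m + real n - 1" and ?b = "real n / 2"
  note b = half_nat_neq[OF assms(1)]
  have pos: "pochhammer x l > 0" if "x > 0" for x :: real and l
    using that by (simp add: pochhammer_pos)
  have nonneg: "quad_coeff ?a ?b l * fps_nth (quad_basis ?b l) k \<ge> 0" for l
  proof (rule mult_nonneg_nonneg)
    have e1: "2 * ?b - ?a = - of_nat (m - 1)" using assms by (simp add: of_nat_diff)
    have e2: "(-1/4 :: real) ^ l = (-1) ^ l / 4 ^ l" by (simp only: power_divide)
    have W: "pochhammer (2 * ?b - ?a) l * (-1/4) ^ l = (if l \<le> m - 1 then fact (m - 1) / fact (m - 1 - l) / 4 ^ l else 0)"
      unfolding e1 pochhammer_neg_nat e2 by (cases "even l") simp_all
    have "quad_coeff ?a ?b l = pochhammer ?a l * pochhammer ?b l * (pochhammer (2 * ?b - ?a) l * (-1/4) ^ l)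
        / (pochhammer (2 * ?b) l * pochhammer (?b + 1/2) l * fact l)"
      unfolding quad_coeff_def by (simp only: mult_ac)
    also have "\<dots> \<ge> 0"
      unfolding W using assms by (intro divide_nonneg_nonneg mult_nonneg_nonneg less_imp_le[OF pos]) simp_all
    finally show "quad_coeff ?a ?b l \<ge> 0" .
    show "fps_nth (quad_basis ?b l) k \<ge> 0"
      using pos[of "?b + of_nat l" "k - 2 * l"] assms
      by (auto simp: quad_basis_def fps_X_power_mult_nth intro!: divide_nonneg_nonneg less_imp_le)
  qed
  have "k < 2 * Suc k" by simp
  then have "fps_nth (geo_pow (?b - ?a) * F21 ?a ?b (2 * ?b) ^ 2) k = (\<Sum>l<Suc k. quad_coeff ?a ?b l * fps_nth (quad_basis ?b l) k)"
    by (rule F21_square_quadratic[OF b])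
  also have "\<dots> > 0"
  proof (rule sum_pos2[of _ 0])
    show "quad_coeff ?a ?b 0 * fps_nth (quad_basis ?b 0) k > 0"
      using pos[of ?b k] assms by (simp add: quad_coeff_def quad_basis_def)
  qed (use nonneg in auto)
  finally show ?thesis by simp
qed

lemma of_real_geo_F21_square_nth:
  "complex_of_real (fps_nth (geo_pow p * F21 a b c ^ 2) k) =
   fps_nth (geo_pow (of_real p) * F21 (of_real a) (of_real b) (of_real c) ^ 2) k"
proof -
  have "complex_of_real (fps_nth (geo_pow p) l) = fps_nth (geo_pow (of_real p)) l" for l
    unfolding geo_pow_nth by (simp add: pochhammer_of_real)
  then show ?thesis
    by (simp add: fps_mult_nth power2_eq_square of_real_F21_nth del: fps_hypergeo_nth)
qed

text \<open>In the reflection formula the sine at an odd multiple of \<open>pi / 2\<close> is a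
  sign. This is the origin of \<open>(-1)^((n-1)/2)\<close>.\<close>

lemma Gamma_half_odd_reflection:
  fixes n j :: nat
  assumes "odd n"
  shows "Gamma (of_nat n / 2 - of_nat j) = complex_of_real (pi * (-1) ^ ((n - 1) div 2) * (-1) ^ j / Gamma (1 - real n / 2 + real j))"
proof -
  obtain p where p: "n = 2 * p + 1" using assms by (auto elim: oddE)
  have "sin (pi * (real n / 2 - real j)) = sin (real p * pi - real j * pi + pi / 2)"
    by (simp add: p field_simps)
  also have "\<dots> = (-1) ^ p * (-1) ^ j"
    by (simp add: sin_add sin_diff cos_diff)
  finally have s: "sin (pi * (real n / 2 - real j)) = (-1) ^ p * (-1) ^ j" .
  define x where "x = real n / 2 - real j"
  have "Gamma (1 - complex_of_real x) = of_real (Gamma (1 - x))"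
    using Gamma_complex_of_real[of "1 - x"] by simp
  moreover have "sin (of_real pi * complex_of_real x) = of_real (sin (pi * x))"
    by (simp only: of_real_mult[symmetric] sin_of_real)
  ultimately have "complex_of_real (Gamma x * Gamma (1 - x)) = complex_of_real (pi / sin (pi * x))"
    using Gamma_reflection_complex[of "complex_of_real x"] Gamma_complex_of_real[of x]
    by (simp only: of_real_mult of_real_divide)
  then have "Gamma x * Gamma (1 - x) = pi / sin (pi * x)"
    by (simp only: of_real_eq_iff)
  moreover have "1 - x = 1 - real n / 2 + real j" by (simp add: x_def)
  ultimately have r: "Gamma (real n / 2 - real j) * Gamma (1 - real n / 2 + real j) = pi / ((-1) ^ p * (-1) ^ j)"
    using s by (simp only: x_def)
  moreover have "pi / ((-1) ^ p * (-1) ^ j) \<noteq> 0" by simp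
  ultimately have ne: "Gamma (1 - real n / 2 + real j) \<noteq> 0" by (metis mult_zero_right)
  have e: "pi / ((-1) ^ p * (-1) ^ j) = pi * (-1) ^ p * (-1) ^ j"
    by (simp add: divide_inverse power_inverse[symmetric] mult.assoc)
  have "Gamma (real n / 2 - real j) = pi * (-1) ^ p * (-1) ^ j / Gamma (1 - real n / 2 + real j)"
    by (rule eq_divide_imp[OF ne]) (simp only: r e)
  then show ?thesis
    using Gamma_complex_of_real[of "real n / 2 - real j"] p by simp
qed

definition double_pole_coeff :: "nat \<Rightarrow> nat \<Rightarrow> nat \<Rightarrow> real" where
  "double_pole_coeff n k m = (-1) ^ ((n - 1) div 2) * (2 * pi / fact k) *
               (fact (2 * n + k - 2) / fact (n - 1) ^ 2) *
               (Gamma (real k + real n / 2) / Gamma (1 - real n / 2) ^ 2) *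
               (Gamma (real n - 1 + real m) ^ 2 /
                 (Gamma (real n - 1) ^ 2 * Gamma (real m) ^ 2 *
                  Gamma (3 * real n / 2 + real k - 1))) *
               hypergeo
                 [real m + real n - 1, - real k / 2, (1 - real k) / 2, 1 - real m]
                 [real n, 1 - real n / 2 - real k, (real n + 1) / 2] 1"

context
  fixes n :: nat
  assumes n: "odd n" "n \<ge> 3"
begin

lemma Gamma_half_neq_0: "Gamma (1 - real n / 2) \<noteq> 0"
proof -
  have "Gamma (1 - complex_of_nat n / 2) \<noteq> 0"
    using odd_half_nonpos_Ints(2)[OF n(1), of 1] by (auto simp: Gamma_eq_zero_iff dest: nonpos_Ints_Int)
  then show ?thesis using Gamma_complex_of_real[of "1 - real n / 2"] by auto
qed

text \<open>Writing \<open>(n/2)_m\<close> as a quotient of Gamma values cancels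
  \<open>Gamma (m + n/2)\<close>. The minus sign is \<open>(-1)^n\<close> for odd \<open>n\<close>
  and disappears on squaring.\<close>

lemma S_log_coeff_real:
  assumes "m \<ge> 1"
  shows "S_log_coeff n m = of_real (- (Gamma (real n - 1 + real m) * Gamma (real n / 2) /
      (Gamma (real n - 1) * Gamma (real m) * Gamma (1 - real n / 2) * fact (n - 1))))"
proof -
  have pos: "real n - 1 > 0" "real n / 2 > 0" "real m > 0" using n assms by auto
  have np: "x \<notin> \<int>\<^sub>\<le>\<^sub>0" if "x > 0" for x :: real using that by (auto elim!: nonpos_Ints_cases')
  have nz: "Gamma (real n / 2 + real m) > 0" "Gamma (real n / 2) > 0" using pos by (auto intro: Gamma_real_pos)
  have "S_prefactor n m = of_real (pochhammer (real n - 1) m / pochhammer (real n / 2) m)"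
    by (simp add: S_prefactor_def flip: pochhammer_of_real)
  also have "pochhammer (real n - 1) m / pochhammer (real n / 2) m
     = Gamma (real n - 1 + real m) / Gamma (real n - 1) / (Gamma (real n / 2 + real m) / Gamma (real n / 2))"
    using pos by (simp add: pochhammer_Gamma np)
  finally have S: "S_prefactor n m = of_real (Gamma (real n - 1 + real m) / Gamma (real n - 1) / (Gamma (real n / 2 + real m) / Gamma (real n / 2)))" .
  have "(-1) ^ n * Gamma (of_nat m + of_nat n / 2) / (Gamma (of_nat m) * Gamma (1 - of_nat n / 2) * fact (n - 1))
     = complex_of_real (- (Gamma (real n / 2 + real m) / (Gamma (real m) * Gamma (1 - real n / 2) * fact (n - 1))))"
    using n Gamma_complex_of_real[of "real n / 2 + real m"] Gamma_complex_of_real[of "real m"] Gamma_complex_of_real[of "1 - real n / 2"]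
    by (simp add: add.commute)
  moreover have "S_log_coeff n m = S_prefactor n m * ((-1) ^ n * Gamma (of_nat m + of_nat n / 2) / (Gamma (of_nat m) * Gamma (1 - of_nat n / 2) * fact (n - 1)))"
    using assms by (simp add: S_log_coeff_def)
  ultimately have "S_log_coeff n m = of_real (Gamma (real n - 1 + real m) / Gamma (real n - 1) / (Gamma (real n / 2 + real m) / Gamma (real n / 2)) *
      (- (Gamma (real n / 2 + real m) / (Gamma (real m) * Gamma (1 - real n / 2) * fact (n - 1)))))"
    by (simp only: S of_real_mult)
  also have "Gamma (real n - 1 + real m) / Gamma (real n - 1) / (Gamma (real n / 2 + real m) / Gamma (real n / 2)) *
      (- (Gamma (real n / 2 + real m) / (Gamma (real m) * Gamma (1 - real n / 2) * fact (n - 1))))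
     = - (Gamma (real n - 1 + real m) * Gamma (real n / 2) /
      (Gamma (real n - 1) * Gamma (real m) * Gamma (1 - real n / 2) * fact (n - 1)))"
    using nz by (simp add: divide_simps)
  finally show ?thesis .
qed

lemma S_log_fps_square_nth:
  "fps_nth (geo_pow q * S_log_fps n m ^ 2) j = (if j < 2 * n - 2 then 0 else
     S_log_coeff n m ^ 2 * fps_nth (geo_pow q * F21 (of_nat m + of_nat n - 1) (of_nat n / 2) (of_nat n) ^ 2) (j - (2 * n - 2)))"
proof -
  have "2 * n - 2 = 2 * (n - 1)" using n by simp
  then have "geo_pow q * S_log_fps n m ^ 2 = fps_const (S_log_coeff n m ^ 2) * (fps_X ^ (2 * n - 2) *
     (geo_pow q * F21 (of_nat m + of_nat n - 1) (of_nat n / 2) (of_nat n) ^ 2))"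
    by (simp add: S_log_fps_def power_mult_distrib power_mult[symmetric] mult_ac)
  then show ?thesis
    by (simp only: fps_mult_left_const_nth fps_X_power_mult_nth mult_zero_right split: if_split) simp
qed

text \<open>With \<open>j = 2 n - 2 + k\<close>, reflection turns \<open>Gamma (n/2 - j)\<close>
  into a multiple of \<open>1 / Gamma (3 n/2 + k - 1)\<close>, and its sign \<open>(-1)^j\<close>
  cancels the one from the slope of \<open>rGamma\<close>.\<close>

lemma double_pole_value:
  assumes m: "m \<ge> 1"
  shows "Gamma (of_nat n / 2 - of_nat (2 * n - 2 + k)) / Gamma (of_nat n / 2) * ((-1) ^ (2 * n - 2 + k) * fact (2 * n - 2 + k)) *
       (2 * fps_nth (geo_pow (1 - of_nat m - of_nat n / 2) * S_log_fps n m ^ 2) (2 * n - 2 + k)) = complex_of_real (double_pole_coeff n k m)"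
    and "(-1) ^ ((n - 1) div 2) * double_pole_coeff n k m > 0"
proof -
  define j where "j = 2 * n - 2 + k"
  define H where "H = hypergeo
                 [real m + real n - 1, - real k / 2, (1 - real k) / 2, 1 - real m]
                 [real n, 1 - real n / 2 - real k, (real n + 1) / 2] 1"
  have pos: "real n - 1 > 0" "real n / 2 > 0" "real m > 0" "3 * real n / 2 + real k - 1 > 0" using n m by auto
  have np: "x \<notin> \<int>\<^sub>\<le>\<^sub>0" if "x > 0" for x :: real using that by (auto elim!: nonpos_Ints_cases')
  define q where "q = pochhammer (real n / 2) k / fact k * H"
  have q: "q = fps_nth (geo_pow (real n / 2 - (real m + real n - 1)) * F21 (real m + real n - 1) (real n / 2) (real n) ^ 2) k"
  proof -
    have "n \<ge> 1" using n by simp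
    note b = half_nat_neq[OF this]
    have e: "2 * (real n / 2) = real n" "real n - (real m + real n - 1) = 1 - real m" "real n / 2 + 1 / 2 = (real n + 1) / 2" by simp_all
    show ?thesis
      using F21_square_nth[OF b, of "real m + real n - 1" k] unfolding e by (simp only: q_def H_def)
  qed
  \<comment> \<open>The 4F3 is not inspected term by term: it is a positive Taylor coefficient
    divided by the positive number \<open>(n/2)_k / k!\<close>.\<close>
  have "q > 0" unfolding q by (rule F21_square_quadratic_pos) (use n m in auto)
  moreover have pk: "pochhammer (real n / 2) k = Gamma (real k + real n / 2) / Gamma (real n / 2)"
    using np pos by (simp add: pochhammer_Gamma add.commute)
  moreover have "pochhammer (real n / 2) k / fact k > 0"
    using pochhammer_pos[OF pos(2), of k] by simp
  ultimately have H: "H > 0"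
    unfolding q_def using zero_less_mult_pos by blast
  have G: "Gamma (real n - 1) > 0" "Gamma (real n / 2) > 0" "Gamma (real m) > 0" "Gamma (3 * real n / 2 + real k - 1) > 0"
    "Gamma (real n - 1 + real m) > 0" "Gamma (real k + real n / 2) > 0" "Gamma (1 - real n / 2) \<noteq> 0"
    using pos Gamma_half_neq_0 by (auto intro!: Gamma_real_pos)
  show "(-1) ^ ((n - 1) div 2) * double_pole_coeff n k m > 0"
  proof -
    have "(-1) ^ ((n - 1) div 2) * double_pole_coeff n k m = (2 * pi / fact k) *
               (fact (2 * n + k - 2) / fact (n - 1) ^ 2) *
               (Gamma (real k + real n / 2) / Gamma (1 - real n / 2) ^ 2) *
               (Gamma (real n - 1 + real m) ^ 2 /
                 (Gamma (real n - 1) ^ 2 * Gamma (real m) ^ 2 *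
                  Gamma (3 * real n / 2 + real k - 1))) * H"
      unfolding double_pole_coeff_def H_def by (simp add: mult.assoc[symmetric] power_mult_distrib[symmetric])
    also have "\<dots> > 0"
    proof -
      have "Gamma (1 - real n / 2) ^ 2 > 0" using G(7) by simp
      then show ?thesis
        using G H by (intro mult_pos_pos divide_pos_pos) simp_all
    qed
    finally show ?thesis .
  qed
  have "fps_nth (geo_pow (1 - of_nat m - of_nat n / 2) * S_log_fps n m ^ 2) j = S_log_coeff n m ^ 2 * complex_of_real q"
  proof -
    have "of_real (real n / 2 - (real m + real n - 1)) = 1 - of_nat m - complex_of_nat n / 2" by (simp add: field_simps)
    then have "complex_of_real q = fps_nth (geo_pow (1 - of_nat m - of_nat n / 2) * F21 (of_nat m + of_nat n - 1) (of_nat n / 2) (of_nat n) ^ 2) k"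
      unfolding q of_real_geo_F21_square_nth by simp
    then show ?thesis unfolding S_log_fps_square_nth by (simp add: j_def del: fps_hypergeo_nth)
  qed
  moreover have "Gamma (of_nat n / 2 - of_nat j) = complex_of_real (pi * (-1) ^ ((n - 1) div 2) * (-1) ^ j / Gamma (3 * real n / 2 + real k - 1))"
  proof -
    have "1 - real n / 2 + real j = 3 * real n / 2 + real k - 1" using n by (simp add: j_def of_nat_diff)
    then show ?thesis unfolding Gamma_half_odd_reflection[OF n(1)] by (simp only:)
  qed
  moreover have "Gamma (of_nat n / 2) = complex_of_real (Gamma (real n / 2))"
    using Gamma_complex_of_real[of "real n / 2"] by simp
  ultimately have "Gamma (of_nat n / 2 - of_nat j) / Gamma (of_nat n / 2) * ((-1) ^ j * fact j) *
       (2 * fps_nth (geo_pow (1 - of_nat m - of_nat n / 2) * S_log_fps n m ^ 2) j)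
    = complex_of_real (pi * (-1) ^ ((n - 1) div 2) * (-1) ^ j / Gamma (3 * real n / 2 + real k - 1) / Gamma (real n / 2) * ((-1) ^ j * fact j) *
       (2 * ((- (Gamma (real n - 1 + real m) * Gamma (real n / 2) /
      (Gamma (real n - 1) * Gamma (real m) * Gamma (1 - real n / 2) * fact (n - 1)))) ^ 2 * q)))"
    unfolding S_log_coeff_real[OF m] by simp
  also have "pi * (-1) ^ ((n - 1) div 2) * (-1) ^ j / Gamma (3 * real n / 2 + real k - 1) / Gamma (real n / 2) * ((-1) ^ j * fact j) *
       (2 * ((- (Gamma (real n - 1 + real m) * Gamma (real n / 2) /
      (Gamma (real n - 1) * Gamma (real m) * Gamma (1 - real n / 2) * fact (n - 1)))) ^ 2 * q)) = double_pole_coeff n k m"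
  proof -
    \<comment> \<open>Gamma values and factorials are replaced by variables, which leaves a field
      identity; \<open>s\<close> plays the role of \<open>(-1)^j\<close>.\<close>
    have alg: "pi * e * s / D / g * (s * fj) * (2 * ((- (A * g / (B * C * g1 * f))) ^ 2 * (Gk / g / fk * H)))
       = e * (2 * pi / fk) * (fj / f ^ 2) * (Gk / g1 ^ 2) * (A ^ 2 / (B ^ 2 * C ^ 2 * D)) * H"
      if "s * s = 1" "g \<noteq> 0" "D \<noteq> 0" "B \<noteq> 0" "C \<noteq> 0" "g1 \<noteq> 0" "f \<noteq> 0" "fk \<noteq> 0" for e s D g fj A B C g1 f Gk fk H :: real
    proof -
      have "pi * e * s / D / g * (s * fj) * (2 * ((- (A * g / (B * C * g1 * f))) ^ 2 * (Gk / g / fk * H)))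
       = (s * s) * (pi * e / D / g * fj * (2 * ((A * g / (B * C * g1 * f)) ^ 2 * (Gk / g / fk * H))))"
        by (simp add: mult_ac)
      then show ?thesis
        unfolding that(1) using that(2-) by (simp add: divide_simps power2_eq_square)
    qed
    have "2 * n - 2 + k = 2 * n + k - 2" using n by simp
    then have "j = 2 * n + k - 2" by (simp add: j_def)
    moreover have "(-1 :: real) ^ j * (-1) ^ j = 1" by (simp flip: power_mult_distrib)
    ultimately show ?thesis
      unfolding double_pole_coeff_def H_def[symmetric] q_def pk using G by (intro alg[THEN trans]) auto
  qed
  finally show "Gamma (of_nat n / 2 - of_nat (2 * n - 2 + k)) / Gamma (of_nat n / 2) * ((-1) ^ (2 * n - 2 + k) * fact (2 * n - 2 + k)) *
       (2 * fps_nth (geo_pow (1 - of_nat m - of_nat n / 2) * S_log_fps n m ^ 2) (2 * n - 2 + k)) = complex_of_real (double_pole_coeff n k m)"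
    unfolding j_def .
qed

lemma double_pole_limit:
  assumes "m \<ge> 1"
  shows "((\<lambda>s. (s + 2 * of_nat n - 1 + of_nat k) ^ 2 * I_fun n m s) \<longlongrightarrow> complex_of_real (double_pole_coeff n k m))
     (at (- 2 * of_nat n + 1 - of_nat k))"
proof -
  have "of_nat (2 * n - 2 + k) = 2 * complex_of_nat n - 2 + of_nat k" using n by (simp add: of_nat_diff)
  then have "- of_nat (2 * n - 2 + k) - 1 = - 2 * complex_of_nat n + 1 - of_nat k"
    "s + of_nat (2 * n - 2 + k) + 1 = s + 2 * of_nat n - 1 + of_nat k" for s :: complex
    by simp_all
  then show ?thesis
    using I_fun_double_limits(2)[OF n, of "2 * n - 2 + k" m] unfolding double_pole_value(1)[OF assms] by (simp only:)
qed

lemma laurent_coeff_I_fun: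
  "laurent_coeff n 2 m (- 2 * of_nat n + 1 - of_nat k) = (if m = 0 then 0 else complex_of_real (double_pole_coeff n k m))"
  "(\<And>k. s0 \<noteq> - 2 * of_nat n + 1 - of_nat k) \<Longrightarrow> laurent_coeff n 2 m s0 = 0"
proof -
  have mero: "I_fun n m meromorphic_on {z}" for z
    using I_fun_double_limits(1)[OF n] by (rule meromorphic_on_subset) simp
  have coeff: "laurent_coeff n 2 m z = L" if "((\<lambda>s. (s - z) ^ 2 * I_fun n m s) \<longlongrightarrow> L) (at z)" for z L
    using laurent_coeff_2_eqI[OF mero that] by (simp add: laurent_coeff_def)
  \<comment> \<open>Two causes for a vanishing coefficient: the squared logarithm starts at
    \<open>x^(2n-2)\<close>, and for \<open>m = 0\<close> there is no logarithm.\<close>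
  have low: "laurent_coeff n 2 m (- of_nat j - 1) = 0" if "j < 2 * n - 2 \<or> m = 0" for j
  proof (rule coeff)
    have "fps_nth (geo_pow (1 - of_nat m - of_nat n / 2) * S_log_fps n m ^ 2) j = 0"
      unfolding S_log_fps_square_nth using that by (auto simp: S_log_coeff_def)
    then show "((\<lambda>s. (s - (- of_nat j - 1)) ^ 2 * I_fun n m s) \<longlongrightarrow> 0) (at (- of_nat j - 1))"
      using I_fun_double_limits(2)[OF n, of j m] by (simp add: algebra_simps del: fps_hypergeo_nth)
  qed
  have j: "- of_nat (2 * n - 2 + k) - 1 = - 2 * complex_of_nat n + 1 - of_nat k" for k
    using n by (simp add: of_nat_diff)
  show "laurent_coeff n 2 m (- 2 * of_nat n + 1 - of_nat k) = (if m = 0 then 0 else complex_of_real (double_pole_coeff n k m))"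
  proof (cases "m = 0")
    case True
    then show ?thesis using low[of "2 * n - 2 + k"] unfolding j by simp
  next
    case False
    have "laurent_coeff n 2 m (- 2 * of_nat n + 1 - of_nat k) = complex_of_real (double_pole_coeff n k m)"
    proof (rule coeff)
      have "s - (- 2 * of_nat n + 1 - of_nat k) = s + 2 * of_nat n - 1 + of_nat k" for s :: complex by simp
      then show "((\<lambda>s. (s - (- 2 * of_nat n + 1 - of_nat k)) ^ 2 * I_fun n m s) \<longlongrightarrow> complex_of_real (double_pole_coeff n k m))
         (at (- 2 * of_nat n + 1 - of_nat k))"
        using double_pole_limit[of m k] False by (simp only:)
    qed
    then show ?thesis using False by simp
  qed
  show "laurent_coeff n 2 m s0 = 0" if s0: "\<And>k. s0 \<noteq> - 2 * of_nat n + 1 - of_nat k"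
  proof (cases "\<exists>j. s0 = - of_nat j - 1")
    case True
    then obtain i where i: "s0 = - of_nat i - 1" by blast
    have "i < 2 * n - 2"
    proof (rule ccontr)
      assume "\<not> i < 2 * n - 2"
      then have "i = 2 * n - 2 + (i - (2 * n - 2))" by simp
      then show False using s0[of "i - (2 * n - 2)"] j[of "i - (2 * n - 2)"] i by metis
    qed
    then show ?thesis using low i by simp
  next
    case False
    then show ?thesis using I_fun_double_limits(3)[OF n, of s0 m] by (intro coeff) auto
  qed
qed

end

theorem theorem4p5:
  fixes n :: nat
  assumes "n \<ge> 3" and "odd n"
  shows "(\<forall>k m :: nat. m \<ge> 1 \<longrightarrow>
           ((\<lambda>s. (s + 2 * of_nat n - 1 + of_nat k) ^ 2 * I_fun n m s) \<longlongrightarrow>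
             complex_of_real
              ((-1) ^ ((n - 1) div 2) * (2 * pi / fact k) *
               (fact (2 * n + k - 2) / fact (n - 1) ^ 2) *
               (Gamma (real k + real n / 2) / Gamma (1 - real n / 2) ^ 2) *
               (Gamma (real n - 1 + real m) ^ 2 /
                 (Gamma (real n - 1) ^ 2 * Gamma (real m) ^ 2 *
                  Gamma (3 * real n / 2 + real k - 1))) *
               hypergeo
                 [real m + real n - 1, - real k / 2, (1 - real k) / 2, 1 - real m]
                 [real n, 1 - real n / 2 - real k, (real n + 1) / 2] 1))
             (at (- 2 * of_nat n + 1 - of_nat k)))
         \<and> discrete_Wallach n 2 = {- 2 * of_nat n + 1 - of_nat k | k :: nat. True}"
proof (intro conjI allI impI)
  note n = assms(2,1)
  show "((\<lambda>s. (s + 2 * of_nat n - 1 + of_nat k) ^ 2 * I_fun n m s) \<longlongrightarrow>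
             complex_of_real
              ((-1) ^ ((n - 1) div 2) * (2 * pi / fact k) *
               (fact (2 * n + k - 2) / fact (n - 1) ^ 2) *
               (Gamma (real k + real n / 2) / Gamma (1 - real n / 2) ^ 2) *
               (Gamma (real n - 1 + real m) ^ 2 /
                 (Gamma (real n - 1) ^ 2 * Gamma (real m) ^ 2 *
                  Gamma (3 * real n / 2 + real k - 1))) *
               hypergeo
                 [real m + real n - 1, - real k / 2, (1 - real k) / 2, 1 - real m]
                 [real n, 1 - real n / 2 - real k, (real n + 1) / 2] 1))
             (at (- 2 * of_nat n + 1 - of_nat k))" if "m \<ge> 1" for k m
    using double_pole_limit[OF n that, of k] unfolding double_pole_coeff_def .
  show "discrete_Wallach n 2 = {- 2 * of_nat n + 1 - of_nat k | k :: nat. True}"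
  proof (intro equalityI subsetI)
    fix s0 assume "s0 \<in> discrete_Wallach n 2"
    then obtain m where "laurent_coeff n 2 m s0 \<noteq> 0" by (auto simp: discrete_Wallach_def)
    then show "s0 \<in> {- 2 * of_nat n + 1 - of_nat k | k :: nat. True}"
      using laurent_coeff_I_fun(2)[OF n, of s0 m] by blast
  next
    fix s0 :: complex assume "s0 \<in> {- 2 * of_nat n + 1 - of_nat k | k :: nat. True}"
    then obtain k where s0: "s0 = - 2 * of_nat n + 1 - of_nat k" by blast
    have sgn: "(-1) ^ ((n - 1) div 2) * double_pole_coeff n k m > 0" if "m \<ge> 1" for m
      using double_pole_value(2)[OF n that] .
    have nz: "double_pole_coeff n k 1 \<noteq> 0" using sgn[of 1] by auto
    \<comment> \<open>The index \<open>m = 1\<close> serves as witness, since the coefficient is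
      zero for \<open>m = 0\<close> and nonzero for all \<open>m >= 1\<close>.\<close>
    have "is_pole (I_fun n 1) s0"
    proof (rule is_pole_if_double_limit)
      have "s - s0 = s + 2 * of_nat n - 1 + of_nat k" for s by (simp add: s0)
      then show "((\<lambda>s. (s - s0) ^ 2 * I_fun n 1 s) \<longlongrightarrow> complex_of_real (double_pole_coeff n k 1)) (at s0)"
        using double_pole_limit[OF n order_refl, of k] unfolding s0 by (simp only:)
    qed (use nz in simp)
    moreover have "laurent_coeff n 2 1 s0 \<noteq> 0"
      using nz unfolding s0 laurent_coeff_I_fun(1)[OF n] by simp
    \<comment> \<open>The common sign depends on \<open>n\<close> alone, and the zero at
      \<open>m = 0\<close> fits either alternative.\<close>
    moreover have "(\<forall>m. laurent_coeff n 2 m s0 \<in> \<real>\<^sub>\<ge>\<^sub>0) \<or> (\<forall>m. laurent_coeff n 2 m s0 \<in> \<real>\<^sub>\<le>\<^sub>0)"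
    proof (cases "even ((n - 1) div 2)")
      case True
      then have "double_pole_coeff n k m \<ge> 0" if "m \<noteq> 0" for m using sgn[of m] that by simp
      then show ?thesis unfolding s0 laurent_coeff_I_fun(1)[OF n] by auto
    next
      case False
      then have "double_pole_coeff n k m \<le> 0" if "m \<noteq> 0" for m using sgn[of m] that by simp
      then show ?thesis unfolding s0 laurent_coeff_I_fun(1)[OF n] by auto
    qed
    ultimately show "s0 \<in> discrete_Wallach n 2"
      unfolding discrete_Wallach_def by blast
  qed
qed

end
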